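(* Let $N\ge 1$ and let $f\in C^1([0,\infty))\cap C^2((0,\infty))$ satisfy $f(0)=0$, and $f(u)>0$, $f'(u)>0$, $f''(u)>0$ for all $u>0$, and $$F(u):=\int_u^\infty \frac{ds}{f(s)}<\infty\quad\text{for all } u>0 .$$ Assume that the limit $q:=\lim_{s\to+0}f'(s)F(s)$ exists and satisfies $q<1+\frac N2$. If $q=1$, assume furthermore that there exists a constant $s_0>0$ such that $f'(s)F(s)\ge1$ for $0<s<s_0$. Then there exist $\gamma_*>0$ and $q_*,q^*$ with $1\le q_*\le q\le q^*<1+N/2$ such that for every $\gamma\in(0,\gamma_* )$ the problem $$\partial_t u=\Delta u+f(u)\ \text{ in } \mathbb{R}^N\times(0,\infty),\qquad u(x,0)=u_0(x):=F^{-1}\bigl[\gamma^{-1}(|x|^2+1)\bigr]\ \text{ in } \mathbb{R}^N,$$ has a global in time solution $u$, and this solution satisfies $$\frac{|y|^2}{F(W_*(y))}\le\frac{|x|^2}{F(u(x,t))}\le\frac{|y|^2}{F(W^*(y))},\qquad y=\frac{x}{\sqrt{t+1}},$$ for all $(x,t)\in\mathbb{R}^N\times[0,\infty)$, where $W_*$ and $W^*$ are some positive $C^2$ functions on $\mathbb{R}^N$ solving $$\Delta W+\frac y2\cdot\nabla W+f(W)F(W)+f(W)+\frac{|\nabla W|^2}{f(W)F(W)}\Bigl[\tilde q-f'(W)F(W)\Bigr]=0,\qquad y\in\mathbb{R}^N,$$ with $\tilde q=q_*$ for $W=W_*$ and with $\tilde q=q^*$ for $W=W^*$.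
   Context: Under the hypotheses on $f$, the function $F:(0,\infty)\to(0,\infty)$ is a strictly decreasing bijection (with $F(u)\to\infty$ as $u\to+0$ and $F(u)\to0$ as $u\to\infty$), and $F^{-1}:(0,\infty)\to(0,\infty)$ denotes its inverse. Existence of the limit $q$ means existence as a real number. A global in time solution (for a bounded continuous nonnegative $u_0$) is a nonnegative function $u\in C^{2,1}(\mathbb{R}^N\times(0,\infty))\cap C(\mathbb{R}^N\times[0,\infty))$, bounded on $\mathbb{R}^N\times[0,T]$ for every $T<\infty$, satisfying the equation pointwise for $t>0$ and $u(\cdot,0)=u_0$. *)

theory Defs
  imports "HOL-Analysis.Analysis"
begin

text \<open>The derivatives are taken within the set, so they are one-sided at boundary points such as
  \<open>0\<close> in \<open>{0..}\<close>; on open sets they agree with \<open>deriv\<close>.\<close>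

definition C1_on :: "real set \<Rightarrow> (real \<Rightarrow> real) \<Rightarrow> bool" where
  "C1_on S f \<longleftrightarrow>
    (\<exists>f'. (\<forall>x\<in>S. (f has_real_derivative f' x) (at x within S)) \<and> continuous_on S f')"

definition C2_on :: "real set \<Rightarrow> (real \<Rightarrow> real) \<Rightarrow> bool" where
  "C2_on S f \<longleftrightarrow>
    (\<exists>f'. (\<forall>x\<in>S. (f has_real_derivative f' x) (at x within S)) \<and> C1_on S f')"

text \<open>For \<open>f\<close> as in the theorem, \<open>1 / f\<close> is not integrable at \<open>0\<close>, so \<open>tail_int f 0 = 0\<close> instead of
  \<open>\<infinity>\<close>; a quotient \<open>a / tail_int f 0\<close> is still \<open>0\<close>, as it is for the value \<open>\<infinity>\<close>.\<close>

definition tail_int :: "(real \<Rightarrow> real) \<Rightarrow> real \<Rightarrow> real" where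
  "tail_int f u = (LBINT s:{u..}. 1 / f s)"

definition tail_int_inv :: "(real \<Rightarrow> real) \<Rightarrow> real \<Rightarrow> real" where
  "tail_int_inv f = the_inv_into {0<..} (tail_int f)"

definition partial_deriv :: "'n \<Rightarrow> (real^'n \<Rightarrow> real) \<Rightarrow> real^('n::finite) \<Rightarrow> real" where
  "partial_deriv i w x = deriv (\<lambda>s. w (x + s *\<^sub>R axis i 1)) 0"

definition has_partial_derivs :: "(real^('n::finite) \<Rightarrow> real) \<Rightarrow> bool" where
  "has_partial_derivs w \<longleftrightarrow>
    (\<forall>i x. (\<lambda>s. w (x + s *\<^sub>R axis i 1)) field_differentiable (at 0))"

definition grad :: "(real^('n::finite) \<Rightarrow> real) \<Rightarrow> real^'n \<Rightarrow> real^'n" where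
  "grad w x = (\<chi> i. partial_deriv i w x)"

definition laplacian :: "(real^('n::finite) \<Rightarrow> real) \<Rightarrow> real^'n \<Rightarrow> real" where
  "laplacian w x = (\<Sum>i\<in>UNIV. partial_deriv i (partial_deriv i w) x)"

definition C2_space :: "(real^('n::finite) \<Rightarrow> real) \<Rightarrow> bool" where
  "C2_space w \<longleftrightarrow>
    continuous_on UNIV w \<and>
    has_partial_derivs w \<and> (\<forall>i. continuous_on UNIV (partial_deriv i w)) \<and>
    (\<forall>i. has_partial_derivs (partial_deriv i w)) \<and>
    (\<forall>i j. continuous_on UNIV (partial_deriv j (partial_deriv i w)))"

text \<open>\<open>C\<^sup>2\<^sup>,\<^sup>1(\<real>\<^sup>N \<times> (0,\<infty>))\<close>: the derivatives exist pointwise and are jointly continuous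
  in \<open>(x,t)\<close>.\<close>

definition C21 :: "(real^('n::finite) \<Rightarrow> real \<Rightarrow> real) \<Rightarrow> bool" where
  "C21 u \<longleftrightarrow>
    continuous_on (UNIV \<times> {0<..}) (\<lambda>(x, t). u x t) \<and>
    (\<forall>x. \<forall>t>0. u x field_differentiable (at t)) \<and>
    continuous_on (UNIV \<times> {0<..}) (\<lambda>(x, t). deriv (u x) t) \<and>
    (\<forall>t>0. has_partial_derivs (\<lambda>x. u x t)) \<and>
    (\<forall>i. continuous_on (UNIV \<times> {0<..}) (\<lambda>(x, t). partial_deriv i (\<lambda>x. u x t) x)) \<and>
    (\<forall>t>0. \<forall>i. has_partial_derivs (partial_deriv i (\<lambda>x. u x t))) \<and>
    (\<forall>i j. continuous_on (UNIV \<times> {0<..})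
       (\<lambda>(x, t). partial_deriv j (partial_deriv i (\<lambda>x. u x t)) x))"

definition global_solution ::
  "(real \<Rightarrow> real) \<Rightarrow> (real^('n::finite) \<Rightarrow> real) \<Rightarrow> (real^'n \<Rightarrow> real \<Rightarrow> real) \<Rightarrow> bool" where
  "global_solution f u0 u \<longleftrightarrow>
    C21 u \<and>
    continuous_on (UNIV \<times> {0..}) (\<lambda>(x, t). u x t) \<and>
    (\<forall>x. \<forall>t\<ge>0. 0 \<le> u x t) \<and>
    (\<forall>T. bounded ((\<lambda>(x, t). u x t) ` (UNIV \<times> {0..T}))) \<and>
    (\<forall>x. \<forall>t>0. deriv (u x) t = laplacian (\<lambda>x. u x t) x + f (u x t)) \<and>
    (\<forall>x. u x 0 = u0 x)"

definition profile_solution ::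
  "(real \<Rightarrow> real) \<Rightarrow> real \<Rightarrow> (real^('n::finite) \<Rightarrow> real) \<Rightarrow> bool" where
  "profile_solution f qt W \<longleftrightarrow>
    C2_space W \<and> (\<forall>y. 0 < W y) \<and>
    (\<forall>y. laplacian W y + (y /\<^sub>R 2) \<bullet> grad W y
         + f (W y) * tail_int f (W y) + f (W y)
         + (norm (grad W y))\<^sup>2 / (f (W y) * tail_int f (W y))
             * (qt - deriv f (W y) * tail_int f (W y)) = 0)"

end

theory Submission
  imports Defs "HOL-Probability.Probability"
begin

text \<open>For the exponent \<open>q\<close> write \<open>F (W y) = P (\<bar>y\<bar>\<^sup>2)\<close>. The profile equation turns into an ordinary
  differential equation for \<open>P\<close> that does not involve \<open>f\<close>, and the forward self-similar function
  \<open>v x t = F\<^bsup>-1\<^esup> ((t + 1) P (\<bar>x\<bar>\<^sup>2 / (t + 1)))\<close> satisfies \<open>v\<^sub>t - \<Delta> v - f v = c (q - f' v F v)\<close> with \<open>c \<ge> 0\<close>. Since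
  \<open>f' F \<ge> 1\<close> near \<open>0\<close>, the exponent \<open>1\<close> gives subsolutions, and any exponent in \<open>(q, 1 + N/2)\<close> gives
  supersolutions, provided that the profiles are large (that is, \<open>v\<close> is small). The profiles behave
  linearly: \<open>P s \<ge> P 0 (1 + s / (2 N))\<close> always, and \<open>P s \<le> C P 0 (1 + s)\<close> below the Fujita exponent
  \<open>1 + N/2\<close>, so they can be placed on either side of the initial datum. The solution itself comes from
  Picard iteration of the Duhamel formula for a globally Lipschitz modification of \<open>f\<close>; comparison
  keeps it between the two barriers, where the modification is invisible.\<close>

section \<open>Partial derivatives and the comparison principle\<close>

text \<open>The obstacle is that f' F is not constant. With w = F(v) the equation v_t = \<Delta> v +
  f(v) reads w_t = \<Delta> w - 1 - f'(v) |\<nabla> w|^2. Freezing f'(v) w at a constant q leaves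
  w_t = \<Delta> w - 1 - q |\<nabla> w|^2 / w, which is invariant under parabolic scaling; this is
  the origin of the self-similar form. Since f' F may oscillate around its limit, q itself is in
  general no admissible frozen exponent, and two different exponents enclose it. The required signs
  of q - f' F are known only near 0, that is for large F(v), and this is what forces \<gamma> to be
  small.\<close>

definition has_pd :: "'n \<Rightarrow> (real^('n::finite) \<Rightarrow> real) \<Rightarrow> real^'n \<Rightarrow> real \<Rightarrow> bool" where
  "has_pd i w x D \<longleftrightarrow> ((\<lambda>s. w (x + s *\<^sub>R axis i 1)) has_real_derivative D) (at 0)"

lemma has_pd_imp_partial_deriv: "has_pd i w x D \<Longrightarrow> partial_deriv i w x = D"
  unfolding has_pd_def partial_deriv_def by (rule DERIV_imp_deriv)

lemma has_partial_derivsI: "(\<And>i x. has_pd i w x (D i x)) \<Longrightarrow> has_partial_derivs w"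
  unfolding has_partial_derivs_def has_pd_def field_differentiable_def by blast

lemma partial_deriv_eqI: "(\<And>x. has_pd i w x (D x)) \<Longrightarrow> partial_deriv i w = D"
  by (rule ext) (rule has_pd_imp_partial_deriv)

lemma has_pd_along_line:
  "has_pd i w (x + h *\<^sub>R axis i 1) D \<longleftrightarrow>
     ((\<lambda>s. w (x + s *\<^sub>R axis i 1)) has_real_derivative D) (at h)"
  using DERIV_shift[of "\<lambda>s. w (x + s *\<^sub>R axis i 1)" D 0 h]
  by (simp add: has_pd_def scaleR_add_left algebra_simps)

lemma has_pd_const: "has_pd i (\<lambda>x. c) x 0"
  unfolding has_pd_def by (rule DERIV_const)

lemma has_pd_component: "has_pd i (\<lambda>x. x $ j) x (if i = j then 1 else 0)"
proof -
  have "((\<lambda>s. x $ j + s * (axis i 1 $ j)) has_real_derivative (axis i 1 $ j)) (at 0)"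
    by (auto intro!: derivative_eq_intros)
  then show ?thesis
    unfolding has_pd_def by (simp only: vector_add_component vector_scaleR_component real_scaleR_def)
      (simp add: axis_def eq_commute)
qed

lemma has_pd_add: "has_pd i v x a \<Longrightarrow> has_pd i w x b \<Longrightarrow> has_pd i (\<lambda>x. v x + w x) x (a + b)"
  unfolding has_pd_def by (rule DERIV_add)

lemma has_pd_diff: "has_pd i v x a \<Longrightarrow> has_pd i w x b \<Longrightarrow> has_pd i (\<lambda>x. v x - w x) x (a - b)"
  unfolding has_pd_def by (rule DERIV_diff)

lemma has_pd_mult:
  "has_pd i v x a \<Longrightarrow> has_pd i w x b \<Longrightarrow> has_pd i (\<lambda>x. v x * w x) x (a * w x + b * v x)"
  unfolding has_pd_def by (drule (1) DERIV_mult) simp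

lemma has_pd_compose:
  assumes "(\<phi> has_real_derivative c) (at (w x))" "has_pd i w x a"
  shows "has_pd i (\<lambda>x. \<phi> (w x)) x (c * a)"
  using DERIV_chain2[of \<phi> c "\<lambda>s. w (x + s *\<^sub>R axis i 1)" 0 a UNIV] assms
  by (simp add: has_pd_def)

section \<open>Functions of the squared norm\<close>

lemma norm_add_axis_sq:
  fixes x :: "real^'n::finite"
  shows "(norm (x + s *\<^sub>R axis i 1))\<^sup>2 = (norm x)\<^sup>2 + 2 * s * x $ i + s\<^sup>2"
proof -
  have "axis i (1::real) \<bullet> axis i 1 = 1" by (simp add: inner_axis_axis)
  then show ?thesis
    by (simp only: power2_norm_eq_inner inner_add_left inner_add_right inner_scaleR_left
        inner_scaleR_right inner_axis inner_axis' inner_real_def) (simp add: power2_eq_square algebra_simps)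
qed

text \<open>Profiles are functions of |x|^2 rather than of |x|: regularity at the origin is then
  automatic. A one-sided derivative of \<open>\<Phi>\<close> at 0 suffices because the squared norm
  never leaves \<open>{0..}\<close>, which is why the chain rule is used on the image.\<close>

lemma has_pd_radial:
  fixes x :: "real^'n::finite"
  assumes "\<And>s. s \<ge> 0 \<Longrightarrow> (\<Phi> has_real_derivative \<Phi>1 s) (at s within {0..})"
  shows "has_pd i (\<lambda>x. \<Phi> ((norm x)\<^sup>2)) x (2 * x $ i * \<Phi>1 ((norm x)\<^sup>2))"
proof -
  let ?g = "\<lambda>s. (norm (x + s *\<^sub>R axis i 1))\<^sup>2"
  have g: "(?g has_real_derivative 2 * x $ i) (at 0)"
    unfolding norm_add_axis_sq by (auto intro!: derivative_eq_intros)
  have "(\<Phi> has_real_derivative \<Phi>1 (?g 0)) (at (?g 0) within range ?g)"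
    by (rule has_field_derivative_subset[OF assms]) auto
  from DERIV_image_chain[OF this g] show ?thesis
    by (simp add: has_pd_def o_def mult.commute)
qed

lemma has_pd_radial2:
  fixes x :: "real^'n::finite"
  assumes "\<And>s. s \<ge> 0 \<Longrightarrow> (\<Phi>1 has_real_derivative \<Phi>2 s) (at s within {0..})"
  shows "has_pd j (\<lambda>x. 2 * x $ i * \<Phi>1 ((norm x)\<^sup>2)) x
     (4 * x $ i * x $ j * \<Phi>2 ((norm x)\<^sup>2) + (if i = j then 2 * \<Phi>1 ((norm x)\<^sup>2) else 0))"
proof -
  have "has_pd j (\<lambda>x. 2 * x $ i) x (2 * (if j = i then 1 else 0))"
    using has_pd_mult[OF has_pd_const[of j 2 x] has_pd_component[of j i x]]
    by (simp add: mult.commute)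
  from has_pd_mult[OF this has_pd_radial[OF assms]] show ?thesis
    by (rule back_subst[where P = "has_pd j _ x"]) (auto simp: algebra_simps)
qed

lemma sum_component_sq:
  fixes x :: "real^'n::finite"
  shows "(\<Sum>i\<in>UNIV. x $ i * x $ i) = (norm x)\<^sup>2"
  by (simp add: power2_norm_eq_inner inner_vec_def)

lemma laplacian_radial:
  fixes x :: "real^'n::finite"
  assumes 1: "\<And>s. s \<ge> 0 \<Longrightarrow> (\<Phi> has_real_derivative \<Phi>1 s) (at s within {0..})"
    and 2: "\<And>s. s \<ge> 0 \<Longrightarrow> (\<Phi>1 has_real_derivative \<Phi>2 s) (at s within {0..})"
  shows "laplacian (\<lambda>x. \<Phi> ((norm x)\<^sup>2)) x =
     4 * (norm x)\<^sup>2 * \<Phi>2 ((norm x)\<^sup>2) + 2 * real CARD('n) * \<Phi>1 ((norm x)\<^sup>2)"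
proof -
  have *: "partial_deriv i (\<lambda>x. \<Phi> ((norm x)\<^sup>2)) = (\<lambda>x. 2 * x $ i * \<Phi>1 ((norm x)\<^sup>2))" for i
    by (rule partial_deriv_eqI) (rule has_pd_radial[OF 1])
  have "partial_deriv i (\<lambda>x. 2 * x $ i * \<Phi>1 ((norm x)\<^sup>2)) x =
     4 * \<Phi>2 ((norm x)\<^sup>2) * (x $ i * x $ i) + 2 * \<Phi>1 ((norm x)\<^sup>2)" for i
    using has_pd_imp_partial_deriv[OF has_pd_radial2[OF 2, of i i x]] by (simp add: mult_ac)
  then show ?thesis
    unfolding laplacian_def * by (simp add: sum.distrib flip: sum_distrib_left sum_component_sq)
qed

lemma C2_spaceI:
  assumes c: "continuous_on UNIV w"
    and d: "\<And>i x. has_pd i w x (D i x)" "\<And>i. continuous_on UNIV (D i)"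
    and dd: "\<And>i j x. has_pd j (D i) x (DD i j x)" "\<And>i j. continuous_on UNIV (DD i j)"
  shows "C2_space w"
proof -
  have "partial_deriv i w = D i" for i by (rule partial_deriv_eqI) (rule d)
  moreover have "partial_deriv j (D i) = DD i j" for i j by (rule partial_deriv_eqI) (rule dd)
  moreover have "has_partial_derivs w" by (rule has_partial_derivsI) (rule d)
  moreover have "has_partial_derivs (D i)" for i by (rule has_partial_derivsI) (rule dd)
  ultimately show ?thesis using c d dd unfolding C2_space_def by simp
qed

lemma C2_space_radial:
  fixes \<Phi> :: "real \<Rightarrow> real"
  assumes 1: "\<And>s. s \<ge> 0 \<Longrightarrow> (\<Phi> has_real_derivative \<Phi>1 s) (at s within {0..})"
    and 2: "\<And>s. s \<ge> 0 \<Longrightarrow> (\<Phi>1 has_real_derivative \<Phi>2 s) (at s within {0..})"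
    and 3: "continuous_on {0..} \<Phi>2"
  shows "C2_space (\<lambda>x::real^'n::finite. \<Phi> ((norm x)\<^sup>2))"
proof -
  have sq: "continuous_on UNIV (\<lambda>x::real^'n. (norm x)\<^sup>2)" by (intro continuous_intros)
  have c: "continuous_on UNIV (\<lambda>x::real^'n. \<phi> ((norm x)\<^sup>2))" if "continuous_on {0..} \<phi>" for \<phi> :: "real \<Rightarrow> real"
    by (rule continuous_on_compose2[OF that sq]) auto
  note cs = c[OF DERIV_continuous_on[of "{0..}" \<Phi> \<Phi>1]] c[OF DERIV_continuous_on[of "{0..}" \<Phi>1 \<Phi>2]] c[OF 3]
  have if_cont: "continuous_on UNIV (\<lambda>x::real^'n. if i = j then u x else 0)"
    if "continuous_on UNIV u" for i j :: 'n and u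
    using that by (cases "i = j") auto
  show ?thesis
    by (rule C2_spaceI[OF _ has_pd_radial[OF 1] _ has_pd_radial2[OF 2]])
       (auto intro!: continuous_intros if_cont cs 1 2)
qed

section \<open>Parabolic comparison on the whole space\<close>

lemma second_derivative_at_max_nonpos:
  fixes \<sigma> :: "real \<Rightarrow> real"
  assumes 1: "\<And>r. (\<sigma> has_real_derivative \<sigma>1 r) (at r)"
    and 2: "(\<sigma>1 has_real_derivative c) (at 0)" and max: "\<And>r. \<sigma> r \<le> \<sigma> 0"
  shows "c \<le> 0"
proof (rule ccontr)
  assume "\<not> c \<le> 0"
  have "\<sigma>1 0 = 0" using DERIV_local_max[OF 1[of 0], of 1] max by simp
  obtain \<delta> where \<delta>: "\<delta> > 0" "\<And>h. h > 0 \<Longrightarrow> h < \<delta> \<Longrightarrow> \<sigma>1 0 < \<sigma>1 h"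
    using DERIV_pos_inc_right[OF 2] \<open>\<not> c \<le> 0\<close> by auto
  have "\<sigma> 0 < \<sigma> (\<delta>/2)"
  proof (rule DERIV_pos_imp_increasing_open[of 0 "\<delta>/2" \<sigma>])
    show "\<exists>y. DERIV \<sigma> r :> y \<and> 0 < y" if "0 < r" "r < \<delta>/2" for r
      using that \<delta> 1 \<open>\<sigma>1 0 = 0\<close> by force
    show "continuous_on {0..\<delta>/2} \<sigma>"
      by (rule DERIV_continuous_on, rule has_field_derivative_at_within, rule 1)
  qed (use \<delta> in simp)
  with max[of "\<delta>/2"] show False by simp
qed

text \<open>Multiplying by exp(-K t) absorbs the zeroth order term, and subtracting \<epsilon> (1 +
  |x|^2 + (2 N + 1) t) forces the maximum over the unbounded space to be attained. The time slope 2
  N + 1 exceeds the Laplacian 2 N of |x|^2, so the penalty is a strict supersolution of the heat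
  equation and a positive maximum at a positive time is impossible. At such a maximum d is positive,
  so the differential inequality is only asked for there.\<close>

lemma comparison_principle:
  fixes d dt :: "real^'n::finite \<Rightarrow> real \<Rightarrow> real" and D DD :: "'n \<Rightarrow> real^'n \<Rightarrow> real \<Rightarrow> real"
  assumes cont: "continuous_on (UNIV \<times> {0..T}) (\<lambda>(x, t). d x t)"
    and bdd: "\<And>x t. 0 \<le> t \<Longrightarrow> t \<le> T \<Longrightarrow> d x t \<le> B"
    and init: "\<And>x. d x 0 \<le> 0"
    and dt: "\<And>x t. 0 < t \<Longrightarrow> t \<le> T \<Longrightarrow> (d x has_real_derivative dt x t) (at t)"
    and D: "\<And>i x t. 0 < t \<Longrightarrow> t \<le> T \<Longrightarrow> has_pd i (\<lambda>x. d x t) x (D i x t)"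
    and DD: "\<And>i x t. 0 < t \<Longrightarrow> t \<le> T \<Longrightarrow> has_pd i (\<lambda>x. D i x t) x (DD i x t)"
    and ineq: "\<And>x t. 0 < t \<Longrightarrow> t \<le> T \<Longrightarrow> d x t > 0 \<Longrightarrow> dt x t \<le> (\<Sum>i\<in>UNIV. DD i x t) + K * d x t"
    and K: "K \<ge> 0" and t: "0 \<le> t0" "t0 \<le> T"
  shows "d x0 t0 \<le> 0"
proof (rule ccontr)
  assume "\<not> d x0 t0 \<le> 0"
  then have pos: "d x0 t0 > 0" by simp
  let ?N = "real CARD('n)"
  define m where "m = exp (- K * t0) * d x0 t0"
  have m: "m > 0" using pos by (simp add: m_def)
  define b where "b = 1 + (norm x0)\<^sup>2 + (2 * ?N + 1) * t0"
  have b: "b > 0" using t by (auto simp: b_def intro!: add_pos_nonneg)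
  \<comment> \<open>Half of the value at which \<Psi> would vanish at (x0, t0), so \<Psi> is
    positive there.\<close>
  define \<epsilon> where "\<epsilon> = m / (2 * b)"
  have \<epsilon>: "\<epsilon> > 0" "\<epsilon> * b < m" using m b by (auto simp: \<epsilon>_def)
  define \<Psi> where "\<Psi> x t = exp (- K * t) * d x t - \<epsilon> * (1 + (norm x)\<^sup>2 + (2 * ?N + 1) * t)" for x t
  have \<Psi>0: "\<Psi> x0 t0 > 0" using \<epsilon> by (simp add: \<Psi>_def m_def b_def)
  \<comment> \<open>Outside the ball of radius R the quadratic penalty alone outweighs the upper
    bound B.\<close>
  define R where "R = norm x0 + sqrt (max B 0 / \<epsilon>)"
  have R: "norm x0 \<le> R" "max B 0 \<le> \<epsilon> * R\<^sup>2" "0 \<le> R"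
  proof -
    show "norm x0 \<le> R" "0 \<le> R" using \<epsilon> by (auto simp: R_def intro!: add_nonneg_nonneg divide_nonneg_pos)
    have "max B 0 / \<epsilon> = (sqrt (max B 0 / \<epsilon>))\<^sup>2" using \<epsilon> by simp
    also have "\<dots> \<le> R\<^sup>2" using \<epsilon> unfolding R_def
      by (intro power_mono real_sqrt_ge_zero) (auto intro!: divide_nonneg_pos)
    finally show "max B 0 \<le> \<epsilon> * R\<^sup>2" using \<epsilon> by (simp add: field_simps)
  qed
  have out: "\<Psi> x t < 0" if "norm x > R" "0 \<le> t" "t \<le> T" for x t
  proof -
    have "exp (- K * t) * d x t \<le> exp (- K * t) * max B 0"
      using bdd[of t x] that by (intro mult_left_mono) auto
    also have "\<dots> \<le> 1 * max B 0" using K that by (intro mult_right_mono) auto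
    also have "\<dots> \<le> \<epsilon> * (norm x)\<^sup>2" using R that \<epsilon>
      by (smt (verit) mult_left_mono power_mono)
    finally have *: "exp (- K * t) * d x t \<le> \<epsilon> * (norm x)\<^sup>2" .
    have "0 < \<epsilon> * (1 + (2 * ?N + 1) * t)" using \<epsilon> that by (intro mult_pos_pos add_pos_nonneg) auto
    with * show ?thesis by (simp add: \<Psi>_def algebra_simps)
  qed
  let ?C = "cball (0::real^'n) R \<times> {0..T}"
  have "compact ?C" by (intro compact_Times) auto
  moreover have "continuous_on ?C (\<lambda>(x, t). \<Psi> x t)"
    unfolding \<Psi>_def case_prod_beta
    using continuous_on_subset[OF cont, of ?C]
    by (intro continuous_intros) (auto simp: case_prod_beta)
  moreover have "?C \<noteq> {}" using R t by auto
  ultimately obtain y s where ys: "(y, s) \<in> ?C" and mx: "\<forall>p\<in>?C. (\<lambda>(x, t). \<Psi> x t) p \<le> \<Psi> y s"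
    using continuous_attains_sup[of ?C "\<lambda>(x, t). \<Psi> x t"] by (metis (no_types, lifting) case_prod_conv surj_pair)
  have \<Psi>ys: "\<Psi> y s > 0" using mx \<Psi>0 R t by (force simp: dist_norm)
  have max: "\<Psi> x t \<le> \<Psi> y s" if "0 \<le> t" "t \<le> T" for x t
  proof (cases "norm x \<le> R")
    case True then show ?thesis using mx that by force
  next
    case False then show ?thesis using out[of x t] that \<Psi>ys by linarith
  qed
  have s: "0 \<le> s" "s \<le> T" using ys by auto
  have "exp (- K * s) * d y s > 0"
  proof -
    have "\<epsilon> * (1 + (norm y)\<^sup>2 + (2 * ?N + 1) * s) \<ge> 0" using \<epsilon> s
      by (intro mult_nonneg_nonneg add_nonneg_nonneg) auto
    then show ?thesis using \<Psi>ys by (simp add: \<Psi>_def)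
  qed
  then have dpos: "d y s > 0" by (simp add: zero_less_mult_iff)
  with init[of y] s have s0: "s > 0" by (cases "s = 0") auto
  have tder: "(\<Psi> y has_real_derivative
      (exp (- K * s) * (dt y s - K * d y s) - \<epsilon> * (2 * ?N + 1))) (at s)"
    unfolding \<Psi>_def
    by (rule derivative_eq_intros dt[OF s0 s(2)] refl | simp add: algebra_simps)+
  \<comment> \<open>The maximum may sit at the final time s = T, so only earlier times are compared
    and the time derivative is merely nonnegative.\<close>
  have "exp (- K * s) * (dt y s - K * d y s) - \<epsilon> * (2 * ?N + 1) \<ge> 0"
  proof (rule ccontr)
    assume "\<not> ?thesis"
    then obtain \<delta> where "\<delta> > 0" "\<And>h. h > 0 \<Longrightarrow> h < \<delta> \<Longrightarrow> \<Psi> y s < \<Psi> y (s - h)"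
      using DERIV_neg_dec_left[OF tder] by auto
    from this(2)[of "min (\<delta>/2) s"] this(1) s0 max[of "s - min (\<delta>/2) s" y] s
    show False by (smt (verit, best) field_sum_of_halves)
  qed
  moreover have "exp (- K * s) * DD i y s - 2 * \<epsilon> \<le> 0" for i
  proof (rule second_derivative_at_max_nonpos)
    fix r
    have *: "((\<lambda>r. d (y + r *\<^sub>R axis i 1) s) has_real_derivative D i (y + r *\<^sub>R axis i 1) s) (at r)"
      using D[OF s0 s(2), of i "y + r *\<^sub>R axis i 1"] by (simp add: has_pd_along_line)
    show "((\<lambda>r. \<Psi> (y + r *\<^sub>R axis i 1) s) has_real_derivative
        exp (- K * s) * D i (y + r *\<^sub>R axis i 1) s - \<epsilon> * (2 * y $ i + 2 * r)) (at r)"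
      unfolding \<Psi>_def norm_add_axis_sq
      by (rule derivative_eq_intros * refl | simp)+
    show "\<Psi> (y + r *\<^sub>R axis i 1) s \<le> \<Psi> (y + 0 *\<^sub>R axis i 1) s" using max s by simp
  next
    have *: "((\<lambda>r. D i (y + r *\<^sub>R axis i 1) s) has_real_derivative DD i y s) (at 0)"
      using DD[OF s0 s(2), of i y] by (simp add: has_pd_def)
    show "((\<lambda>r. exp (- K * s) * D i (y + r *\<^sub>R axis i 1) s - \<epsilon> * (2 * y $ i + 2 * r))
       has_real_derivative exp (- K * s) * DD i y s - 2 * \<epsilon>) (at 0)"
      by (rule derivative_eq_intros * refl | simp)+
  qed
  then have "(\<Sum>i\<in>UNIV. exp (- K * s) * DD i y s) \<le> (\<Sum>i\<in>(UNIV::'n set). 2 * \<epsilon>)"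
    by (intro sum_mono) (simp add: algebra_simps)
  then have "exp (- K * s) * (\<Sum>i\<in>UNIV. DD i y s) \<le> 2 * \<epsilon> * ?N" by (simp add: sum_distrib_left mult_ac)
  moreover have "exp (- K * s) * (dt y s - K * d y s) \<le> exp (- K * s) * (\<Sum>i\<in>UNIV. DD i y s)"
    using ineq[OF s0 s(2) dpos] by (intro mult_left_mono) auto
  ultimately show False using \<epsilon> by (simp add: algebra_simps)
qed

section \<open>Continuity and derivatives of parameter integrals\<close>

lemma continuous_on_param_integral:
  fixes k :: "'a::metric_space \<Rightarrow> 'b \<Rightarrow> real"
  assumes "\<And>p. p \<in> S \<Longrightarrow> k p \<in> borel_measurable Q"
    and cont: "\<And>z. continuous_on S (\<lambda>p. k p z)"
    and bound: "\<And>p z. p \<in> S \<Longrightarrow> \<bar>k p z\<bar> \<le> B z" and B: "integrable Q B"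
  shows "continuous_on S (\<lambda>p. \<integral>z. k p z \<partial>Q)"
proof (unfold continuous_on_sequentially, intro allI ballI impI, elim conjE)
  fix p and pn :: "nat \<Rightarrow> 'a" assume p: "p \<in> S" and pn: "\<forall>n. pn n \<in> S" "pn \<longlonglongrightarrow> p"
  have "(\<lambda>n. k (pn n) z) \<longlonglongrightarrow> k p z" for z
    using cont[of z] p pn unfolding continuous_on_sequentially o_def by blast
  then show "((\<lambda>p. \<integral>z. k p z \<partial>Q) \<circ> pn) \<longlonglongrightarrow> (\<integral>z. k p z \<partial>Q)"
    unfolding o_def
    by (intro integral_dominated_convergence[where w = B]) (use assms p pn in auto)
qed

text \<open>The mean value inequality bounds all difference quotients by the integrable
  \<open>B\<close>, so dominated convergence applies along every sequence of increments.\<close>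

lemma has_real_derivative_param_integral:
  fixes k k' :: "real \<Rightarrow> 'b \<Rightarrow> real"
  assumes m: "\<And>h. k h \<in> borel_measurable Q" "k' 0 \<in> borel_measurable Q"
    and i: "\<And>h. integrable Q (k h)"
    and der: "\<And>h z. ((\<lambda>h. k h z) has_real_derivative k' h z) (at h)"
    and bound: "\<And>h z. \<bar>k' h z\<bar> \<le> B z" and B: "integrable Q B"
  shows "((\<lambda>h. \<integral>z. k h z \<partial>Q) has_real_derivative (\<integral>z. k' 0 z \<partial>Q)) (at 0)"
  unfolding DERIV_def tendsto_at_iff_sequentially
proof (intro allI impI)
  fix hn :: "nat \<Rightarrow> real" assume hn: "\<forall>n. hn n \<in> UNIV - {0}" "hn \<longlonglongrightarrow> 0"
  let ?q = "\<lambda>n z. (k (0 + hn n) z - k 0 z) / hn n"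
  have "(\<lambda>n. \<integral>z. ?q n z \<partial>Q) \<longlonglongrightarrow> (\<integral>z. k' 0 z \<partial>Q)"
  proof (rule integral_dominated_convergence[where w = B])
    show "AE z in Q. (\<lambda>n. ?q n z) \<longlonglongrightarrow> k' 0 z"
    proof (rule AE_I2)
      fix z
      have "((\<lambda>h. (k (0 + h) z - k 0 z) / h) \<circ> hn) \<longlonglongrightarrow> k' 0 z"
        using der[of z 0] hn unfolding DERIV_def tendsto_at_iff_sequentially by blast
      then show "(\<lambda>n. ?q n z) \<longlonglongrightarrow> k' 0 z" by (simp add: o_def)
    qed
    fix n
    show "AE z in Q. norm (?q n z) \<le> B z"
    proof (rule AE_I2)
      fix z
      have "norm (k (hn n) z - k 0 z) \<le> B z * norm (hn n - 0)"
        by (rule field_differentiable_bound[where f' = "\<lambda>h. k' h z" and S = UNIV])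
           (use der bound in auto)
      then show "norm (?q n z) \<le> B z" using hn(1) by (simp add: field_simps)
    qed
  qed (use m B in auto)
  moreover have "(\<integral>z. ?q n z \<partial>Q) = ((\<integral>z. k (0 + hn n) z \<partial>Q) - (\<integral>z. k 0 z \<partial>Q)) / hn n" for n
    by (simp only: integral_divide_zero Bochner_Integration.integral_diff[OF i i])
  ultimately show "((\<lambda>h. ((\<integral>z. k (0 + h) z \<partial>Q) - (\<integral>z. k 0 z \<partial>Q)) / h) \<circ> hn) \<longlonglongrightarrow> (\<integral>z. k' 0 z \<partial>Q)"
    by (simp only: o_def)
qed

section \<open>Gaussian averages\<close>

text \<open>Stein's identity. The normal density n satisfies n' = - y n, so n \<psi>' - y n \<psi>
  is the derivative of n \<psi>, which vanishes at both ends of the line.\<close>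

lemma std_normal_integration_by_parts:
  fixes \<psi> \<psi>' :: "real \<Rightarrow> real"
  assumes der: "\<And>y. (\<psi> has_real_derivative \<psi>' y) (at y)" and cont: "continuous_on UNIV \<psi>'"
    and B: "\<And>y. \<bar>\<psi> y\<bar> \<le> B" "\<And>y. \<bar>\<psi>' y\<bar> \<le> B"
  shows "(\<integral>y. y * \<psi> y \<partial>density lborel std_normal_density) = (\<integral>y. \<psi>' y \<partial>density lborel std_normal_density)"
proof -
  have c\<psi>: "continuous_on UNIV \<psi>" by (rule DERIV_continuous_on, rule has_field_derivative_at_within, rule der)
  have [measurable]: "\<psi> \<in> borel_measurable borel" "\<psi>' \<in> borel_measurable borel"
    using c\<psi> cont by (auto intro: borel_measurable_continuous_onI)
  let ?n = "std_normal_density"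
  have i1: "integrable lborel (\<lambda>y. ?n y * \<psi>' y)"
  proof (rule Bochner_Integration.integrable_bound[where f = "\<lambda>y. B * (?n y * y ^ 0)"])
    show "integrable lborel (\<lambda>y. B * (?n y * y ^ 0))"
      by (intro integrable_mult_right integrable_std_normal_moment)
    have "\<bar>\<psi>' y\<bar> * ?n y \<le> \<bar>B\<bar> * ?n y" for y
      using B(2)[of y] by (intro mult_right_mono) auto
    then show "AE y in lborel. norm (?n y * \<psi>' y) \<le> norm (B * (?n y * y ^ 0))"
      by (intro AE_I2) (simp add: abs_mult mult.commute)
  qed simp
  have i2: "integrable lborel (\<lambda>y. ?n y * (y * \<psi> y))"
  proof (rule Bochner_Integration.integrable_bound[where f = "\<lambda>y. B * (?n y * \<bar>y\<bar> ^ 1)"])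
    show "integrable lborel (\<lambda>y. B * (?n y * \<bar>y\<bar> ^ 1))"
      by (intro integrable_mult_right integrable_std_normal_moment_abs)
    show "AE y in lborel. norm (?n y * (y * \<psi> y)) \<le> norm (B * (?n y * \<bar>y\<bar> ^ 1))"
    proof (rule AE_I2)
      fix y
      have "(?n y * \<bar>y\<bar>) * \<bar>\<psi> y\<bar> \<le> (?n y * \<bar>y\<bar>) * \<bar>B\<bar>"
        using B(1)[of y] by (intro mult_left_mono) auto
      then show "norm (?n y * (y * \<psi> y)) \<le> norm (B * (?n y * \<bar>y\<bar> ^ 1))"
        by (simp add: abs_mult mult_ac)
    qed
  qed simp
  have n0: "((\<lambda>y. ?n y * \<psi> y) \<longlongrightarrow> 0) F" if F: "filterlim (\<lambda>y::real. y\<^sup>2 / 2) at_top F" for F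
  proof -
    have "((\<lambda>y. ?n y) \<longlongrightarrow> 1 / sqrt (2 * pi) * 0) F"
      unfolding std_normal_density_def
      using filterlim_compose[OF exp_at_bot filterlim_compose[OF filterlim_uminus_at_bot_at_top F]]
      by (intro tendsto_mult tendsto_const) (simp add: o_def)
    then have "((\<lambda>y. B * ?n y) \<longlongrightarrow> 0) F" by (auto intro: tendsto_mult_right_zero)
    then show ?thesis
      by (rule Lim_null_comparison[rotated])
         (use B(1) in \<open>auto simp: abs_mult mult.commute intro!: always_eventually mult_right_mono\<close>)
  qed
  have "(LBINT y=-\<infinity>..\<infinity>. ?n y * \<psi>' y - ?n y * (y * \<psi> y)) = 0 - 0"
  proof (rule interval_integral_FTC_integrable[where F = "\<lambda>y. ?n y * \<psi> y"])
    fix y :: real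
    show "((\<lambda>y. ?n y * \<psi> y) has_vector_derivative ?n y * \<psi>' y - ?n y * (y * \<psi> y)) (at y)"
      unfolding std_normal_density_def has_real_derivative_iff_has_vector_derivative[symmetric]
      by (rule derivative_eq_intros der refl | simp)+ (simp add: algebra_simps)
    show "isCont (\<lambda>y. ?n y * \<psi>' y - ?n y * (y * \<psi> y)) y"
      using cont c\<psi> unfolding std_normal_density_def
      by (intro continuous_intros) (auto simp: continuous_on_eq_continuous_at)
  next
    show "set_integrable lborel (einterval (- \<infinity>) \<infinity>) (\<lambda>y. ?n y * \<psi>' y - ?n y * (y * \<psi> y))"
      using i1 i2 by (simp add: set_integrable_def)
    have half: "filterlim (\<lambda>y::real. y\<^sup>2 / 2) at_top F" if "filterlim (\<lambda>y::real. y\<^sup>2) at_top F" for F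
      using filterlim_tendsto_pos_mult_at_top[OF tendsto_const[of "1/2::real"] _ that] by simp
    show "(((\<lambda>y. ?n y * \<psi> y) \<circ> real_of_ereal) \<longlongrightarrow> 0) (at_right (- \<infinity>))"
      unfolding ereal_tendsto_simps1
      by (intro n0 half filterlim_pow_at_bot_even filterlim_ident) auto
    show "(((\<lambda>y. ?n y * \<psi> y) \<circ> real_of_ereal) \<longlongrightarrow> 0) (at_left \<infinity>)"
      unfolding ereal_tendsto_simps1
      by (intro n0 half filterlim_pow_at_top filterlim_ident) auto
  qed simp
  then have "(\<integral>y. ?n y * \<psi>' y - ?n y * (y * \<psi> y) \<partial>lborel) = 0"
    by (simp add: interval_lebesgue_integral_def set_lebesgue_integral_def)
  then show ?thesis using i1 i2 by (simp add: integral_density)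
qed

text \<open>The standard Gaussian law, taken as the image of a product of one-dimensional normal
  laws so that Fubini can isolate a single coordinate.\<close>

definition gauss :: "(real^'n::finite) measure" where
  "gauss = distr (Pi\<^sub>M UNIV (\<lambda>_. density lborel std_normal_density)) borel (\<lambda>z. \<chi> i. z i)"

abbreviation (input) N01 :: "real measure" where "N01 \<equiv> density lborel std_normal_density"

lemma prob_space_N01: "prob_space N01"
  by (rule prob_space_normal_density) simp

lemma vec_lambda_measurable [measurable]:
  "(\<lambda>z. \<chi> i. z i) \<in> borel_measurable (Pi\<^sub>M UNIV (\<lambda>_::'n::finite. N01))"
proof -
  have "(\<lambda>z. (\<chi> i. z i) \<bullet> b) \<in> borel_measurable (Pi\<^sub>M UNIV (\<lambda>_::'n. N01))"
    if "b \<in> Basis" for b :: "real^'n"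
  proof -
    have "\<exists>j. b = axis j 1" using that unfolding Basis_vec_def by simp
    then obtain j where b: "b = axis j 1" ..
    have "(\<lambda>z. z j) \<in> borel_measurable (Pi\<^sub>M UNIV (\<lambda>_::'n. N01))"
      using measurable_component_singleton[of j UNIV "\<lambda>_. N01"] by simp
    then show ?thesis by (simp add: b inner_axis)
  qed
  then show ?thesis by (subst borel_measurable_euclidean_space) auto
qed

lemma sets_gauss [simp, measurable_cong]: "sets gauss = sets borel"
  by (simp add: gauss_def)

lemma space_gauss [simp]: "space gauss = UNIV"
  by (simp add: gauss_def)

lemma prob_space_gauss: "prob_space (gauss :: (real^'n::finite) measure)"
  unfolding gauss_def
  by (intro prob_space.prob_space_distr prob_space_PiM prob_space_N01 vec_lambda_measurable)

lemma integrable_gauss_component: "integrable (gauss :: (real^'n::finite) measure) (\<lambda>z. z $ i)"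
proof -
  have d: "distr (Pi\<^sub>M UNIV (\<lambda>_::'n. N01)) N01 (\<lambda>\<omega>. \<omega> i) = N01"
    by (rule distr_PiM_component) (auto intro: prob_space_N01)
  have "integrable N01 (\<lambda>y. y)"
    using integrable_std_normal_moment[of 1] by (subst integrable_density) auto
  then have "integrable (distr (Pi\<^sub>M UNIV (\<lambda>_::'n. N01)) N01 (\<lambda>\<omega>. \<omega> i)) (\<lambda>y. y)" by (simp add: d)
  then have "integrable (Pi\<^sub>M UNIV (\<lambda>_::'n. N01)) (\<lambda>\<omega>. \<omega> i)"
    by (subst (asm) integrable_distr_eq) (auto intro: measurable_component_singleton)
  then show ?thesis unfolding gauss_def by (subst integrable_distr_eq) auto
qed

lemma integrable_gauss_norm: "integrable (gauss :: (real^'n::finite) measure) norm"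
proof (rule Bochner_Integration.integrable_bound[where f = "\<lambda>z. \<Sum>i\<in>UNIV. \<bar>z $ i\<bar>"])
  show "integrable (gauss :: (real^'n::finite) measure) (\<lambda>z. \<Sum>i\<in>UNIV. \<bar>z $ i\<bar>)"
    by (intro Bochner_Integration.integrable_sum integrable_abs integrable_gauss_component)
qed (auto intro!: AE_I2 norm_le_l1_cart order_trans[OF norm_le_l1_cart abs_ge_self])

text \<open>Coordinate i is integrated first, where the one-dimensional identity applies; the other
  coordinates are parameters.\<close>

lemma gauss_integration_by_parts:
  fixes \<phi> \<phi>' :: "real^'n::finite \<Rightarrow> real"
  assumes der: "\<And>z. has_pd i \<phi> z (\<phi>' z)"
    and cont: "continuous_on UNIV \<phi>" "continuous_on UNIV \<phi>'"
    and B: "\<And>z. \<bar>\<phi> z\<bar> \<le> B" "\<And>z. \<bar>\<phi>' z\<bar> \<le> B"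
  shows "(\<integral>z. z $ i * \<phi> z \<partial>gauss) = (\<integral>z. \<phi>' z \<partial>gauss)"
proof -
  let ?P = "Pi\<^sub>M UNIV (\<lambda>_::'n. N01)"
  let ?T = "\<lambda>z::'n \<Rightarrow> real. (\<chi> i. z i)"
  interpret N: prob_space N01 by (rule prob_space_N01)
  interpret P: product_prob_space "\<lambda>_::'n. N01" UNIV by standard
  interpret G: prob_space "gauss :: (real^'n) measure" by (rule prob_space_gauss)
  have [measurable]: "\<phi> \<in> borel_measurable borel" "\<phi>' \<in> borel_measurable borel"
    using cont by (auto intro: borel_measurable_continuous_onI)
  have g1: "integrable gauss \<phi>'"
    using B(2) by (intro G.integrable_const_bound[of _ B]) auto
  have g2: "integrable gauss (\<lambda>z. z $ i * \<phi> z)"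
  proof (rule Bochner_Integration.integrable_bound[where f = "\<lambda>z. B * \<bar>z $ i\<bar>"])
    show "integrable gauss (\<lambda>z. B * \<bar>z $ i\<bar>)"
      by (intro integrable_mult_right integrable_abs integrable_gauss_component)
    have "\<bar>\<phi> z\<bar> * \<bar>z $ i\<bar> \<le> \<bar>B\<bar> * \<bar>z $ i\<bar>" for z
      using B(1)[of z] by (intro mult_right_mono) auto
    then show "AE z in gauss. norm (z $ i * \<phi> z) \<le> norm (B * \<bar>z $ i\<bar>)"
      by (intro AE_I2) (simp add: abs_mult mult.commute)
  qed simp
  have U: "insert i (UNIV - {i}) = UNIV" by auto
  have ins: "(\<integral>z. h (?T z) \<partial>?P) =
      (\<integral>x. (\<integral>y. h (?T (x(i:=y))) \<partial>N01) \<partial>Pi\<^sub>M (UNIV - {i}) (\<lambda>_. N01))"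
    if h: "integrable gauss h" for h :: "real^'n \<Rightarrow> real"
  proof -
    have [measurable]: "h \<in> borel_measurable borel" using borel_measurable_integrable[OF h] by simp
    have "integrable ?P (\<lambda>z. h (?T z))"
      using h unfolding gauss_def by (subst (asm) integrable_distr_eq) (auto simp: gauss_def)
    then show ?thesis
      using P.product_integral_insert[of "UNIV - {i}" i "\<lambda>z. h (?T z)"] by (simp add: U)
  qed
  \<comment> \<open>Changing coordinate i is a motion along axis i from the point with that
    coordinate set to 0, the form in which \<open>has_pd_along_line\<close> applies.\<close>
  have upd: "?T (x(i:=y)) = ?T (x(i:=0)) + y *\<^sub>R axis i 1" for x :: "'n \<Rightarrow> real" and y
    by (auto simp: vec_eq_iff axis_def)
  have inner: "(\<integral>y. ?T (x(i:=y)) $ i * \<phi> (?T (x(i:=y))) \<partial>N01) = (\<integral>y. \<phi>' (?T (x(i:=y))) \<partial>N01)" for x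
  proof -
    have "(\<integral>y. y * \<phi> (?T (x(i:=0)) + y *\<^sub>R axis i 1) \<partial>N01) = (\<integral>y. \<phi>' (?T (x(i:=0)) + y *\<^sub>R axis i 1) \<partial>N01)"
    proof (rule std_normal_integration_by_parts[OF _ _ B])
      fix y
      show "((\<lambda>y. \<phi> (?T (x(i:=0)) + y *\<^sub>R axis i 1)) has_real_derivative
          \<phi>' (?T (x(i:=0)) + y *\<^sub>R axis i 1)) (at y)"
        using der by (simp flip: has_pd_along_line)
    qed (intro continuous_on_compose2[OF cont(2)] continuous_intros subset_UNIV)
    then show ?thesis unfolding upd[of x, symmetric] by (simp add: fun_upd_def)
  qed
  have "(\<integral>z. z $ i * \<phi> z \<partial>gauss) = (\<integral>z. ?T z $ i * \<phi> (?T z) \<partial>?P)"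
    unfolding gauss_def by (subst integral_distr) auto
  also have "\<dots> = (\<integral>z. \<phi>' (?T z) \<partial>?P)"
    unfolding ins[OF g2] ins[OF g1] inner ..
  also have "\<dots> = (\<integral>z. \<phi>' z \<partial>gauss)"
    unfolding gauss_def by (subst integral_distr) auto
  finally show ?thesis .
qed

section \<open>The product of the uniform and the Gaussian law\<close>

definition unit_uniform :: "real measure" where
  "unit_uniform = density lborel (indicator {0..1})"

definition rho_gauss :: "(real \<times> (real^'n::finite)) measure" where
  "rho_gauss = unit_uniform \<Otimes>\<^sub>M gauss"

lemma sets_unit_uniform [simp, measurable_cong]: "sets unit_uniform = sets borel"
  by (simp add: unit_uniform_def)

lemma space_unit_uniform [simp]: "space unit_uniform = UNIV"
  by (simp add: unit_uniform_def)

lemma sets_rho_gauss [simp, measurable_cong]: "sets (rho_gauss :: (real \<times> (real^'n::finite)) measure) = sets borel"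
  unfolding rho_gauss_def borel_prod[symmetric] by (intro sets_pair_measure_cong) simp_all

lemma prob_space_unit_uniform: "prob_space unit_uniform"
  by standard (simp add: unit_uniform_def emeasure_density)

lemma AE_unit_uniform: "AE r in unit_uniform. 0 \<le> r \<and> r \<le> 1"
  unfolding unit_uniform_def by (subst AE_density) (auto intro!: AE_I2 simp: indicator_def split: if_splits)

lemma integral_unit_uniform:
  fixes k :: "real \<Rightarrow> real"
  assumes "continuous_on UNIV k"
  shows "(\<integral>r. k r \<partial>unit_uniform) = integral {0..1} k"
proof -
  have [measurable]: "k \<in> borel_measurable borel" using assms by (rule borel_measurable_continuous_onI)
  have "(\<integral>r. k r \<partial>unit_uniform) = (\<integral>r. indicator {0..1} r *\<^sub>R k r \<partial>lborel)"
  proof -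
    have "unit_uniform = density lborel (\<lambda>r. ennreal (indicator {0..1} r))"
      unfolding unit_uniform_def by (simp add: ennreal_indicator)
    then show ?thesis using integral_density[of k lborel "indicator {0..1}"] by simp
  qed
  also have "\<dots> = (LBINT r:{0..1}. k r)" by (simp add: set_lebesgue_integral_def)
  also have "\<dots> = integral {0..1} k"
    by (intro set_borel_integral_eq_integral borel_integrable_atLeastAtMost')
       (use assms in \<open>auto intro: continuous_on_subset\<close>)
  finally show ?thesis .
qed

lemma pair_sigma_finite_rho_gauss: "pair_sigma_finite unit_uniform (gauss :: (real^'n::finite) measure)"
  by (intro pair_sigma_finite.intro prob_space_imp_sigma_finite prob_space_unit_uniform prob_space_gauss)

lemma integral_rho_gauss:
  fixes k :: "real \<times> (real^'n::finite) \<Rightarrow> real"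
  assumes "integrable (rho_gauss :: (real \<times> (real^'n::finite)) measure) k"
  shows "(\<integral>p. k p \<partial>rho_gauss) = (\<integral>r. (\<integral>z. k (r, z) \<partial>gauss) \<partial>unit_uniform)"
  using pair_sigma_finite.integral_fst'[OF pair_sigma_finite_rho_gauss, of k] assms
  unfolding rho_gauss_def by simp

lemma integrable_unit_uniform: "continuous_on UNIV k \<Longrightarrow> integrable unit_uniform (k :: real \<Rightarrow> real)"
proof -
  assume k: "continuous_on UNIV k"
  interpret prob_space unit_uniform by (rule prob_space_unit_uniform)
  have "bounded (k ` {0..1})"
    by (intro compact_imp_bounded compact_continuous_image continuous_on_subset[OF k]) auto
  then obtain B where "\<And>r. r \<in> {0..1} \<Longrightarrow> norm (k r) \<le> B" unfolding bounded_iff by blast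
  then have "AE r in unit_uniform. norm (k r) \<le> B"
    by (intro AE_mp[OF AE_unit_uniform AE_I2] impI) simp
  then show ?thesis
    by (rule integrable_const_bound) (use borel_measurable_continuous_onI[OF k] in simp)
qed

lemma integrable_rho_gauss_product:
  fixes k :: "real \<Rightarrow> real" and l :: "real^'n::finite \<Rightarrow> real"
  assumes k: "continuous_on UNIV k" and l: "integrable gauss l"
  shows "integrable (rho_gauss :: (real \<times> (real^'n::finite)) measure) (\<lambda>p. k (fst p) * l (snd p))"
proof -
  interpret pair_sigma_finite unit_uniform "gauss :: (real^'n) measure" by (rule pair_sigma_finite_rho_gauss)
  have [measurable]: "k \<in> borel_measurable borel" using k by (rule borel_measurable_continuous_onI)
  have [measurable]: "l \<in> borel_measurable borel" using borel_measurable_integrable[OF l] by simp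
  have "integrable unit_uniform (\<lambda>r. norm (k r) * (\<integral>z. norm (l z) \<partial>gauss))"
    by (intro integrable_mult_left integrable_unit_uniform continuous_intros k)
  then show ?thesis unfolding rho_gauss_def
    by (intro Fubini_integrable) (auto simp: norm_mult l simp del: real_norm_def)
qed

text \<open>A common integrable majorant for the two weights that occur, \<rho> for the potential
  and a coordinate of z for its gradient.\<close>

definition moment_weight :: "real \<times> (real^'n::finite) \<Rightarrow> real" where
  "moment_weight p = \<bar>fst p\<bar> + norm (snd p)"

lemma moment_weight_nonneg: "0 \<le> moment_weight p" by (simp add: moment_weight_def)

lemma integrable_moment_weight: "integrable (rho_gauss :: (real \<times> (real^'n::finite)) measure) moment_weight"
proof -
  interpret G: prob_space "gauss :: (real^'n) measure" by (rule prob_space_gauss)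
  have "integrable (rho_gauss :: (real \<times> (real^'n)) measure) (\<lambda>p. \<bar>fst p\<bar> * 1 + 1 * norm (snd p))"
    by (intro Bochner_Integration.integrable_add integrable_rho_gauss_product continuous_intros integrable_gauss_norm) simp
  then show ?thesis unfolding moment_weight_def by simp
qed

text \<open>The class in which the Duhamel iteration lives; potentials preserve it. The bound covers
  all t <= T, negative times included: \<rho> formally ranges over the whole line, and a sampled
  time t (1 - \<rho>^2) is negative for |\<rho>| > 1. Majorants then hold at every point instead of
  almost everywhere.\<close>

definition tame :: "(real^'n::finite \<Rightarrow> real \<Rightarrow> real) \<Rightarrow> bool" where
  "tame g \<longleftrightarrow> continuous_on UNIV (\<lambda>p. g (fst p) (snd p)) \<and> (\<forall>T. \<exists>B. \<forall>x. \<forall>t\<le>T. \<bar>g x t\<bar> \<le> B)"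

lemma tameD_cont: "tame g \<Longrightarrow> continuous_on S a \<Longrightarrow> continuous_on S b \<Longrightarrow> continuous_on S (\<lambda>s. g (a s) (b s))"
  unfolding tame_def
  using continuous_on_compose2[of UNIV "\<lambda>p. g (fst p) (snd p)" S "\<lambda>s. (a s, b s)"]
  by (auto intro: continuous_intros)

lemma tame_bound:
  assumes "tame g" shows "\<exists>B. 0 \<le> B \<and> (\<forall>x t. t \<le> T \<longrightarrow> \<bar>g x t\<bar> \<le> B)"
proof -
  obtain B where B: "\<And>x t. t \<le> T \<Longrightarrow> \<bar>g x t\<bar> \<le> B" using assms unfolding tame_def by blast
  moreover have "B \<ge> 0" using B[of T] abs_ge_zero[of "g 0 T"] by (meson order.refl order_trans)
  ultimately show ?thesis by blast
qed

text \<open>Majorants are uniform only for times below a fixed T, and every point is interior to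
  such an open strip.\<close>

lemma continuous_on_strips:
  fixes F :: "'a::t2_space \<times> real \<Rightarrow> real"
  assumes "\<And>T. continuous_on (UNIV \<times> {..<T}) F"
  shows "continuous_on UNIV F"
proof -
  have "isCont F p" for p
    by (rule continuous_on_interior[OF assms[of "snd p + 1"]])
       (simp add: interior_open open_Times mem_Times_iff)
  then show ?thesis by (simp add: continuous_on_eq_continuous_at)
qed

definition ptime :: "real \<Rightarrow> real" where "ptime t = max 0 t"

lemma ptime_simps [simp]: "0 \<le> ptime t" "t \<ge> 0 \<Longrightarrow> ptime t = t" "ptime (ptime t) = ptime t" "t \<le> ptime t"
  by (auto simp: ptime_def)

lemma continuous_on_ptime [continuous_intros]: "continuous_on S a \<Longrightarrow> continuous_on S (\<lambda>x. ptime (a x))"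
  unfolding ptime_def by (intro continuous_intros)

lemma ptime_mult_le: "ptime t * (1 - r\<^sup>2) \<le> ptime t"
  by (simp add: algebra_simps)

abbreviation sample_point :: "real^'n \<Rightarrow> real \<Rightarrow> real \<times> (real^'n::finite) \<Rightarrow> real^'n" where
  "sample_point x t p \<equiv> x + (sqrt (2 * ptime t) * fst p) *\<^sub>R snd p"

abbreviation sample_time :: "real \<Rightarrow> real \<times> (real^'n::finite) \<Rightarrow> real" where
  "sample_time t p \<equiv> ptime t * (1 - (fst p)\<^sup>2)"

text \<open>The heat potential over the time \<open>s\<close> becomes an integral over \<open>\<rho> \<in> [0, 1]\<close> and a standard Gaussian
  vector \<open>z\<close> by \<open>s = t (1 - \<rho>\<^sup>2)\<close>, \<open>x' = x + \<surd>(2 t) \<rho> z\<close>. The substitution removes the singularity of the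
  kernel: one derivative of the potential costs only a factor \<open>z\<close>. Negative times are read as \<open>0\<close>
  throughout, so that all functions are defined and continuous on the whole space.\<close>

definition heat_mean :: "(real \<Rightarrow> real \<times> (real^'n) \<Rightarrow> real) \<Rightarrow> (real^'n::finite \<Rightarrow> real \<Rightarrow> real) \<Rightarrow> real^'n \<Rightarrow> real \<Rightarrow> real" where
  "heat_mean w g x t = (\<integral>p. w (ptime t) p * g (sample_point x t p) (sample_time t p) \<partial>rho_gauss)"

text \<open>Treats the potential and its gradient at once, which differ only in the weight.\<close>

locale mean_weight =
  fixes w :: "real \<Rightarrow> real \<times> (real^'n::finite) \<Rightarrow> real"
  assumes cont_w: "continuous_on UNIV (\<lambda>q. w (fst q) (snd q))"
    and bound_w: "\<And>T. \<exists>A\<ge>0. \<forall>t p. 0 \<le> t \<and> t \<le> T \<longrightarrow> \<bar>w t p\<bar> \<le> A * moment_weight p"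
begin

lemma cont_w2: "continuous_on S a \<Longrightarrow> continuous_on S b \<Longrightarrow> continuous_on S (\<lambda>s. w (a s) (b s))"
  using continuous_on_compose2[OF cont_w, of S "\<lambda>s. (a s, b s)"]
  by (auto intro: continuous_intros)

lemma cont_integrand:
  assumes "tame g" "continuous_on S a" "continuous_on S b" "continuous_on S c"
  shows "continuous_on S (\<lambda>s. w (ptime (a s)) (c s) * g (b s + (sqrt (2 * ptime (a s)) * fst (c s)) *\<^sub>R snd (c s)) (ptime (a s) * (1 - (fst (c s))\<^sup>2)))"
  using assms by (intro continuous_intros cont_w2 tameD_cont[OF assms(1)])

lemma measurable_integrand [measurable]:
  assumes "tame g"
  shows "(\<lambda>p. w (ptime t) p * g (sample_point x t p) (sample_time t p)) \<in> borel_measurable rho_gauss"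
  by (subst measurable_cong_sets[OF sets_rho_gauss refl], rule borel_measurable_continuous_onI,
      rule cont_integrand[OF assms]) (auto intro: continuous_intros)

text \<open>The point y is independent of p: since \<open>g\<close> is bounded in space, one
  majorant serves every x, as dominated convergence in x and t requires.\<close>

lemma bound_integrand:
  assumes "tame g"
  shows "\<exists>C. 0 \<le> C \<and> (\<forall>t p y. t \<le> T \<longrightarrow> \<bar>w (ptime t) p * g y (sample_time t p)\<bar> \<le> C * moment_weight p)"
proof -
  obtain B where "0 \<le> B \<and> (\<forall>x t. t \<le> ptime T \<longrightarrow> \<bar>g x t\<bar> \<le> B)" using tame_bound[OF assms, of "ptime T"] ..
  then have B: "B \<ge> 0" "\<And>x t. t \<le> ptime T \<Longrightarrow> \<bar>g x t\<bar> \<le> B" by auto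
  obtain A where A: "A \<ge> 0" "\<And>t p. 0 \<le> t \<Longrightarrow> t \<le> ptime T \<Longrightarrow> \<bar>w t p\<bar> \<le> A * moment_weight p"
    using bound_w[of "ptime T"] by auto
  show ?thesis
  proof (intro exI[of _ "A * B"] conjI allI impI)
    fix t p y assume t: "t \<le> T"
    then have *: "ptime t \<le> ptime T" by (simp add: ptime_def)
    have "\<bar>w (ptime t) p\<bar> * \<bar>g y (sample_time t p)\<bar> \<le> (A * moment_weight p) * B"
    proof (rule mult_mono)
      show "\<bar>w (ptime t) p\<bar> \<le> A * moment_weight p" using * by (intro A(2)) auto
      show "\<bar>g y (sample_time t p)\<bar> \<le> B" using * ptime_mult_le[of t "fst p"] by (intro B(2)) linarith
      show "0 \<le> A * moment_weight p" using A(1) moment_weight_nonneg[of p] by (rule mult_nonneg_nonneg)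
    qed simp
    then show "\<bar>w (ptime t) p * g y (sample_time t p)\<bar> \<le> A * B * moment_weight p" by (simp only: abs_mult mult.assoc mult.commute[of B] mult.left_commute[of B])
  qed (use A(1) B(1) in simp)
qed

lemma integrable_integrand:
  assumes "tame g"
  shows "integrable rho_gauss (\<lambda>p. w (ptime t) p * g (sample_point x t p) (sample_time t p))"
proof -
  obtain C where "0 \<le> C \<and> (\<forall>s p y. s \<le> t \<longrightarrow> \<bar>w (ptime s) p * g y (sample_time s p)\<bar> \<le> C * moment_weight p)"
    using bound_integrand[OF assms, of t] ..
  then have C: "C \<ge> 0" "\<And>s p y. s \<le> t \<Longrightarrow> \<bar>w (ptime s) p * g y (sample_time s p)\<bar> \<le> C * moment_weight p" by (auto simp del: ptime_simps)
  show ?thesis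
  proof (rule Bochner_Integration.integrable_bound)
    show "integrable rho_gauss (\<lambda>p::real \<times> (real^'n). C * moment_weight p)"
      by (rule integrable_mult_right) (rule integrable_moment_weight)
    show "(\<lambda>p. w (ptime t) p * g (sample_point x t p) (sample_time t p)) \<in> borel_measurable rho_gauss"
      by (rule measurable_integrand[OF assms])
    show "AE p in rho_gauss. norm (w (ptime t) p * g (sample_point x t p) (sample_time t p)) \<le> norm (C * moment_weight p)"
      unfolding real_norm_def by (rule AE_I2, rule order_trans[OF C(2)[OF order.refl] abs_ge_self])
  qed
qed

lemma tame_heat_mean: assumes "tame g" shows "tame (heat_mean w g)"
  unfolding tame_def
proof (intro conjI allI)
  fix T
  obtain C where "0 \<le> C \<and> (\<forall>t p y. t \<le> T \<longrightarrow> \<bar>w (ptime t) p * g y (sample_time t p)\<bar> \<le> C * moment_weight p)"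
      using bound_integrand[OF assms, of T] ..
    then have C: "C \<ge> 0" "\<And>t p y. t \<le> T \<Longrightarrow> \<bar>w (ptime t) p * g y (sample_time t p)\<bar> \<le> C * moment_weight p" by (auto simp del: ptime_simps)
  have "\<bar>heat_mean w g x t\<bar> \<le> (\<integral>p. C * moment_weight (p :: real \<times> (real^'n)) \<partial>rho_gauss)" if "t \<le> T" for x t
  proof -
    have "\<bar>heat_mean w g x t\<bar> \<le> (\<integral>p. \<bar>w (ptime t) p * g (sample_point x t p) (sample_time t p)\<bar> \<partial>rho_gauss)"
      unfolding heat_mean_def by (rule integral_abs_bound)
    also have "\<dots> \<le> (\<integral>p. C * moment_weight (p :: real \<times> (real^'n)) \<partial>rho_gauss)"
      by (intro integral_mono C integrable_abs integrable_integrand assms integrable_mult_right integrable_moment_weight that)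
    finally show ?thesis .
  qed
  then show "\<exists>B. \<forall>x. \<forall>t\<le>T. \<bar>heat_mean w g x t\<bar> \<le> B" by blast
next
  show "continuous_on UNIV (\<lambda>p. heat_mean w g (fst p) (snd p))"
  proof (rule continuous_on_strips)
    fix T
    obtain C where "0 \<le> C \<and> (\<forall>t p y. t \<le> T \<longrightarrow> \<bar>w (ptime t) p * g y (sample_time t p)\<bar> \<le> C * moment_weight p)"
      using bound_integrand[OF assms, of T] ..
    then have C: "C \<ge> 0" "\<And>t p y. t \<le> T \<Longrightarrow> \<bar>w (ptime t) p * g y (sample_time t p)\<bar> \<le> C * moment_weight p" by (auto simp del: ptime_simps)
    show "continuous_on (UNIV \<times> {..<T}) (\<lambda>p. heat_mean w g (fst p) (snd p))"
      unfolding heat_mean_def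
    proof (rule continuous_on_param_integral[where B = "\<lambda>p. C * moment_weight p"])
      fix z :: "real \<times> (real^'n)"
      show "continuous_on (UNIV \<times> {..<T}) (\<lambda>p. w (ptime (snd p)) z * g (sample_point (fst p) (snd p) z) (sample_time (snd p) z))"
        by (rule cont_integrand[OF assms]) (intro continuous_intros)+
    next
      show "\<bar>w (ptime (snd p)) z * g (sample_point (fst p) (snd p) z) (sample_time (snd p) z)\<bar> \<le> C * moment_weight z"
        if "p \<in> UNIV \<times> {..<T}" for p and z :: "real \<times> (real^'n)"
        by (rule C(2)) (use that in \<open>simp add: mem_Times_iff\<close>)
    qed (rule measurable_integrand[OF assms] integrable_mult_right[OF integrable_moment_weight])+
  qed
qed

lemma has_pd_heat_mean:
  assumes g: "tame g" and g': "tame g'" and der: "\<And>x t. has_pd i (\<lambda>x. g x t) x (g' x t)"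
  shows "has_pd i (\<lambda>x. heat_mean w g x t) x (heat_mean w g' x t)"
proof -
  obtain C where "0 \<le> C \<and> (\<forall>s p y. s \<le> t \<longrightarrow> \<bar>w (ptime s) p * g' y (sample_time s p)\<bar> \<le> C * moment_weight p)"
      using bound_integrand[OF g', of t] ..
    then have C: "C \<ge> 0" "\<And>s p y. s \<le> t \<Longrightarrow> \<bar>w (ptime s) p * g' y (sample_time s p)\<bar> \<le> C * moment_weight p" by (auto simp del: ptime_simps)
  let ?y = "\<lambda>h p. (x + h *\<^sub>R axis i 1) + (sqrt (2 * ptime t) * fst p) *\<^sub>R snd p"
  let ?t = "\<lambda>p::real \<times> (real^'n). sample_time t p"
  have "((\<lambda>h. \<integral>p. w (ptime t) p * g (?y h p) (?t p) \<partial>rho_gauss) has_real_derivative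
      (\<integral>p. w (ptime t) p * g' (?y 0 p) (?t p) \<partial>rho_gauss)) (at 0)"
  proof (rule has_real_derivative_param_integral[where B = "\<lambda>p. C * moment_weight p"])
    fix h and p :: "real \<times> (real^'n)"
    have eq: "?y h p = (sample_point x t p) + h *\<^sub>R axis i 1" for h
      by (simp only: add_ac)
    have "((\<lambda>h. g (?y h p) (?t p)) has_real_derivative g' (?y h p) (?t p)) (at h)"
      unfolding eq by (rule iffD1[OF has_pd_along_line[where w = "\<lambda>x. g x (?t p)"]]) (rule der)
    then show "((\<lambda>h. w (ptime t) p * g (?y h p) (?t p)) has_real_derivative w (ptime t) p * g' (?y h p) (?t p)) (at h)"
      by (rule DERIV_cmult)
  next
    show "\<bar>w (ptime t) p * g' (?y h p) (?t p)\<bar> \<le> C * moment_weight p" for h and p :: "real \<times> (real^'n)"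
      by (rule C(2)[OF order.refl])
  qed (rule measurable_integrand[OF g] measurable_integrand[OF g'] integrable_integrand[OF g]
        integrable_mult_right[OF integrable_moment_weight])+
  then show ?thesis by (simp add: has_pd_def heat_mean_def)
qed

end

section \<open>The heat potential\<close>

text \<open>Walk from x to x + v one coordinate at a time and apply the mean value inequality on
  each leg to w minus its linear part.\<close>

lemma partials_increment_bound:
  fixes w :: "real^'n::finite \<Rightarrow> real"
  assumes pd: "\<And>i y. has_pd i w y (D i y)"
    and eps: "\<And>i y. norm (y - x) \<le> r \<Longrightarrow> \<bar>D i y - D i x\<bar> \<le> \<epsilon>" and v: "norm v \<le> r"
  shows "\<bar>w (x + (\<Sum>i\<in>A. v $ i *\<^sub>R axis i 1)) - w x - (\<Sum>i\<in>A. v $ i * D i x)\<bar> \<le> \<epsilon> * (\<Sum>i\<in>A. \<bar>v $ i\<bar>)"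
proof (induction A rule: infinite_finite_induct)
  case (insert k A)
  define p where "p = x + (\<Sum>i\<in>A. v $ i *\<^sub>R axis i 1)"
  have pj: "(\<Sum>i\<in>A. v $ i *\<^sub>R axis i (1::real)) $ j = (if j \<in> A then v $ j else 0)" for j
  proof -
    have "(\<Sum>i\<in>A. v $ i *\<^sub>R axis i (1::real)) $ j = (\<Sum>i\<in>A. v $ i * (axis i 1 $ j))" by simp
    also have "\<dots> = (\<Sum>i\<in>A. if i = j then v $ j else 0)" by (rule sum.cong) (auto simp: axis_def)
    finally have "(\<Sum>i\<in>A. v $ i *\<^sub>R axis i (1::real)) $ j = (\<Sum>i\<in>A. if i = j then v $ j else 0)" .
    then show ?thesis using insert by simp
  qed
  \<comment> \<open>Each component of the deviation from x is at most the corresponding component of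
    v, so no leg leaves the ball where \<open>eps\<close> holds.\<close>
  have close: "norm (p + s *\<^sub>R axis k 1 - x) \<le> r" if "\<bar>s\<bar> \<le> \<bar>v $ k\<bar>" for s
  proof -
    have "norm ((p + s *\<^sub>R axis k 1 - x) $ j) \<le> norm (v $ j)" for j
      using that insert pj[of j] by (auto simp: p_def axis_def)
    then have "norm (p + s *\<^sub>R axis k 1 - x) \<le> norm v" by (rule norm_le_componentwise_cart)
    then show ?thesis using v by simp
  qed
  let ?\<phi> = "\<lambda>s. w (p + s *\<^sub>R axis k 1) - s * D k x"
  let ?I = "{- \<bar>v $ k\<bar> .. \<bar>v $ k\<bar>}"
  have "norm (?\<phi> (v $ k) - ?\<phi> 0) \<le> \<epsilon> * norm (v $ k - 0)"
  proof (rule field_differentiable_bound[where S = ?I and f' = "\<lambda>s. D k (p + s *\<^sub>R axis k 1) - D k x"])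
    fix s assume "s \<in> ?I"
    have "((\<lambda>s. w (p + s *\<^sub>R axis k 1)) has_real_derivative D k (p + s *\<^sub>R axis k 1)) (at s)"
      using pd[of k "p + s *\<^sub>R axis k 1"] unfolding has_pd_along_line .
    then have "(?\<phi> has_real_derivative D k (p + s *\<^sub>R axis k 1) - D k x) (at s)"
      by (auto intro!: derivative_eq_intros)
    then show "(?\<phi> has_real_derivative D k (p + s *\<^sub>R axis k 1) - D k x) (at s within ?I)"
      by (rule has_field_derivative_at_within)
    show "norm (D k (p + s *\<^sub>R axis k 1) - D k x) \<le> \<epsilon>"
      unfolding real_norm_def by (rule eps, rule close) (use \<open>s \<in> ?I\<close> in auto)
  qed auto
  moreover have "x + (\<Sum>i\<in>insert k A. v $ i *\<^sub>R axis i 1) = p + v $ k *\<^sub>R axis k 1"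
    using insert by (simp add: p_def algebra_simps)
  ultimately show ?case using insert by (simp add: p_def algebra_simps)
qed auto

text \<open>\<open>has_pd\<close> sees only the axes, whereas a Gaussian sample moves along an
  arbitrary vector z; continuity of the partial derivatives bridges the gap.\<close>

lemma has_directional_derivative:
  fixes w :: "real^'n::finite \<Rightarrow> real"
  assumes pd: "\<And>i y. has_pd i w y (D i y)" and cont: "\<And>i. continuous_on UNIV (D i)"
  shows "((\<lambda>s. w (x + s *\<^sub>R v)) has_real_derivative (\<Sum>i\<in>UNIV. v $ i * D i x)) (at 0)"
  unfolding DERIV_def LIM_eq
proof (intro allI impI)
  fix e :: real assume e: "e > 0"
  define V where "V = (\<Sum>i\<in>UNIV. \<bar>v $ i\<bar>)"
  have V: "V \<ge> 0" by (auto simp: V_def intro: sum_nonneg)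
  define \<epsilon> where "\<epsilon> = e / (2 * (V + 1))"
  have \<epsilon>: "\<epsilon> > 0" using e V by (auto simp: \<epsilon>_def)
  have "\<epsilon> * V < \<epsilon> * (2 * (V + 1))" using \<epsilon> V by (intro mult_strict_left_mono) auto
  also have "\<dots> = e" using V by (simp add: \<epsilon>_def)
  finally have \<epsilon>V: "\<epsilon> * V < e" .
  have "\<exists>r>0. \<forall>y. dist y x < r \<longrightarrow> dist (D i y) (D i x) < \<epsilon>" for i
    using cont[of i] \<epsilon> unfolding continuous_on_iff by blast
  then obtain r where r: "\<And>i. r i > 0" "\<And>i y. dist y x < r i \<Longrightarrow> dist (D i y) (D i x) < \<epsilon>" by metis
  define R where "R = Min (range r) / 2"
  have Mr: "Min (range r) > 0" using r(1) by (subst Min_gr_iff) auto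
  have R: "R > 0" using Mr by (simp add: R_def)
  have eps: "\<bar>D i y - D i x\<bar> \<le> \<epsilon>" if "norm (y - x) \<le> R" for i y
  proof -
    have "Min (range r) \<le> r i" by (intro Min_le) auto
    then have "dist y x < r i" using that Mr unfolding R_def dist_norm by linarith
    from r(2)[OF this] show ?thesis by (simp add: dist_real_def)
  qed
  show "\<exists>s>0. \<forall>h. h \<noteq> 0 \<and> norm (h - 0) < s \<longrightarrow>
      norm ((w (x + (0 + h) *\<^sub>R v) - w (x + 0 *\<^sub>R v)) / h - (\<Sum>i\<in>UNIV. v $ i * D i x)) < e"
  proof (intro exI[of _ "R / (norm v + 1)"] conjI allI impI)
    show "R / (norm v + 1) > 0" using R by (intro divide_pos_pos add_nonneg_pos) auto
    fix h :: real assume h: "h \<noteq> 0 \<and> norm (h - 0) < R / (norm v + 1)"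
    have pos: "norm v + 1 > 0" by (rule add_nonneg_pos) auto
    have "\<bar>h\<bar> * (norm v + 1) < R" using h pos by (simp add: pos_less_divide_eq)
    then have nv: "norm (h *\<^sub>R v) \<le> R" by (simp add: algebra_simps)
    have "(\<Sum>i\<in>UNIV. (h *\<^sub>R v) $ i *\<^sub>R axis i 1) = h *\<^sub>R v"
      using basis_expansion[of "h *\<^sub>R v"] by (simp add: scalar_mult_eq_scaleR)
    with partials_increment_bound[of w D x R \<epsilon>, OF pd eps nv, where A = UNIV]
    have "\<bar>w (x + h *\<^sub>R v) - w x - h * (\<Sum>i\<in>UNIV. v $ i * D i x)\<bar> \<le> \<epsilon> * (\<bar>h\<bar> * V)"
      by (simp add: V_def abs_mult sum_distrib_left mult_ac)
    also have "\<dots> = \<bar>h\<bar> * (\<epsilon> * V)" by simp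
    also have "\<dots> < \<bar>h\<bar> * e" using h \<epsilon>V by (intro mult_strict_left_mono) auto
    finally have "\<bar>w (x + h *\<^sub>R v) - w x - h * (\<Sum>i\<in>UNIV. v $ i * D i x)\<bar> < \<bar>h\<bar> * e" .
    moreover have "(w (x + h *\<^sub>R v) - w x) / h - (\<Sum>i\<in>UNIV. v $ i * D i x) =
        (w (x + h *\<^sub>R v) - w x - h * (\<Sum>i\<in>UNIV. v $ i * D i x)) / h"
      using h by (simp add: field_simps)
    ultimately show "norm ((w (x + (0 + h) *\<^sub>R v) - w (x + 0 *\<^sub>R v)) / h - (\<Sum>i\<in>UNIV. v $ i * D i x)) < e"
      using h by (simp add: divide_less_eq mult.commute)
  qed
qed

lemma has_line_derivative:
  fixes w :: "real^'n::finite \<Rightarrow> real"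
  assumes "\<And>i y. has_pd i w y (D i y)" "\<And>i. continuous_on UNIV (D i)"
  shows "((\<lambda>\<sigma>. w (x + (k * \<sigma>) *\<^sub>R z)) has_real_derivative (\<Sum>i\<in>UNIV. k * z $ i * D i (x + (k * \<sigma>) *\<^sub>R z))) (at \<sigma>)"
proof -
  have "((\<lambda>s. w ((x + (k * \<sigma>) *\<^sub>R z) + s *\<^sub>R (k *\<^sub>R z))) has_real_derivative
      (\<Sum>i\<in>UNIV. (k *\<^sub>R z) $ i * D i (x + (k * \<sigma>) *\<^sub>R z))) (at 0)"
    by (rule has_directional_derivative[OF assms])
  moreover have eq: "(x + (k * \<sigma>) *\<^sub>R z) + s *\<^sub>R (k *\<^sub>R z) = x + (k * (s + \<sigma>)) *\<^sub>R z" for s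
    by (simp add: algebra_simps)
  ultimately have "((\<lambda>s. w (x + (k * (s + \<sigma>)) *\<^sub>R z)) has_real_derivative
      (\<Sum>i\<in>UNIV. k * z $ i * D i (x + (k * \<sigma>) *\<^sub>R z))) (at 0)"
    unfolding eq by simp
  then show ?thesis
    using DERIV_shift[of "\<lambda>\<sigma>. w (x + (k * \<sigma>) *\<^sub>R z)" _ 0 \<sigma>] by simp
qed

text \<open>The parameter is the width \<sigma>, a square root of time: in it the average is
  differentiable down to \<sigma> = 0 with first derivatives of w only.\<close>

lemma gauss_average_derivative:
  fixes w :: "real^'n::finite \<Rightarrow> real"
  assumes pd: "\<And>i y. has_pd i w y (D i y)" and cont: "\<And>i. continuous_on UNIV (D i)" "continuous_on UNIV w"
    and B: "\<And>y. \<bar>w y\<bar> \<le> B" "\<And>i y. \<bar>D i y\<bar> \<le> B"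
  shows "((\<lambda>\<sigma>. \<integral>z. w (x + (k * \<sigma>) *\<^sub>R z) \<partial>gauss) has_real_derivative
     (\<integral>z. (\<Sum>i\<in>UNIV. k * z $ i * D i (x + (k * \<sigma>) *\<^sub>R z)) \<partial>gauss)) (at \<sigma>)"
proof -
  interpret G: prob_space "gauss :: (real^'n) measure" by (rule prob_space_gauss)
  have B0: "B \<ge> 0" using B(1)[of 0] by linarith
  have m: "(\<lambda>z. w (x + (k * \<sigma>) *\<^sub>R z)) \<in> borel_measurable gauss" for \<sigma>
    by (subst measurable_cong_sets[OF sets_gauss refl], rule borel_measurable_continuous_onI)
       (intro continuous_on_compose2[OF cont(2)] continuous_intros subset_UNIV)
  have m': "(\<lambda>z. \<Sum>i\<in>UNIV. k * z $ i * D i (x + (k * \<sigma>) *\<^sub>R z)) \<in> borel_measurable gauss" for \<sigma>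
    by (subst measurable_cong_sets[OF sets_gauss refl], rule borel_measurable_continuous_onI)
       (intro continuous_on_sum continuous_on_mult continuous_on_compose2[OF cont(1)] continuous_intros subset_UNIV)
  have "((\<lambda>h. \<integral>z. w (x + (k * (h + \<sigma>)) *\<^sub>R z) \<partial>gauss) has_real_derivative
     (\<integral>z. (\<Sum>i\<in>UNIV. k * z $ i * D i (x + (k * (0 + \<sigma>)) *\<^sub>R z)) \<partial>gauss)) (at 0)"
  proof (rule has_real_derivative_param_integral[where B = "\<lambda>z. (real CARD('n) * \<bar>k\<bar> * B) * norm z"])
    show "integrable gauss (\<lambda>z. w (x + (k * (h + \<sigma>)) *\<^sub>R z))" for h
      by (rule G.integrable_const_bound[where B = B]) (use B m in auto)
    show "integrable (gauss :: (real^'n) measure) (\<lambda>z. (real CARD('n) * \<bar>k\<bar> * B) * norm z)"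
      by (rule integrable_mult_right[OF integrable_gauss_norm])
    fix h and z :: "real^'n"
    show "((\<lambda>h. w (x + (k * (h + \<sigma>)) *\<^sub>R z)) has_real_derivative
        (\<Sum>i\<in>UNIV. k * z $ i * D i (x + (k * (h + \<sigma>)) *\<^sub>R z))) (at h)"
      using has_line_derivative[OF pd cont(1), of x k z "h + \<sigma>"]
      by (simp only: DERIV_shift)
    have "\<bar>\<Sum>i\<in>UNIV. k * z $ i * D i (x + (k * (h + \<sigma>)) *\<^sub>R z)\<bar> \<le> (\<Sum>i\<in>(UNIV::'n set). \<bar>k\<bar> * norm z * B)"
      by (rule order_trans[OF sum_abs sum_mono]) (auto simp: abs_mult intro!: mult_mono B component_le_norm_cart)
    then show "\<bar>\<Sum>i\<in>UNIV. k * z $ i * D i (x + (k * (h + \<sigma>)) *\<^sub>R z)\<bar> \<le> (real CARD('n) * \<bar>k\<bar> * B) * norm z"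
      by (simp add: mult_ac)
  qed (use m m' in simp_all)
  then show ?thesis
    using DERIV_shift[of "\<lambda>\<sigma>. \<integral>z. w (x + (k * \<sigma>) *\<^sub>R z) \<partial>gauss" _ 0 \<sigma>] by simp
qed

text \<open>Both sides integrate \<open>c\<close> over \<open>{\<sigma> \<ge> 0, r \<ge> 0, r + \<sigma>\<^sup>2 \<le> t}\<close>; the right one after the shear
  \<open>s = r + \<sigma>\<^sup>2\<close>. This replaces the semigroup property of the heat kernel.\<close>

lemma shear_fubini:
  fixes c :: "real \<Rightarrow> real \<Rightarrow> real"
  assumes cont: "continuous_on UNIV (\<lambda>p. c (fst p) (snd p))" and t: "t \<ge> 0"
  shows "integral {0..t} (\<lambda>r. integral {0..sqrt (t - r)} (\<lambda>\<sigma>. c \<sigma> r)) =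
         integral {0..t} (\<lambda>s. integral {0..sqrt s} (\<lambda>\<sigma>. c \<sigma> (s - \<sigma>\<^sup>2)))"
proof -
  let ?L = "lborel \<Otimes>\<^sub>M lborel :: (real \<times> real) measure"
  \<comment> \<open>Extension by 0 turns both iterated integrals into integrals over the plane,
    where Fubini and translation invariance apply without moving limits.\<close>
  define E where "E = (\<lambda>(\<sigma>, r). indicator {p::real\<times>real. 0 \<le> fst p \<and> 0 \<le> snd p \<and> snd p + (fst p)\<^sup>2 \<le> t} (\<sigma>, r) * c \<sigma> r)"
  define E' where "E' = (\<lambda>(\<sigma>, s). E (\<sigma>, s - \<sigma>\<^sup>2))"
  have cm: "(\<lambda>p. c (fst p) (snd p)) \<in> borel_measurable borel" using cont by (rule borel_measurable_continuous_onI)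
  have cont2: "continuous_on S (\<lambda>\<sigma>. c (a \<sigma>) (b \<sigma>))" if "continuous_on S a" "continuous_on S b" for S :: "real set" and a b
    using continuous_on_compose2[OF cont, of S "\<lambda>\<sigma>. (a \<sigma>, b \<sigma>)"] that by (auto intro: continuous_intros)
  have clos: "closed {p::real\<times>real. 0 \<le> fst p \<and> 0 \<le> snd p \<and> snd p + (fst p)\<^sup>2 \<le> t}"
    by (intro closed_Collect_conj closed_Collect_le continuous_intros)
  have Em: "E \<in> borel_measurable borel"
    unfolding E_def case_prod_beta using clos cm by (auto intro!: borel_measurable_times borel_measurable_indicator borel_closed)
  have E'm: "E' \<in> borel_measurable borel"
  proof -
    have "(\<lambda>p::real\<times>real. (fst p, snd p - (fst p)\<^sup>2)) \<in> borel_measurable borel"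
      by (rule borel_measurable_continuous_onI) (intro continuous_intros)
    then have "(\<lambda>p. E (fst p, snd p - (fst p)\<^sup>2)) \<in> borel_measurable borel"
      by (rule measurable_compose) (rule Em)
    then show ?thesis by (simp add: E'_def case_prod_beta)
  qed
  have sL: "sets ?L = sets borel" by (subst lborel_prod) simp
  have "compact ((\<lambda>p. c (fst p) (snd p)) ` ({0..sqrt t} \<times> {0..t}))"
    by (intro compact_continuous_image continuous_on_subset[OF cont] compact_Times) auto
  then obtain B where B: "\<And>\<sigma> r. 0 \<le> \<sigma> \<Longrightarrow> \<sigma> \<le> sqrt t \<Longrightarrow> 0 \<le> r \<Longrightarrow> r \<le> t \<Longrightarrow> \<bar>c \<sigma> r\<bar> \<le> B"
  proof -
    assume *: "compact ((\<lambda>p. c (fst p) (snd p)) ` ({0..sqrt t} \<times> {0..t}))"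
    obtain B where B: "\<forall>y\<in>(\<lambda>p. c (fst p) (snd p)) ` ({0..sqrt t} \<times> {0..t}). norm y \<le> B"
      using compact_imp_bounded[OF *] unfolding bounded_iff ..
    show thesis
    proof (rule that)
      fix \<sigma> r assume "0 \<le> \<sigma>" "\<sigma> \<le> sqrt t" "0 \<le> r" "r \<le> t"
      then show "\<bar>c \<sigma> r\<bar> \<le> B" using B[rule_format, OF imageI[of "(\<sigma>, r)"]] by simp
    qed
  qed
  have B0: "B \<ge> 0" using B[of 0 0] t by auto
  have Eb: "\<bar>E (\<sigma>, r)\<bar> \<le> B * indicator ({0..sqrt t} \<times> {0..t}) (\<sigma>, r)" for \<sigma> r
  proof (cases "0 \<le> \<sigma> \<and> 0 \<le> r \<and> r + \<sigma>\<^sup>2 \<le> t")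
    case True
    then have "\<sigma>\<^sup>2 \<le> t" "r \<le> t" using zero_le_power2[of \<sigma>] by linarith+
    then have "\<sigma> \<le> sqrt t" by (intro real_le_rsqrt)
    then show ?thesis using True B \<open>r \<le> t\<close> by (simp add: E_def)
  next
    case False then show ?thesis using B0 by (auto simp: E_def indicator_def)
  qed
  have E'b: "\<bar>E' (\<sigma>, s)\<bar> \<le> B * indicator ({0..sqrt t} \<times> {0..t}) (\<sigma>, s)" for \<sigma> s
  proof (cases "0 \<le> \<sigma> \<and> 0 \<le> s - \<sigma>\<^sup>2 \<and> s \<le> t")
    case True
    then have "\<sigma>\<^sup>2 \<le> t" "0 \<le> s" "s - \<sigma>\<^sup>2 \<le> t" using zero_le_power2[of \<sigma>] by linarith+
    then have "\<sigma> \<le> sqrt t" by (intro real_le_rsqrt)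
    then show ?thesis using True B[of \<sigma> "s - \<sigma>\<^sup>2"] \<open>s - \<sigma>\<^sup>2 \<le> t\<close> \<open>0 \<le> s\<close> by (simp add: E'_def E_def)
  next
    case False then show ?thesis using B0 by (auto simp: E_def E'_def indicator_def)
  qed
  have iB: "integrable ?L (\<lambda>p. B * indicator ({0..sqrt t} \<times> {0..t}) p)"
    by (rule integrable_mult_right, unfold lborel_prod, rule integrable_real_indicator)
       (use emeasure_bounded_finite[OF bounded_Times[OF bounded_closed_interval bounded_closed_interval], of 0 "sqrt t" 0 t] in
        \<open>auto simp: closed_Times borel_closed\<close>)
  have iE: "integrable ?L E"
  proof (rule Bochner_Integration.integrable_bound[OF iB])
    show "E \<in> borel_measurable ?L" unfolding measurable_cong_sets[OF sL refl] by (rule Em)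
    show "AE p in ?L. norm (E p) \<le> norm (B * indicator ({0..sqrt t} \<times> {0..t}) p)"
    proof (rule AE_I2)
      fix p show "norm (E p) \<le> norm (B * indicator ({0..sqrt t} \<times> {0..t}) p)"
        using Eb[of "fst p" "snd p"] unfolding real_norm_def prod.collapse by linarith
    qed
  qed
  have iE': "integrable ?L E'"
  proof (rule Bochner_Integration.integrable_bound[OF iB])
    show "E' \<in> borel_measurable ?L" unfolding measurable_cong_sets[OF sL refl] by (rule E'm)
    show "AE p in ?L. norm (E' p) \<le> norm (B * indicator ({0..sqrt t} \<times> {0..t}) p)"
    proof (rule AE_I2)
      fix p show "norm (E' p) \<le> norm (B * indicator ({0..sqrt t} \<times> {0..t}) p)"
        using E'b[of "fst p" "snd p"] unfolding real_norm_def prod.collapse by linarith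
    qed
  qed
  have inner: "(\<integral>\<sigma>. E (\<sigma>, r) \<partial>lborel) = indicator {0..t} r * integral {0..sqrt (t - r)} (\<lambda>\<sigma>. c \<sigma> r)" for r
  proof -
    have eq: "E (\<sigma>, r) = indicator {0..t} r * (indicator {0..sqrt (t - r)} \<sigma> *\<^sub>R c \<sigma> r)" for \<sigma>
    proof -
      have "(0 \<le> \<sigma> \<and> 0 \<le> r \<and> r + \<sigma>\<^sup>2 \<le> t) = ((0 \<le> r \<and> r \<le> t) \<and> 0 \<le> \<sigma> \<and> \<sigma> \<le> sqrt (t - r))"
      proof safe
        assume *: "0 \<le> \<sigma>" "0 \<le> r" "r + \<sigma>\<^sup>2 \<le> t"
        then show "r \<le> t" using zero_le_power2[of \<sigma>] by linarith
        show "\<sigma> \<le> sqrt (t - r)" using * by (intro real_le_rsqrt) simp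
      next
        assume *: "0 \<le> \<sigma>" "0 \<le> r" "r \<le> t" "\<sigma> \<le> sqrt (t - r)"
        then have "\<sigma>\<^sup>2 \<le> (sqrt (t - r))\<^sup>2" by (intro power_mono)
        with * show "r + \<sigma>\<^sup>2 \<le> t" by simp
      qed
      then show ?thesis by (auto simp: E_def indicator_def)
    qed
    have "(LBINT \<sigma>:{0..sqrt (t - r)}. c \<sigma> r) = integral {0..sqrt (t - r)} (\<lambda>\<sigma>. c \<sigma> r)"
      by (intro set_borel_integral_eq_integral borel_integrable_atLeastAtMost' cont2 continuous_intros)
    then show ?thesis unfolding eq by (simp add: set_lebesgue_integral_def)
  qed
  have inner': "(\<integral>\<sigma>. E' (\<sigma>, s) \<partial>lborel) = indicator {0..t} s * integral {0..sqrt s} (\<lambda>\<sigma>. c \<sigma> (s - \<sigma>\<^sup>2))" for s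
  proof -
    have eq: "E' (\<sigma>, s) = indicator {0..t} s * (indicator {0..sqrt s} \<sigma> *\<^sub>R c \<sigma> (s - \<sigma>\<^sup>2))" for \<sigma>
    proof -
      have "(0 \<le> \<sigma> \<and> 0 \<le> s - \<sigma>\<^sup>2 \<and> s \<le> t) = ((0 \<le> s \<and> s \<le> t) \<and> 0 \<le> \<sigma> \<and> \<sigma> \<le> sqrt s)"
      proof safe
        assume *: "0 \<le> \<sigma>" "0 \<le> s - \<sigma>\<^sup>2" "s \<le> t"
        then show "0 \<le> s" using zero_le_power2[of \<sigma>] by linarith
        show "\<sigma> \<le> sqrt s" using * by (intro real_le_rsqrt) simp
      next
        assume *: "0 \<le> \<sigma>" "0 \<le> s" "s \<le> t" "\<sigma> \<le> sqrt s"
        then have "\<sigma>\<^sup>2 \<le> (sqrt s)\<^sup>2" by (intro power_mono)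
        with * show "0 \<le> s - \<sigma>\<^sup>2" by simp
      qed
      then show ?thesis by (auto simp: E'_def E_def indicator_def)
    qed
    have "(LBINT \<sigma>:{0..sqrt s}. c \<sigma> (s - \<sigma>\<^sup>2)) = integral {0..sqrt s} (\<lambda>\<sigma>. c \<sigma> (s - \<sigma>\<^sup>2))"
      by (intro set_borel_integral_eq_integral borel_integrable_atLeastAtMost' cont2 continuous_intros)
    then show ?thesis unfolding eq by (simp add: set_lebesgue_integral_def)
  qed
  have outer: "(\<integral>r. indicator {0..t} r * J r \<partial>lborel) = integral {0..t} J"
    if "integrable lborel (\<lambda>r. indicator {0..t} r * J r)" for J :: "real \<Rightarrow> real"
    using set_borel_integral_eq_integral(2)[of "{0..t}" J] that
    by (simp add: set_integrable_def set_lebesgue_integral_def)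
  \<comment> \<open>For fixed \<sigma> the shear is a translation by \<sigma>^2 in the second
    variable.\<close>
  have shift: "(\<integral>s. E' (\<sigma>, s) \<partial>lborel) = (\<integral>r. E (\<sigma>, r) \<partial>lborel)" for \<sigma>
    using lborel_integral_real_affine[of 1 "\<lambda>r. E (\<sigma>, r)" "- \<sigma>\<^sup>2"] by (simp add: E'_def)
  have "integral {0..t} (\<lambda>r. integral {0..sqrt (t - r)} (\<lambda>\<sigma>. c \<sigma> r)) = (\<integral>r. (\<integral>\<sigma>. E (\<sigma>, r) \<partial>lborel) \<partial>lborel)"
    unfolding inner using lborel_pair.integrable_snd[of "\<lambda>x y. E (x, y)"] iE
    by (intro outer[symmetric]) (simp add: inner)
  also have "\<dots> = (\<integral>\<sigma>. (\<integral>r. E (\<sigma>, r) \<partial>lborel) \<partial>lborel)"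
    using lborel_pair.Fubini_integral[of "\<lambda>x y. E (x, y)"] iE by simp
  also have "\<dots> = (\<integral>\<sigma>. (\<integral>s. E' (\<sigma>, s) \<partial>lborel) \<partial>lborel)" by (simp only: shift)
  also have "\<dots> = (\<integral>s. (\<integral>\<sigma>. E' (\<sigma>, s) \<partial>lborel) \<partial>lborel)"
    using lborel_pair.Fubini_integral[of "\<lambda>x y. E' (x, y)"] iE' by simp
  also have "\<dots> = integral {0..t} (\<lambda>s. integral {0..sqrt s} (\<lambda>\<sigma>. c \<sigma> (s - \<sigma>\<^sup>2)))"
    unfolding inner' using lborel_pair.integrable_snd[of "\<lambda>x y. E' (x, y)"] iE'
    by (intro outer) (simp add: inner')
  finally show ?thesis .
qed

text \<open>Think of \<open>a \<sigma> r\<close> as the Gaussian average of width \<sigma> of the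
  source at time r, and of c as its derivative in \<sigma>; then w is the Duhamel integral of
  \<open>a (sqrt (t - r)) r\<close> over r in [0, t]. Differentiating this in t directly meets the
  singular factor 1 / sqrt (t - r). Instead a is written as \<open>a 0 r\<close> plus an integral of
  c, the two integrations are exchanged by \<open>shear_fubini\<close>, and w becomes the integral
  of \<open>a 0 r + \<Lambda> r\<close> over [0, t], to which the fundamental theorem of calculus
  applies.\<close>

lemma duhamel_scalar_derivative:
  fixes a c :: "real \<Rightarrow> real \<Rightarrow> real"
  assumes ca: "continuous_on UNIV (\<lambda>p. a (fst p) (snd p))" and cc: "continuous_on UNIV (\<lambda>p. c (fst p) (snd p))"
    and der: "\<And>\<sigma> r. ((\<lambda>\<sigma>. a \<sigma> r) has_real_derivative c \<sigma> r) (at \<sigma>)"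
    and w: "\<And>t. t \<ge> 0 \<Longrightarrow> w t = integral {0..1} (\<lambda>\<rho>. 2 * t * \<rho> * a (sqrt t * \<rho>) (t * (1 - \<rho>\<^sup>2)))"
    and \<Lambda>: "\<And>t. t \<ge> 0 \<Longrightarrow> \<Lambda> t = integral {0..1} (\<lambda>\<rho>. sqrt t * c (sqrt t * \<rho>) (t * (1 - \<rho>\<^sup>2)))"
    and c\<Lambda>: "continuous_on {0..} \<Lambda>" and t: "t > 0"
  shows "(w has_real_derivative a 0 t + \<Lambda> t) (at t)"
proof -
  have cont2: "continuous_on S (\<lambda>\<sigma>. g (u \<sigma>) (v \<sigma>))"
    if "continuous_on UNIV (\<lambda>p. g (fst p) (snd p))" "continuous_on S u" "continuous_on S v"
    for S :: "real set" and u v and g :: "real \<Rightarrow> real \<Rightarrow> real"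
    using continuous_on_compose2[OF that(1), of S "\<lambda>\<sigma>. (u \<sigma>, v \<sigma>)"] that by (auto intro: continuous_intros)
  have w1: "w t = integral {0..t} (\<lambda>r. a (sqrt (t - r)) r)" if "t \<ge> 0" for t
  proof -
    let ?f = "\<lambda>r. a (sqrt (t - r)) r"
    have "((\<lambda>\<rho>. (- 2 * t * \<rho>) *\<^sub>R ?f (t * (1 - \<rho>\<^sup>2))) has_integral
        (integral {t * (1 - 0\<^sup>2)..t * (1 - 1\<^sup>2)} ?f - integral {t * (1 - 1\<^sup>2)..t * (1 - 0\<^sup>2)} ?f)) {0..1}"
    proof (rule has_integral_substitution_general[where s = "{}" and c = 0 and d = t])
      show "(\<lambda>\<rho>. t * (1 - \<rho>\<^sup>2)) ` {0..1} \<subseteq> {0..t}"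
        using that by (auto simp: power_le_one mult_left_le)
      show "continuous_on {0..t} ?f" by (intro cont2[OF ca] continuous_intros)
      show "continuous_on {0..1} (\<lambda>\<rho>. t * (1 - \<rho>\<^sup>2))" by (intro continuous_intros)
    qed (auto intro!: derivative_eq_intros)
    \<comment> \<open>The map from \<rho> to t (1 - \<rho>^2) decreases. Of the two oriented
      integrals in the substitution rule, this one runs over an empty or one-point interval.\<close>
    moreover have "integral {t..0} ?f = 0" using that by (cases "t = 0") auto
    ultimately have *: "((\<lambda>\<rho>. (- 2 * t * \<rho>) * ?f (t * (1 - \<rho>\<^sup>2))) has_integral - integral {0..t} ?f) {0..1}"
      by simp
    have "integral {0..1} (\<lambda>\<rho>. - ((- 2 * t * \<rho>) * ?f (t * (1 - \<rho>\<^sup>2)))) = integral {0..t} ?f"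
      using integral_unique[OF has_integral_neg[OF *]] by simp
    moreover have "integral {0..1} (\<lambda>\<rho>. - ((- 2 * t * \<rho>) * ?f (t * (1 - \<rho>\<^sup>2)))) = w t"
      unfolding w[OF that]
    proof (rule integral_cong)
      fix \<rho> :: real assume \<rho>: "\<rho> \<in> {0..1}"
      have "t - t * (1 - \<rho>\<^sup>2) = t * \<rho>\<^sup>2" by (simp add: right_diff_distrib)
      then have "sqrt (t - t * (1 - \<rho>\<^sup>2)) = sqrt t * \<rho>" using \<rho> by (simp add: real_sqrt_mult)
      then show "- ((- 2 * t * \<rho>) * ?f (t * (1 - \<rho>\<^sup>2))) = 2 * t * \<rho> * a (sqrt t * \<rho>) (t * (1 - \<rho>\<^sup>2))" by simp
    qed
    ultimately show ?thesis by simp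
  qed
  have \<Lambda>1: "\<Lambda> t = integral {0..sqrt t} (\<lambda>\<sigma>. c \<sigma> (t - \<sigma>\<^sup>2))" if "t \<ge> 0" for t
  proof -
    let ?f = "\<lambda>\<sigma>. c \<sigma> (t - \<sigma>\<^sup>2)"
    have *: "((\<lambda>\<rho>. sqrt t *\<^sub>R ?f (sqrt t * \<rho>)) has_integral (integral {sqrt t * 0..sqrt t * 1} ?f)) {0..1}"
    proof (rule has_integral_substitution[where c = 0 and d = "sqrt t"])
      show "(\<lambda>\<rho>. sqrt t * \<rho>) ` {0..1} \<subseteq> {0..sqrt t}" using that by (auto simp: mult_left_le)
      show "continuous_on {0..sqrt t} ?f" by (intro cont2[OF cc] continuous_intros)
    qed (use that in \<open>auto intro!: derivative_eq_intros\<close>)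
    have "integral {0..1} (\<lambda>\<rho>. sqrt t *\<^sub>R ?f (sqrt t * \<rho>)) = integral {0..sqrt t} ?f"
      using integral_unique[OF *] by simp
    moreover have "t - (sqrt t * \<rho>)\<^sup>2 = t * (1 - \<rho>\<^sup>2)" for \<rho>
      using that by (simp add: power_mult_distrib right_diff_distrib)
    ultimately show ?thesis unfolding \<Lambda>[OF that] by simp
  qed
  have a1: "a (sqrt (t - r)) r = a 0 r + integral {0..sqrt (t - r)} (\<lambda>\<sigma>. c \<sigma> r)" if "r \<in> {0..t}" for t r
  proof -
    have "((\<lambda>\<sigma>. c \<sigma> r) has_integral (a (sqrt (t - r)) r - a 0 r)) {0..sqrt (t - r)}"
      using that by (intro fundamental_theorem_of_calculus)
        (auto intro!: has_field_derivative_at_within der simp flip: has_real_derivative_iff_has_vector_derivative)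
    then show ?thesis by (simp add: integral_unique)
  qed
  have w2: "w t = integral {0..t} (\<lambda>r. a 0 r + \<Lambda> r)" if t: "t \<ge> 0" for t
  proof -
    have i1: "(\<lambda>r. a (sqrt (t - r)) r) integrable_on {0..t}"
      by (intro integrable_continuous_interval cont2[OF ca] continuous_intros)
    have i2: "(\<lambda>r. a 0 r) integrable_on {0..t}"
      by (intro integrable_continuous_interval cont2[OF ca] continuous_intros)
    have "integral {0..t} (\<lambda>r. integral {0..sqrt (t - r)} (\<lambda>\<sigma>. c \<sigma> r))
        = integral {0..t} (\<lambda>r. a (sqrt (t - r)) r - a 0 r)"
      by (rule integral_cong) (simp add: a1)
    also have "\<dots> = integral {0..t} (\<lambda>r. a (sqrt (t - r)) r) - integral {0..t} (\<lambda>r. a 0 r)"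
      by (rule integral_diff[OF i1 i2])
    finally have "w t = integral {0..t} (\<lambda>r. a 0 r) + integral {0..t} (\<lambda>r. integral {0..sqrt (t - r)} (\<lambda>\<sigma>. c \<sigma> r))"
      by (simp add: w1[OF t])
    also have "integral {0..t} (\<lambda>r. integral {0..sqrt (t - r)} (\<lambda>\<sigma>. c \<sigma> r)) = integral {0..t} \<Lambda>"
      unfolding shear_fubini[OF cc t] by (rule integral_cong) (simp add: \<Lambda>1)
    also have "integral {0..t} (\<lambda>r. a 0 r) + integral {0..t} \<Lambda> = integral {0..t} (\<lambda>r. a 0 r + \<Lambda> r)"
      by (intro integral_add[symmetric] i2 integrable_continuous_interval continuous_on_subset[OF c\<Lambda>]) auto
    finally show ?thesis .
  qed
  have "((\<lambda>u. integral {0..u} (\<lambda>r. a 0 r + \<Lambda> r)) has_real_derivative a 0 t + \<Lambda> t) (at t within {0..t+1})"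
    using t by (intro integral_has_real_derivative continuous_intros cont2[OF ca] continuous_on_subset[OF c\<Lambda>]) auto
  then have "(w has_real_derivative a 0 t + \<Lambda> t) (at t within {0..t+1})"
    by (rule has_field_derivative_transform_within[of _ _ _ _ 1]) (use t w2 in auto)
  moreover have "at t within {0..t+1} = at t" using t by (intro at_within_interior) auto
  ultimately show ?thesis by simp
qed

text \<open>The Duhamel integral of the heat semigroup against g; the weight 2 t \<rho> is the
  Jacobian of s = t (1 - \<rho>^2).\<close>

definition potential :: "(real^'n::finite \<Rightarrow> real \<Rightarrow> real) \<Rightarrow> real^'n \<Rightarrow> real \<Rightarrow> real" where
  "potential = heat_mean (\<lambda>t p. 2 * t * fst p)"

text \<open>Gaussian integration by parts moves a derivative of the potential onto the weight
  (\<open>potential_eq_potential_grad\<close>), so this is the gradient of \<open>potential\<close> even for merely continuous densities.\<close>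

definition potential_grad :: "'n \<Rightarrow> (real^'n::finite \<Rightarrow> real \<Rightarrow> real) \<Rightarrow> real^'n \<Rightarrow> real \<Rightarrow> real" where
  "potential_grad i = heat_mean (\<lambda>t p. sqrt (2 * t) * (snd p $ i))"

interpretation W0: mean_weight "\<lambda>t p. 2 * t * fst (p :: real \<times> (real^'n::finite))"
proof
  show "continuous_on UNIV (\<lambda>q::real \<times> (real \<times> (real^'n)). 2 * fst q * fst (snd q))" by (intro continuous_intros)
  fix T :: real
  have "\<bar>2 * t * fst p\<bar> \<le> (2 * ptime T) * moment_weight p" if "0 \<le> t \<and> t \<le> T" for t and p :: "real \<times> (real^'n)"
  proof -
    have "\<bar>2 * t * fst p\<bar> = (2 * t) * \<bar>fst p\<bar>" using that by (simp add: abs_mult)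
    also have "\<dots> \<le> (2 * ptime T) * moment_weight p" using that by (intro mult_mono) (auto simp: ptime_def moment_weight_def)
    finally show ?thesis .
  qed
  then show "\<exists>A\<ge>0. \<forall>t p. 0 \<le> t \<and> t \<le> T \<longrightarrow> \<bar>2 * t * fst (p :: real \<times> (real^'n))\<bar> \<le> A * moment_weight p"
    by (intro exI[of _ "2 * ptime T"]) simp
qed

interpretation W1: mean_weight "\<lambda>t p. sqrt (2 * t) * (snd (p :: real \<times> (real^'n::finite)) $ i)" for i
proof
  show "continuous_on UNIV (\<lambda>q::real \<times> (real \<times> (real^'n)). sqrt (2 * fst q) * (snd (snd q) $ i))"
    by (intro continuous_intros)
  fix T :: real
  have "\<bar>sqrt (2 * t) * (snd p $ i)\<bar> \<le> sqrt (2 * ptime T) * moment_weight p" if "0 \<le> t \<and> t \<le> T" for t and p :: "real \<times> (real^'n)"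
  proof -
    have "\<bar>sqrt (2 * t) * (snd p $ i)\<bar> = sqrt (2 * t) * \<bar>snd p $ i\<bar>" using that by (simp add: abs_mult)
    also have "\<dots> \<le> sqrt (2 * ptime T) * moment_weight p"
      using that component_le_norm_cart[of "snd p" i] by (intro mult_mono) (auto simp: ptime_def moment_weight_def)
    finally show ?thesis .
  qed
  then show "\<exists>A\<ge>0. \<forall>t p. 0 \<le> t \<and> t \<le> T \<longrightarrow> \<bar>sqrt (2 * t) * (snd (p :: real \<times> (real^'n)) $ i)\<bar> \<le> A * moment_weight p"
    by (intro exI[of _ "sqrt (2 * ptime T)"]) simp
qed

lemmas tame_potential = W0.tame_heat_mean[folded potential_def]
lemmas tame_potential_grad = W1.tame_heat_mean[folded potential_grad_def]
lemmas has_pd_potential = W0.has_pd_heat_mean[folded potential_def]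
lemmas has_pd_potential_grad = W1.has_pd_heat_mean[folded potential_grad_def]

lemma tame_cont: "tame g \<Longrightarrow> continuous_on S (\<lambda>x. g x t)"
  by (rule tameD_cont[of g S "\<lambda>x. x" "\<lambda>x. t"]) (assumption | intro continuous_intros)+

lemma potential_eq_potential_grad:
  assumes g: "tame g" and g': "tame g'" and der: "\<And>x t. has_pd i (\<lambda>x. g x t) x (g' x t)"
  shows "potential g' x t = potential_grad i g x t"
proof -
  let ?a = "sqrt (2 * ptime t)"
  \<comment> \<open>Integration by parts produces the factor \<open>?a * \<rho>\<close>; one further
    \<open>?a\<close> turns it into the Jacobian 2 t \<rho>, so nothing is ever divided by
    \<rho>.\<close>
  have aa: "?a * ?a = 2 * ptime t" by simp
  have inner: "(\<integral>z. 2 * ptime t * \<rho> * g' (x + (?a * \<rho>) *\<^sub>R z) s \<partial>gauss) = (\<integral>z. ?a * z $ i * g (x + (?a * \<rho>) *\<^sub>R z) s \<partial>gauss)" for \<rho> s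
  proof -
    obtain B where B: "\<And>x. \<bar>g x s\<bar> \<le> B" using tame_bound[OF g, of s] by auto
    obtain B' where B': "\<And>x. \<bar>g' x s\<bar> \<le> B'" "B' \<ge> 0" using tame_bound[OF g', of s] by auto
    have "(\<integral>z. z $ i * g (x + (?a * \<rho>) *\<^sub>R z) s \<partial>gauss) = (\<integral>z. (?a * \<rho>) * g' (x + (?a * \<rho>) *\<^sub>R z) s \<partial>gauss)"
    proof (rule gauss_integration_by_parts[where B = "max B (\<bar>?a * \<rho>\<bar> * B')"])
      fix z
      have "((\<lambda>h. g ((x + (?a * \<rho>) *\<^sub>R z) + ((?a * \<rho>) * h) *\<^sub>R axis i 1) s) has_real_derivative
         g' (x + (?a * \<rho>) *\<^sub>R z) s * (?a * \<rho>)) (at 0)"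
        by (rule DERIV_chain'[where g = "\<lambda>h. g ((x + (?a * \<rho>) *\<^sub>R z) + h *\<^sub>R axis i 1) s" and f = "\<lambda>h. (?a * \<rho>) * h"])
           (use der[where x = "x + (?a * \<rho>) *\<^sub>R z" and t = s] in \<open>auto intro!: derivative_eq_intros simp: has_pd_def\<close>)
      then show "has_pd i (\<lambda>z. g (x + (?a * \<rho>) *\<^sub>R z) s) z ((?a * \<rho>) * g' (x + (?a * \<rho>) *\<^sub>R z) s)"
        unfolding has_pd_def by (simp add: scaleR_add_right add.assoc mult.commute)
      show "\<bar>g (x + (?a * \<rho>) *\<^sub>R z) s\<bar> \<le> max B (\<bar>?a * \<rho>\<bar> * B')" by (rule max.coboundedI1) (rule B)
      show "\<bar>(?a * \<rho>) * g' (x + (?a * \<rho>) *\<^sub>R z) s\<bar> \<le> max B (\<bar>?a * \<rho>\<bar> * B')"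
        unfolding abs_mult[of "?a * \<rho>"] by (rule max.coboundedI2) (intro mult_left_mono B' abs_ge_zero)
    next
      show "continuous_on UNIV (\<lambda>z. g (x + (?a * \<rho>) *\<^sub>R z) s)"
        by (rule tameD_cont[OF g]) (intro continuous_intros)+
      show "continuous_on UNIV (\<lambda>z. (?a * \<rho>) * g' (x + (?a * \<rho>) *\<^sub>R z) s)"
        by (rule continuous_on_mult_left, rule tameD_cont[OF g']) (intro continuous_intros)+
    qed
    then have "?a * (\<integral>z. z $ i * g (x + (?a * \<rho>) *\<^sub>R z) s \<partial>gauss) = ?a * (\<integral>z. (?a * \<rho>) * g' (x + (?a * \<rho>) *\<^sub>R z) s \<partial>gauss)"
      by (rule arg_cong)
    then show ?thesis
      unfolding integral_mult_right_zero[symmetric] mult.assoc[symmetric] aa by simp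
  qed
  have "potential g' x t = (\<integral>\<rho>. (\<integral>z. 2 * ptime t * \<rho> * g' (x + (?a * \<rho>) *\<^sub>R z) (ptime t * (1 - \<rho>\<^sup>2)) \<partial>gauss) \<partial>unit_uniform)"
    unfolding potential_def heat_mean_def by (subst integral_rho_gauss[OF W0.integrable_integrand[OF g']]) simp
  also have "\<dots> = (\<integral>\<rho>. (\<integral>z. ?a * z $ i * g (x + (?a * \<rho>) *\<^sub>R z) (ptime t * (1 - \<rho>\<^sup>2)) \<partial>gauss) \<partial>unit_uniform)"
    by (simp only: inner)
  also have "\<dots> = potential_grad i g x t"
    unfolding potential_grad_def heat_mean_def by (subst integral_rho_gauss[OF W1.integrable_integrand[OF g]]) simp
  finally show ?thesis .
qed

section \<open>Algebra of tame functions and bounds for potentials\<close>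

lemma tameI:
  assumes "continuous_on UNIV (\<lambda>p. g (fst p) (snd p))" "\<And>T. \<exists>B. \<forall>x t. t \<le> T \<longrightarrow> \<bar>g x t\<bar> \<le> B"
  shows "tame g"
  using assms unfolding tame_def by blast

lemma tame_imp_continuous: "tame g \<Longrightarrow> continuous_on UNIV (\<lambda>p. g (fst p) (snd p))"
  by (simp add: tame_def)

lemma tame_compose:
  assumes g: "tame g" and \<phi>: "continuous_on UNIV \<phi>"
  shows "tame (\<lambda>x t. \<phi> (g x t))"
proof (rule tameI)
  show "continuous_on UNIV (\<lambda>p. \<phi> (g (fst p) (snd p)))"
    by (rule continuous_on_compose2[OF \<phi> tame_imp_continuous[OF g]]) simp
  fix T
  obtain B where B: "0 \<le> B \<and> (\<forall>x t. t \<le> T \<longrightarrow> \<bar>g x t\<bar> \<le> B)" using tame_bound[OF g, of T] ..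
  have "compact (\<phi> ` {-B..B})" by (intro compact_continuous_image continuous_on_subset[OF \<phi>]) auto
  then obtain C where C: "\<forall>y\<in>\<phi> ` {-B..B}. norm y \<le> C" using compact_imp_bounded bounded_iff by metis
  have "\<bar>\<phi> (g x t)\<bar> \<le> C" if "t \<le> T" for x t
  proof -
    have "g x t \<in> {-B..B}" using B that by (auto simp: abs_le_iff minus_le_iff)
    then show ?thesis using C by (metis imageI real_norm_def)
  qed
  then show "\<exists>B. \<forall>x t. t \<le> T \<longrightarrow> \<bar>\<phi> (g x t)\<bar> \<le> B" by blast
qed

lemma tame_add:
  assumes g: "tame g" and h: "tame h"
  shows "tame (\<lambda>x t. g x t + h x t)"
proof (rule tameI)
  show "continuous_on UNIV (\<lambda>p. g (fst p) (snd p) + h (fst p) (snd p))"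
    by (intro continuous_on_add tame_imp_continuous g h)
  fix T
  obtain B where B: "0 \<le> B \<and> (\<forall>x t. t \<le> T \<longrightarrow> \<bar>g x t\<bar> \<le> B)" using tame_bound[OF g, of T] ..
  obtain C where C: "0 \<le> C \<and> (\<forall>x t. t \<le> T \<longrightarrow> \<bar>h x t\<bar> \<le> C)" using tame_bound[OF h, of T] ..
  show "\<exists>B. \<forall>x t. t \<le> T \<longrightarrow> \<bar>g x t + h x t\<bar> \<le> B"
    using B C by (intro exI[of _ "B + C"]) (auto intro: order_trans[OF abs_triangle_ineq add_mono])
qed

lemma tame_mult:
  assumes g: "tame g" and h: "tame h"
  shows "tame (\<lambda>x t. g x t * h x t)"
proof (rule tameI)
  show "continuous_on UNIV (\<lambda>p. g (fst p) (snd p) * h (fst p) (snd p))"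
    by (intro continuous_on_mult tame_imp_continuous g h)
  fix T
  obtain B where B: "0 \<le> B \<and> (\<forall>x t. t \<le> T \<longrightarrow> \<bar>g x t\<bar> \<le> B)" using tame_bound[OF g, of T] ..
  obtain C where C: "0 \<le> C \<and> (\<forall>x t. t \<le> T \<longrightarrow> \<bar>h x t\<bar> \<le> C)" using tame_bound[OF h, of T] ..
  show "\<exists>B. \<forall>x t. t \<le> T \<longrightarrow> \<bar>g x t * h x t\<bar> \<le> B"
    using B C by (intro exI[of _ "B * C"]) (auto simp: abs_mult intro!: mult_mono)
qed

lemma tame_diff: "tame g \<Longrightarrow> tame h \<Longrightarrow> tame (\<lambda>x t. g x t - h x t)"
  using tame_add[of g "\<lambda>x t. - h x t"] tame_compose[of h uminus] by (simp add: continuous_on_minus)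

lemma (in mean_weight) heat_mean_diff:
  assumes "tame g" "tame h"
  shows "heat_mean w (\<lambda>x t. g x t - h x t) x t = heat_mean w g x t - heat_mean w h x t"
proof -
  have eq: "w (ptime t) p * (g a b - h a b) = w (ptime t) p * g a b - w (ptime t) p * h a b" for p a b
    by (rule right_diff_distrib)
  show ?thesis
    unfolding heat_mean_def eq
    by (rule Bochner_Integration.integral_diff[OF integrable_integrand[OF assms(1)] integrable_integrand[OF assms(2)]])
qed

lemmas potential_diff = W0.heat_mean_diff[folded potential_def]
lemmas potential_grad_diff = W1.heat_mean_diff[folded potential_grad_def]

definition weight_moment :: "'n::finite itself \<Rightarrow> real" where
  "weight_moment _ = (\<integral>p. moment_weight (p :: real \<times> (real^'n)) \<partial>rho_gauss)"

lemma potential_grad_bound: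
  fixes g :: "real^'n::finite \<Rightarrow> real \<Rightarrow> real"
  assumes g: "tame g" and c: "\<And>x s. s \<le> ptime t \<Longrightarrow> \<bar>g x s\<bar> \<le> c"
  shows "\<bar>potential_grad i g x t\<bar> \<le> sqrt (2 * ptime t) * c * weight_moment TYPE('n)"
proof -
  have c0: "0 \<le> c" using c[of "ptime t" 0] abs_ge_zero[of "g 0 (ptime t)"] by linarith
  have "\<bar>potential_grad i g x t\<bar> \<le> (\<integral>p. \<bar>sqrt (2 * ptime t) * (snd p $ i) * g (sample_point x t p) (sample_time t p)\<bar> \<partial>rho_gauss)"
    unfolding potential_grad_def heat_mean_def by (rule integral_abs_bound)
  also have "\<dots> \<le> (\<integral>p. (sqrt (2 * ptime t) * c) * moment_weight (p :: real \<times> (real^'n)) \<partial>rho_gauss)"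
  proof (rule integral_mono)
    show "integrable rho_gauss (\<lambda>p. \<bar>sqrt (2 * ptime t) * (snd p $ i) * g (sample_point x t p) (sample_time t p)\<bar>)"
      by (rule integrable_abs) (rule W1.integrable_integrand[OF g])
    show "integrable rho_gauss (\<lambda>p. (sqrt (2 * ptime t) * c) * moment_weight (p :: real \<times> (real^'n)))"
      by (rule integrable_mult_right[OF integrable_moment_weight])
    fix p :: "real \<times> (real^'n)"
    have "\<bar>snd p $ i\<bar> \<le> moment_weight p" using component_le_norm_cart[of "snd p" i] by (simp add: moment_weight_def)
    then have "\<bar>snd p $ i\<bar> * \<bar>g (sample_point x t p) (sample_time t p)\<bar> \<le> moment_weight p * c"
      by (intro mult_mono c ptime_mult_le moment_weight_nonneg) auto
    then have "sqrt (2 * ptime t) * (\<bar>snd p $ i\<bar> * \<bar>g (sample_point x t p) (sample_time t p)\<bar>)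
       \<le> sqrt (2 * ptime t) * (moment_weight p * c)" by (intro mult_left_mono) auto
    moreover have "\<bar>sqrt (2 * ptime t)\<bar> = sqrt (2 * ptime t)" by simp
    ultimately show "\<bar>sqrt (2 * ptime t) * (snd p $ i) * g (sample_point x t p) (sample_time t p)\<bar>
        \<le> (sqrt (2 * ptime t) * c) * moment_weight p"
      unfolding abs_mult by (simp only: mult.assoc mult.commute[of c])
  qed
  finally show ?thesis by (simp add: weight_moment_def)
qed

text \<open>Bounds are measured against exp(\<kappa> t): integrating this weight in time gains 1 /
  \<kappa>, which for large \<kappa> makes the Duhamel map a contraction on all times at
  once.\<close>

lemma potential_bound:
  fixes g :: "real^'n::finite \<Rightarrow> real \<Rightarrow> real"
  assumes g: "tame g" and \<kappa>: "\<kappa> > 0" and c: "\<And>x s. \<bar>g x s\<bar> \<le> c * exp (\<kappa> * ptime s)"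
  shows "\<bar>potential g x t\<bar> \<le> c / \<kappa> * exp (\<kappa> * ptime t)"
proof -
  interpret G: prob_space "gauss :: (real^'n) measure" by (rule prob_space_gauss)
  have c0: "0 \<le> c" using c[of 0 0] abs_ge_zero[of "g 0 0"] by simp
  define k where "k r = 2 * ptime t * \<bar>r\<bar> * (c * exp (\<kappa> * ptime (ptime t * (1 - r\<^sup>2))))" for r :: real
  have k: "continuous_on UNIV k" unfolding k_def by (intro continuous_intros)
  have ik: "integrable rho_gauss (\<lambda>p. k (fst p) * (\<lambda>z::real^'n. 1) (snd p))"
    by (intro integrable_rho_gauss_product k) simp
  have "\<bar>potential g x t\<bar> \<le> (\<integral>p. \<bar>2 * ptime t * fst p * g (sample_point x t p) (sample_time t p)\<bar> \<partial>rho_gauss)"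
    unfolding potential_def heat_mean_def by (rule integral_abs_bound)
  also have "\<dots> \<le> (\<integral>p. k (fst p) * (\<lambda>z::real^'n. 1) (snd p) \<partial>rho_gauss)"
  proof (rule integral_mono)
    show "integrable rho_gauss (\<lambda>p. \<bar>2 * ptime t * fst p * g (sample_point x t p) (sample_time t p)\<bar>)"
      by (rule integrable_abs) (rule W0.integrable_integrand[OF g])
    fix p :: "real \<times> (real^'n)"
    have "\<bar>2 * ptime t * fst p\<bar> * \<bar>g (sample_point x t p) (sample_time t p)\<bar>
      \<le> \<bar>2 * ptime t * fst p\<bar> * (c * exp (\<kappa> * ptime (sample_time t p)))"
      by (intro mult_left_mono c) auto
    moreover have "\<bar>2 * ptime t * fst p\<bar> = 2 * ptime t * \<bar>fst p\<bar>" by (simp add: abs_mult)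
    ultimately show "\<bar>2 * ptime t * fst p * g (sample_point x t p) (sample_time t p)\<bar> \<le> k (fst p) * 1"
      unfolding k_def abs_mult[of "2 * ptime t * fst p"] by simp
  qed (rule ik)
  also have "\<dots> = (\<integral>r. k r \<partial>unit_uniform)"
    by (subst integral_rho_gauss[OF ik]) (simp add: G.prob_space[unfolded space_gauss])
  also have "\<dots> = integral {0..1} k" by (rule integral_unit_uniform[OF k])
  also have "\<dots> = integral {0..1} (\<lambda>r. 2 * ptime t * r * (c * exp (\<kappa> * (ptime t * (1 - r\<^sup>2)))))"
  proof (rule integral_cong)
    fix r :: real assume r: "r \<in> {0..1}"
    then have "ptime (ptime t * (1 - r\<^sup>2)) = ptime t * (1 - r\<^sup>2)"
      by (intro ptime_simps(2) mult_nonneg_nonneg) (auto simp: power_le_one)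
    then show "k r = 2 * ptime t * r * (c * exp (\<kappa> * (ptime t * (1 - r\<^sup>2))))" using r by (simp add: k_def)
  qed
  also have "\<dots> = (- (c / \<kappa>) * exp (\<kappa> * (ptime t * (1 - 1\<^sup>2)))) - (- (c / \<kappa>) * exp (\<kappa> * (ptime t * (1 - 0\<^sup>2))))"
  proof (rule integral_unique, rule fundamental_theorem_of_calculus)
    fix r :: real
    have "((\<lambda>r. - (c / \<kappa>) * exp (\<kappa> * (ptime t * (1 - r\<^sup>2)))) has_real_derivative
        - (c / \<kappa>) * (exp (\<kappa> * (ptime t * (1 - r\<^sup>2))) * (\<kappa> * (ptime t * (- (2 * r)))))) (at r)"
      by (rule derivative_eq_intros refl | simp)+
    moreover have "- (c / \<kappa>) * (exp (\<kappa> * (ptime t * (1 - r\<^sup>2))) * (\<kappa> * (ptime t * (- (2 * r))))) =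
       2 * ptime t * r * (c * exp (\<kappa> * (ptime t * (1 - r\<^sup>2))))" using \<kappa> by simp
    ultimately show "((\<lambda>r. - (c / \<kappa>) * exp (\<kappa> * (ptime t * (1 - r\<^sup>2)))) has_vector_derivative
        2 * ptime t * r * (c * exp (\<kappa> * (ptime t * (1 - r\<^sup>2))))) (at r within {0..1})"
      by (simp only: has_real_derivative_iff_has_vector_derivative[symmetric]) (rule has_field_derivative_at_within)
  qed simp
  also have "\<dots> \<le> c / \<kappa> * exp (\<kappa> * ptime t)" using c0 \<kappa> by simp
  finally show ?thesis .
qed

text \<open>The growth bound on l admits both the constant weight and the coordinate weights that
  appear after differentiating in \<sigma>.\<close>

lemma gauss_weighted:
  fixes h :: "real^'n::finite \<Rightarrow> real \<Rightarrow> real"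
  assumes h: "tame h" and l: "continuous_on UNIV l" and L: "\<And>z. \<bar>l z\<bar> \<le> L * (1 + norm z)"
  shows "integrable gauss (\<lambda>z. l z * h (x + (k * \<sigma>) *\<^sub>R z) r)" (is ?A)
    and "continuous_on UNIV (\<lambda>p. \<integral>z. l z * h (x + (k * fst p) *\<^sub>R z) (snd p) \<partial>gauss)" (is ?B)
proof -
  interpret G: prob_space "gauss :: (real^'n) measure" by (rule prob_space_gauss)
  have L0: "0 \<le> L" using L[of 0] abs_ge_zero[of "l 0"] by simp
  have i: "integrable gauss (\<lambda>z::real^'n. C * (1 + norm z))" for C
    by (intro integrable_mult_right Bochner_Integration.integrable_add integrable_gauss_norm) simp
  have m: "(\<lambda>z. l z * h (x + (k * \<sigma>) *\<^sub>R z) r) \<in> borel_measurable gauss" for \<sigma> r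
    by (subst measurable_cong_sets[OF sets_gauss refl], rule borel_measurable_continuous_onI,
        rule continuous_on_mult[OF l], rule tameD_cont[OF h]) (intro continuous_intros)+
  have b: "\<exists>C. \<forall>z \<sigma> r. r \<le> T \<longrightarrow> \<bar>l z * h (x + (k * \<sigma>) *\<^sub>R z) r\<bar> \<le> C * (1 + norm z)" for T
  proof -
    obtain B where B: "0 \<le> B \<and> (\<forall>x t. t \<le> T \<longrightarrow> \<bar>h x t\<bar> \<le> B)" using tame_bound[OF h, of T] ..
    have "\<bar>l z * h y r\<bar> \<le> (L * B) * (1 + norm z)" if "r \<le> T" for z y r
    proof -
      have "\<bar>l z\<bar> * \<bar>h y r\<bar> \<le> (L * (1 + norm z)) * B"
        using B that L0 by (intro mult_mono L) auto
      then show ?thesis by (simp add: abs_mult mult_ac)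
    qed
    then show ?thesis by blast
  qed
  obtain C where C: "\<forall>z \<sigma> s. s \<le> r \<longrightarrow> \<bar>l z * h (x + (k * \<sigma>) *\<^sub>R z) s\<bar> \<le> C * (1 + norm z)" using b[of r] ..
  show ?A
  proof (rule Bochner_Integration.integrable_bound[OF i[of C] m])
    show "AE z in gauss. norm (l z * h (x + (k * \<sigma>) *\<^sub>R z) r) \<le> norm (C * (1 + norm z))"
    proof (rule AE_I2)
      fix z :: "real^'n"
      have "\<bar>l z * h (x + (k * \<sigma>) *\<^sub>R z) r\<bar> \<le> C * (1 + norm z)" using C by blast
      then show "norm (l z * h (x + (k * \<sigma>) *\<^sub>R z) r) \<le> norm (C * (1 + norm z))" by (simp only: real_norm_def)
    qed
  qed
  show ?B
  proof (rule continuous_on_strips)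
    fix T
    obtain C where C: "\<forall>z \<sigma> r. r \<le> T \<longrightarrow> \<bar>l z * h (x + (k * \<sigma>) *\<^sub>R z) r\<bar> \<le> C * (1 + norm z)" using b[of T] ..
    show "continuous_on (UNIV \<times> {..<T}) (\<lambda>p. \<integral>z. l z * h (x + (k * fst p) *\<^sub>R z) (snd p) \<partial>gauss)"
    proof (rule continuous_on_param_integral[where B = "\<lambda>z. C * (1 + norm z)"])
      fix z :: "real^'n"
      show "continuous_on (UNIV \<times> {..<T}) (\<lambda>p. l z * h (x + (k * fst p) *\<^sub>R z) (snd p))"
        by (rule continuous_on_mult_left, rule tameD_cont[OF h]) (intro continuous_intros)+
    next
      fix z :: "real^'n" and p :: "real \<times> real" assume "p \<in> UNIV \<times> {..<T}"
      then have "snd p \<le> T" by (simp add: mem_Times_iff)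
      then show "\<bar>l z * h (x + (k * fst p) *\<^sub>R z) (snd p)\<bar> \<le> C * (1 + norm z)" using C by blast
    qed (rule m i)+
  qed
qed

text \<open>This is \<open>duhamel_scalar_derivative\<close> at fixed x. Its correction term comes
  out as the sum of \<open>potential_grad i (gi i)\<close>, which is the Laplacian of the potential
  expressed through first derivatives of the source.\<close>

lemma potential_time_derivative:
  fixes g :: "real^'n::finite \<Rightarrow> real \<Rightarrow> real"
  assumes g: "tame g" and gi: "\<And>i. tame (gi i)" and pd: "\<And>i x t. has_pd i (\<lambda>x. g x t) x (gi i x t)"
    and t: "t > 0"
  shows "(potential g x has_real_derivative g x t + (\<Sum>i\<in>UNIV. potential_grad i (gi i) x t)) (at t)"
proof -
  interpret G: prob_space "gauss :: (real^'n) measure" by (rule prob_space_gauss)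
  define a where "a \<sigma> r = (\<integral>z. 1 * g (x + (sqrt 2 * \<sigma>) *\<^sub>R z) r \<partial>gauss)" for \<sigma> r
  define ci where "ci i \<sigma> r = (\<integral>z. (sqrt 2 * z $ i) * gi i (x + (sqrt 2 * \<sigma>) *\<^sub>R z) r \<partial>gauss)" for i \<sigma> r
  have li: "continuous_on UNIV (\<lambda>z::real^'n. sqrt 2 * z $ i)" for i by (intro continuous_intros)
  have Li: "\<bar>sqrt 2 * z $ i\<bar> \<le> sqrt 2 * (1 + norm z)" for i and z :: "real^'n"
    using component_le_norm_cart[of z i] by (simp add: abs_mult)
  note gw = gauss_weighted[OF gi li Li]
  have ca: "continuous_on UNIV (\<lambda>p. a (fst p) (snd p))"
    unfolding a_def by (rule gauss_weighted(2)[OF g, where L = 1]) auto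
  have cci: "continuous_on UNIV (\<lambda>p. ci i (fst p) (snd p))" for i
    unfolding ci_def by (rule gw(2))
  have c2: "continuous_on S (\<lambda>s. F (u s) (v s))"
    if "continuous_on UNIV (\<lambda>p. F (fst p) (snd p))" "continuous_on S u" "continuous_on S v"
    for F :: "real \<Rightarrow> real \<Rightarrow> real" and S :: "real set" and u v
    using continuous_on_compose2[OF that(1), of S "\<lambda>s. (u s, v s)"] that by (auto intro: continuous_intros)
  have "(potential g x has_real_derivative a 0 t + (\<Sum>i\<in>UNIV. potential_grad i (gi i) x t)) (at t)"
  proof (rule duhamel_scalar_derivative[where c = "\<lambda>\<sigma> r. \<Sum>i\<in>UNIV. ci i \<sigma> r", OF ca _ _ _ _ _ t])
    show "continuous_on UNIV (\<lambda>p. \<Sum>i\<in>UNIV. ci i (fst p) (snd p))"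
      by (intro continuous_on_sum cci)
  next
    fix \<sigma> r
    obtain B where B: "0 \<le> B \<and> (\<forall>x t. t \<le> r \<longrightarrow> \<bar>g x t\<bar> \<le> B)" using tame_bound[OF g, of r] ..
    have "\<forall>i. \<exists>B. 0 \<le> B \<and> (\<forall>x t. t \<le> r \<longrightarrow> \<bar>gi i x t\<bar> \<le> B)" using tame_bound[OF gi, of r] ..
    then obtain Bi where Bi: "\<And>i. 0 \<le> Bi i \<and> (\<forall>x t. t \<le> r \<longrightarrow> \<bar>gi i x t\<bar> \<le> Bi i)" by metis
    define B' where "B' = B + (\<Sum>i\<in>UNIV. Bi i)"
    have Bs: "Bi i \<le> (\<Sum>i\<in>UNIV. Bi i)" "0 \<le> (\<Sum>i\<in>UNIV. Bi i)" for i
      using Bi by (auto intro!: member_le_sum sum_nonneg)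
    have "((\<lambda>\<sigma>. \<integral>z. g (x + (sqrt 2 * \<sigma>) *\<^sub>R z) r \<partial>gauss) has_real_derivative
       (\<integral>z. (\<Sum>i\<in>UNIV. sqrt 2 * z $ i * gi i (x + (sqrt 2 * \<sigma>) *\<^sub>R z) r) \<partial>gauss)) (at \<sigma>)"
    proof (rule gauss_average_derivative[where D = "\<lambda>i y. gi i y r" and B = B'])
      show "\<bar>g y r\<bar> \<le> B'" for y using B Bs(2) by (simp add: B'_def add_increasing2)
      show "\<bar>gi i y r\<bar> \<le> B'" for i y
      proof -
        have "\<bar>gi i y r\<bar> \<le> Bi i" using Bi by blast
        then show ?thesis using B Bs(1)[of i] by (simp add: B'_def)
      qed
    qed (rule pd tame_cont[OF gi] tame_cont[OF g])+
    moreover have "(\<integral>z. (\<Sum>i\<in>UNIV. sqrt 2 * z $ i * gi i (x + (sqrt 2 * \<sigma>) *\<^sub>R z) r) \<partial>gauss) = (\<Sum>i\<in>UNIV. ci i \<sigma> r)"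
      unfolding ci_def by (rule Bochner_Integration.integral_sum) (rule gw(1))
    ultimately show "((\<lambda>\<sigma>. a \<sigma> r) has_real_derivative (\<Sum>i\<in>UNIV. ci i \<sigma> r)) (at \<sigma>)" by (simp add: a_def)
  next
    fix t :: real assume t: "t \<ge> 0"
    have sq: "sqrt (2 * t) * \<rho> = sqrt 2 * (sqrt t * \<rho>)" for \<rho> by (simp add: real_sqrt_mult)
    have "potential g x t = (\<integral>\<rho>. (\<integral>z. 2 * t * \<rho> * g (x + (sqrt (2 * t) * \<rho>) *\<^sub>R z) (t * (1 - \<rho>\<^sup>2)) \<partial>gauss) \<partial>unit_uniform)"
      unfolding potential_def heat_mean_def by (subst integral_rho_gauss[OF W0.integrable_integrand[OF g]]) (simp add: t)
    also have "\<dots> = (\<integral>\<rho>. 2 * t * \<rho> * a (sqrt t * \<rho>) (t * (1 - \<rho>\<^sup>2)) \<partial>unit_uniform)"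
      unfolding a_def sq by simp
    also have "\<dots> = integral {0..1} (\<lambda>\<rho>. 2 * t * \<rho> * a (sqrt t * \<rho>) (t * (1 - \<rho>\<^sup>2)))"
      by (rule integral_unit_uniform) (intro continuous_intros c2[OF ca])
    finally show "potential g x t = \<dots>" .
  next
    fix t :: real assume t: "t \<ge> 0"
    have sq: "sqrt (2 * t) * \<rho> = sqrt 2 * (sqrt t * \<rho>)" for \<rho> by (simp add: real_sqrt_mult)
    have sq2: "sqrt (2 * t) * z = sqrt t * (sqrt 2 * z)" for z by (simp add: real_sqrt_mult)
    have D: "potential_grad i (gi i) x t = integral {0..1} (\<lambda>\<rho>. sqrt t * ci i (sqrt t * \<rho>) (t * (1 - \<rho>\<^sup>2)))" for i
    proof -
      have "potential_grad i (gi i) x t = (\<integral>\<rho>. (\<integral>z. sqrt (2 * t) * z $ i * gi i (x + (sqrt (2 * t) * \<rho>) *\<^sub>R z) (t * (1 - \<rho>\<^sup>2)) \<partial>gauss) \<partial>unit_uniform)"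
        unfolding potential_grad_def heat_mean_def by (subst integral_rho_gauss[OF W1.integrable_integrand[OF gi]]) (simp add: t)
      also have "\<dots> = (\<integral>\<rho>. sqrt t * ci i (sqrt t * \<rho>) (t * (1 - \<rho>\<^sup>2)) \<partial>unit_uniform)"
        unfolding ci_def sq integral_mult_right_zero[symmetric] sq2 by (simp only: mult_ac)
      also have "\<dots> = integral {0..1} (\<lambda>\<rho>. sqrt t * ci i (sqrt t * \<rho>) (t * (1 - \<rho>\<^sup>2)))"
        by (rule integral_unit_uniform) (intro continuous_intros c2[OF cci])
      finally show ?thesis .
    qed
    show "(\<Sum>i\<in>UNIV. potential_grad i (gi i) x t) = integral {0..1} (\<lambda>\<rho>. sqrt t * (\<Sum>i\<in>UNIV. ci i (sqrt t * \<rho>) (t * (1 - \<rho>\<^sup>2))))"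
      unfolding D sum_distrib_left
      by (rule Henstock_Kurzweil_Integration.integral_sum[symmetric])
         (auto intro!: integrable_continuous_interval continuous_intros c2[OF cci])
  next
    show "continuous_on {0..} (\<lambda>t. \<Sum>i\<in>UNIV. potential_grad i (gi i) x t)"
      by (intro continuous_on_sum tameD_cont[OF tame_potential_grad[OF gi]] continuous_intros)
  qed
  moreover have "a 0 t = g x t" by (simp add: a_def G.prob_space[unfolded space_gauss])
  ultimately show ?thesis by simp
qed

text \<open>The heat semigroup applied to \<phi>: the heat kernel at time t is the law of sqrt (2 t)
  z with z standard Gaussian. For t <= 0 the value is \<phi> itself.\<close>

definition heat :: "(real^'n::finite \<Rightarrow> real) \<Rightarrow> real^'n \<Rightarrow> real \<Rightarrow> real" where
  "heat \<phi> x t = (\<integral>z. \<phi> (x + sqrt (2 * ptime t) *\<^sub>R z) \<partial>gauss)"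

lemma tame_of_bounded:
  assumes "continuous_on UNIV \<phi>" "\<And>x. \<bar>\<phi> x\<bar> \<le> B"
  shows "tame (\<lambda>x t. \<phi> x)"
proof (rule tameI)
  show "continuous_on UNIV (\<lambda>p::(real^'a) \<times> real. \<phi> (fst p))"
    by (rule continuous_on_compose2[OF assms(1)]) (auto intro: continuous_intros)
qed (use assms(2) in blast)

lemma tame_heat:
  fixes \<phi> :: "real^'n::finite \<Rightarrow> real"
  assumes c: "continuous_on UNIV \<phi>" and B: "\<And>x. \<bar>\<phi> x\<bar> \<le> B"
  shows "tame (heat \<phi>)" "\<bar>heat \<phi> x t\<bar> \<le> B"
proof -
  interpret G: prob_space "gauss :: (real^'n) measure" by (rule prob_space_gauss)
  have m: "(\<lambda>z. \<phi> (x + k *\<^sub>R z)) \<in> borel_measurable gauss" for x k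
    by (subst measurable_cong_sets[OF sets_gauss refl], rule borel_measurable_continuous_onI,
        rule continuous_on_compose2[OF c]) (auto intro!: continuous_intros)
  have i: "integrable gauss (\<lambda>z. \<phi> (x + k *\<^sub>R z))" for x k
    by (rule G.integrable_const_bound[of _ B]) (use B m in auto)
  show b: "\<bar>heat \<phi> x t\<bar> \<le> B" for x t
  proof -
    have "\<bar>heat \<phi> x t\<bar> \<le> (\<integral>z. \<bar>\<phi> (x + sqrt (2 * ptime t) *\<^sub>R z)\<bar> \<partial>gauss)"
      unfolding heat_def by (rule integral_abs_bound)
    also have "\<dots> \<le> (\<integral>z. B \<partial>(gauss :: (real^'n) measure))"
      by (intro integral_mono integrable_abs i B) simp
    finally show ?thesis by (simp add: G.prob_space[unfolded space_gauss])
  qed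
  show "tame (heat \<phi>)"
  proof (rule tameI)
    show "continuous_on UNIV (\<lambda>p. heat \<phi> (fst p) (snd p))"
      unfolding heat_def
    proof (rule continuous_on_param_integral[where B = "\<lambda>_. B"])
      show "continuous_on UNIV (\<lambda>p. \<phi> (fst p + sqrt (2 * ptime (snd p)) *\<^sub>R z))" for z
        by (rule continuous_on_compose2[OF c]) (auto intro!: continuous_intros)
    qed (use m B in auto)
  qed (use b in blast)
qed

lemma has_pd_heat:
  fixes \<phi> \<phi>' :: "real^'n::finite \<Rightarrow> real"
  assumes c: "continuous_on UNIV \<phi>" and B: "\<And>x. \<bar>\<phi> x\<bar> \<le> B"
    and c': "continuous_on UNIV \<phi>'" and B': "\<And>x. \<bar>\<phi>' x\<bar> \<le> B'"
    and pd: "\<And>x. has_pd i \<phi> x (\<phi>' x)"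
  shows "has_pd i (\<lambda>x. heat \<phi> x t) x (heat \<phi>' x t)"
proof -
  interpret G: prob_space "gauss :: (real^'n) measure" by (rule prob_space_gauss)
  have m: "(\<lambda>z. \<psi> (x + k *\<^sub>R z)) \<in> borel_measurable gauss" if "continuous_on UNIV \<psi>"
    for x k and \<psi> :: "real^'n \<Rightarrow> real"
    by (subst measurable_cong_sets[OF sets_gauss refl], rule borel_measurable_continuous_onI,
        rule continuous_on_compose2[OF that]) (auto intro!: continuous_intros)
  have "((\<lambda>h. \<integral>z. \<phi> ((x + h *\<^sub>R axis i 1) + sqrt (2 * ptime t) *\<^sub>R z) \<partial>gauss) has_real_derivative
     (\<integral>z. \<phi>' ((x + 0 *\<^sub>R axis i 1) + sqrt (2 * ptime t) *\<^sub>R z) \<partial>gauss)) (at 0)"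
  proof (rule has_real_derivative_param_integral[where B = "\<lambda>_. B'"])
    fix h and z :: "real^'n"
    have eq: "(x + h *\<^sub>R axis i 1) + sqrt (2 * ptime t) *\<^sub>R z = (x + sqrt (2 * ptime t) *\<^sub>R z) + h *\<^sub>R axis i 1" for h
      by (simp only: add_ac)
    show "((\<lambda>h. \<phi> ((x + h *\<^sub>R axis i 1) + sqrt (2 * ptime t) *\<^sub>R z)) has_real_derivative
        \<phi>' ((x + h *\<^sub>R axis i 1) + sqrt (2 * ptime t) *\<^sub>R z)) (at h)"
      unfolding eq by (rule iffD1[OF has_pd_along_line]) (rule pd)
    show "integrable gauss (\<lambda>z. \<phi> ((x + h *\<^sub>R axis i 1) + sqrt (2 * ptime t) *\<^sub>R z))" for h
      by (rule G.integrable_const_bound[of _ B]) (use B m[OF c] in auto)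
  qed (use m[OF c] m[OF c'] B' in auto)
  then show ?thesis by (simp add: has_pd_def heat_def)
qed

text \<open>In \<sigma> = sqrt t the derivative is a Gaussian mean of coordinates times first
  derivatives of \<phi>. Integration by parts makes it 2 \<sigma> times the mean of the Laplacian,
  and d\<sigma>/dt = 1 / (2 \<sigma>) cancels the factor.\<close>

lemma heat_time_derivative:
  fixes \<phi> :: "real^'n::finite \<Rightarrow> real"
  assumes c: "continuous_on UNIV \<phi>" "\<And>i. continuous_on UNIV (\<phi>1 i)" "\<And>i. continuous_on UNIV (\<phi>2 i)"
    and B: "\<And>x. \<bar>\<phi> x\<bar> \<le> B" "\<And>i x. \<bar>\<phi>1 i x\<bar> \<le> B" "\<And>i x. \<bar>\<phi>2 i x\<bar> \<le> B"
    and pd: "\<And>i x. has_pd i \<phi> x (\<phi>1 i x)" "\<And>i x. has_pd i (\<phi>1 i) x (\<phi>2 i x)"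
    and t: "t > 0"
  shows "(heat \<phi> x has_real_derivative (\<Sum>i\<in>UNIV. heat (\<phi>2 i) x t)) (at t)"
proof -
  let ?A = "\<lambda>\<sigma>. \<integral>z. \<phi> (x + (sqrt 2 * \<sigma>) *\<^sub>R z) \<partial>gauss"
  let ?k = "sqrt 2 * sqrt t"
  have k: "?k > 0" "?k * ?k = 2 * t" using t by (simp_all add: algebra_simps)
  have B0: "B \<ge> 0" using B(1)[of 0] by linarith
  have ibp: "(\<integral>z. (sqrt 2 * z $ i) * \<phi>1 i (x + ?k *\<^sub>R z) \<partial>gauss) = sqrt 2 * ?k * heat (\<phi>2 i) x t" for i
  proof -
    have "(\<integral>z. z $ i * \<phi>1 i (x + ?k *\<^sub>R z) \<partial>gauss) = (\<integral>z. ?k * \<phi>2 i (x + ?k *\<^sub>R z) \<partial>gauss)"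
    proof (rule gauss_integration_by_parts[where B = "max B (?k * B)"])
      fix z
      have "((\<lambda>h. \<phi>1 i ((x + ?k *\<^sub>R z) + (?k * h) *\<^sub>R axis i 1)) has_real_derivative
         \<phi>2 i (x + ?k *\<^sub>R z) * ?k) (at 0)"
        by (rule DERIV_chain'[where g = "\<lambda>h. \<phi>1 i ((x + ?k *\<^sub>R z) + h *\<^sub>R axis i 1)" and f = "\<lambda>h. ?k * h"])
           (use pd(2)[of i "x + ?k *\<^sub>R z"] in \<open>auto intro!: derivative_eq_intros simp: has_pd_def\<close>)
      then show "has_pd i (\<lambda>z. \<phi>1 i (x + ?k *\<^sub>R z)) z (?k * \<phi>2 i (x + ?k *\<^sub>R z))"
        unfolding has_pd_def by (simp add: scaleR_add_right add.assoc mult.commute)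
      show "\<bar>\<phi>1 i (x + ?k *\<^sub>R z)\<bar> \<le> max B (?k * B)" by (rule max.coboundedI1) (rule B)
      have "\<bar>?k * \<phi>2 i (x + ?k *\<^sub>R z)\<bar> = ?k * \<bar>\<phi>2 i (x + ?k *\<^sub>R z)\<bar>"
        by (simp only: abs_mult[of ?k] abs_of_pos[OF k(1)])
      also have "\<dots> \<le> ?k * B" using k(1) B(3) by (intro mult_left_mono) auto
      finally show "\<bar>?k * \<phi>2 i (x + ?k *\<^sub>R z)\<bar> \<le> max B (?k * B)" by simp
    next
      show "continuous_on UNIV (\<lambda>z. \<phi>1 i (x + ?k *\<^sub>R z))"
        by (rule continuous_on_compose2[OF c(2)]) (auto intro!: continuous_intros)
      show "continuous_on UNIV (\<lambda>z. ?k * \<phi>2 i (x + ?k *\<^sub>R z))"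
        by (rule continuous_on_mult_left, rule continuous_on_compose2[OF c(3)]) (auto intro!: continuous_intros)
    qed
    then have "sqrt 2 * (\<integral>z. z $ i * \<phi>1 i (x + ?k *\<^sub>R z) \<partial>gauss) = sqrt 2 * (\<integral>z. ?k * \<phi>2 i (x + ?k *\<^sub>R z) \<partial>gauss)"
      by (rule arg_cong)
    moreover have "sqrt (2 * ptime t) = ?k" using t by (simp add: real_sqrt_mult)
    ultimately show ?thesis unfolding heat_def by (simp add: mult.assoc)
  qed
  have h: "heat \<phi> x s = ?A (sqrt s)" if "s > 0" for s
    using that by (simp add: heat_def real_sqrt_mult)
  have "(?A has_real_derivative (\<integral>z. (\<Sum>i\<in>UNIV. sqrt 2 * z $ i * \<phi>1 i (x + (sqrt 2 * sqrt t) *\<^sub>R z)) \<partial>gauss)) (at (sqrt t))"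
    by (rule gauss_average_derivative[where B = B]) (rule pd c B)+
  moreover have "(\<integral>z. (\<Sum>i\<in>UNIV. sqrt 2 * z $ i * \<phi>1 i (x + (sqrt 2 * sqrt t) *\<^sub>R z)) \<partial>gauss) =
      (\<Sum>i\<in>UNIV. \<integral>z. (sqrt 2 * z $ i) * \<phi>1 i (x + (sqrt 2 * sqrt t) *\<^sub>R z) \<partial>gauss)"
  proof (rule Bochner_Integration.integral_sum)
    fix i
    show "integrable gauss (\<lambda>z. (sqrt 2 * z $ i) * \<phi>1 i (x + (sqrt 2 * sqrt t) *\<^sub>R z))"
    proof (rule gauss_weighted(1)[where h = "\<lambda>x t. \<phi>1 i x" and L = "sqrt 2" and r = 0])
      show "tame (\<lambda>x t. \<phi>1 i x)" by (rule tame_of_bounded) (rule c B)+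
      show "continuous_on UNIV (\<lambda>z::real^'n. sqrt 2 * z $ i)" by (intro continuous_intros)
      show "\<bar>sqrt 2 * z $ i\<bar> \<le> sqrt 2 * (1 + norm z)" for z :: "real^'n"
        using component_le_norm_cart[of z i] by (simp add: abs_mult)
    qed
  qed
  ultimately have "(?A has_real_derivative (\<Sum>i\<in>UNIV. sqrt 2 * ?k * heat (\<phi>2 i) x t)) (at (sqrt t))"
    by (simp only: ibp)
  then have "((\<lambda>s. ?A (sqrt s)) has_real_derivative (\<Sum>i\<in>UNIV. sqrt 2 * ?k * heat (\<phi>2 i) x t) * (inverse (sqrt t) / 2)) (at t)"
    by (rule DERIV_chain2) (rule DERIV_real_sqrt[OF t])
  moreover have "(\<Sum>i\<in>UNIV. sqrt 2 * ?k * heat (\<phi>2 i) x t) * (inverse (sqrt t) / 2) = (\<Sum>i\<in>UNIV. heat (\<phi>2 i) x t)"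
  proof -
    have "sqrt 2 * ?k * (inverse (sqrt t) / 2) = 1" using t by (simp add: field_simps)
    then have "sqrt 2 * ?k * H * (inverse (sqrt t) / 2) = H" for H by (metis mult.commute mult.assoc mult.left_neutral)
    then show ?thesis by (simp only: sum_distrib_right)
  qed
  ultimately have "((\<lambda>s. ?A (sqrt s)) has_real_derivative (\<Sum>i\<in>UNIV. heat (\<phi>2 i) x t)) (at t)" by simp
  then show ?thesis
    by (rule has_field_derivative_transform_within_open[where S = "{0<..}"]) (use t h in auto)
qed

section \<open>Semilinear heat equations with a Lipschitz nonlinearity\<close>

text \<open>The explicit rate carries the uniformity: applied pointwise with a factor A that is
  locally bounded in the point, it gives locally uniform convergence of both Picard iterations
  below.\<close>

lemma geometric_increments_converge:
  fixes s :: "nat \<Rightarrow> real"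
  assumes A: "\<And>n. \<bar>s (Suc n) - s n\<bar> \<le> A * (1/2)^n"
  shows "convergent s" and "\<bar>lim s - s n\<bar> \<le> 2 * A * (1/2)^n"
proof -
  have le: "\<bar>s (n + k) - s n\<bar> \<le> 2 * A * (1/2)^n - 2 * A * (1/2)^(n + k)" for n k
  proof (induction k)
    case (Suc k)
    have "\<bar>s (n + Suc k) - s n\<bar> \<le> \<bar>s (Suc (n + k)) - s (n + k)\<bar> + \<bar>s (n + k) - s n\<bar>" by simp
    also have "\<dots> \<le> A * (1/2)^(n + k) + (2 * A * (1/2)^n - 2 * A * (1/2)^(n + k))"
      by (intro add_mono A Suc)
    finally show ?case by simp
  qed simp
  have A0: "A \<ge> 0" using A[of 0] by simp
  have le2: "\<bar>s m - s n\<bar> \<le> 2 * A * (1/2)^n" if "m \<ge> n" for m n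
  proof -
    have "0 \<le> 2 * A * (1/2)^m" using A0 by simp
    then show ?thesis using le[of n "m - n"] that by simp
  qed
  have z: "(\<lambda>n. 2 * A * (1/2)^n) \<longlonglongrightarrow> 0"
    by (intro tendsto_mult_right_zero LIMSEQ_power_zero) simp
  have "Cauchy s"
    unfolding Cauchy_altdef2
  proof (intro allI impI)
    fix e :: real assume "e > 0"
    then obtain N where "2 * A * (1/2)^N < e"
      using order_tendstoD(2)[OF z] by (meson eventually_sequentially order.refl)
    then have "\<forall>n\<ge>N. dist (s n) (s N) < e" using le2[of N] by (auto simp: dist_real_def intro: le_less_trans)
    then show "\<exists>N. \<forall>n\<ge>N. dist (s n) (s N) < e" ..
  qed
  then show c: "convergent s" by (simp add: real_Cauchy_convergent)
  then have "s \<longlonglongrightarrow> lim s" by (simp add: convergent_LIMSEQ_iff)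
  then have "(\<lambda>m. \<bar>s m - s n\<bar>) \<longlonglongrightarrow> \<bar>lim s - s n\<bar>" by (intro tendsto_intros)
  then show "\<bar>lim s - s n\<bar> \<le> 2 * A * (1/2)^n"
    by (rule LIMSEQ_le_const2) (use le2 in auto)
qed

text \<open>With bounded derivatives of the data up to order two, the derivatives of the semigroup
  term fall on the data, so everything stays continuous up to t = 0.\<close>

locale semilinear_heat =
  fixes ft ft' :: "real \<Rightarrow> real" and K B :: real
    and u0 :: "real^'n::finite \<Rightarrow> real" and u1 :: "'n \<Rightarrow> real^'n \<Rightarrow> real"
    and u2 :: "'n \<Rightarrow> 'n \<Rightarrow> real^'n \<Rightarrow> real"
  assumes ftd: "\<And>v. (ft has_real_derivative ft' v) (at v)"
    and cft': "continuous_on UNIV ft'" and ftK: "\<And>v. \<bar>ft' v\<bar> \<le> K" and K: "K > 0" and ft0: "ft 0 = 0"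
    and c0: "continuous_on UNIV u0" and c1: "\<And>i. continuous_on UNIV (u1 i)" and c2: "\<And>i j. continuous_on UNIV (u2 i j)"
    and b0: "\<And>x. \<bar>u0 x\<bar> \<le> B" and b1: "\<And>i x. \<bar>u1 i x\<bar> \<le> B" and b2: "\<And>i j x. \<bar>u2 i j x\<bar> \<le> B"
    and d1: "\<And>i x. has_pd i u0 x (u1 i x)" and d2: "\<And>i j x. has_pd j (u1 i) x (u2 i j x)"
begin

lemma ft_Lipschitz: "\<bar>ft a - ft b\<bar> \<le> K * \<bar>a - b\<bar>"
  using field_differentiable_bound[of UNIV ft ft' K a b] ftd ftK by simp

lemma cft: "continuous_on UNIV ft"
  by (rule DERIV_continuous_on, rule has_field_derivative_at_within, rule ftd)

lemma tame_ft: "tame g \<Longrightarrow> tame (\<lambda>y s. ft (g y s))"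
  by (rule tame_compose[OF _ cft])

lemmas tame_S0 = tame_heat(1)[OF c0 b0]
lemmas tame_S1 = tame_heat(1)[OF c1 b1]
lemmas tame_S2 = tame_heat(1)[OF c2 b2]

section \<open>Picard iteration of the Duhamel formula\<close>

primrec U :: "nat \<Rightarrow> real^'n \<Rightarrow> real \<Rightarrow> real" where
  "U 0 = heat u0"
| "U (Suc n) = (\<lambda>x t. heat u0 x t + potential (\<lambda>y s. ft (U n y s)) x t)"

text \<open>The gradient of an iterate involves only the values of the previous one, the derivative
  having moved onto the weight. Gradients therefore converge as soon as the iterates do.\<close>

definition DU :: "nat \<Rightarrow> 'n \<Rightarrow> real^'n \<Rightarrow> real \<Rightarrow> real" where
  "DU n i = (case n of 0 \<Rightarrow> heat (u1 i) | Suc m \<Rightarrow> (\<lambda>x t. heat (u1 i) x t + potential_grad i (\<lambda>y s. ft (U m y s)) x t))"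

lemma tame_U: "tame (U n)"
  by (induction n) (auto intro!: tame_S0 tame_add tame_potential tame_ft)

lemma tame_DU: "tame (DU n i)"
  by (cases n) (auto simp: DU_def intro!: tame_S1 tame_add tame_potential_grad tame_ft tame_U)

lemma has_pd_Duhamel_ft:
  assumes g: "tame g" "tame g'" and pd: "\<And>x t. has_pd i (\<lambda>x. g x t) x (g' x t)"
  shows "has_pd i (\<lambda>x. potential (\<lambda>y s. ft (g y s)) x t) x (potential_grad i (\<lambda>y s. ft (g y s)) x t)"
    and "has_pd i (\<lambda>x. potential_grad j (\<lambda>y s. ft (g y s)) x t) x (potential_grad j (\<lambda>y s. ft' (g y s) * g' y s) x t)"
proof -
  have s: "tame (\<lambda>y s. ft' (g y s) * g' y s)" by (intro tame_mult tame_compose[OF _ cft'] g)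
  have p: "has_pd i (\<lambda>x. ft (g x t)) x (ft' (g x t) * g' x t)" for x t
    by (rule has_pd_compose[OF ftd pd])
  show "has_pd i (\<lambda>x. potential (\<lambda>y s. ft (g y s)) x t) x (potential_grad i (\<lambda>y s. ft (g y s)) x t)"
    using has_pd_potential[OF tame_ft[OF g(1)] s p] unfolding potential_eq_potential_grad[OF tame_ft[OF g(1)] s p] .
  show "has_pd i (\<lambda>x. potential_grad j (\<lambda>y s. ft (g y s)) x t) x (potential_grad j (\<lambda>y s. ft' (g y s) * g' y s) x t)"
    by (rule has_pd_potential_grad[OF tame_ft[OF g(1)] s p])
qed

lemma has_pd_U: "has_pd i (\<lambda>x. U n x t) x (DU n i x t)"
proof (induction n arbitrary: x t)
  case 0
  show ?case using has_pd_heat[OF c0 b0 c1 b1 d1] by (simp add: DU_def)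
next
  case (Suc n)
  show ?case
    using has_pd_add[OF has_pd_heat[OF c0 b0 c1 b1 d1] has_pd_Duhamel_ft(1)[OF tame_U tame_DU Suc]]
    by (simp add: DU_def)
qed

text \<open>Lipschitz constant K against the weight exp(2 K t) gives K / (2 K) = 1/2 in
  \<open>potential_bound\<close>, the contraction factor of the iteration.\<close>

lemma ft_diff_bound:
  fixes g h :: "real^'n \<Rightarrow> real \<Rightarrow> real"
  assumes g: "tame g" and h: "tame h" and c: "\<And>x s. \<bar>g x s - h x s\<bar> \<le> c * exp (2 * K * ptime s)"
  shows "\<bar>potential (\<lambda>y s. ft (g y s)) x t - potential (\<lambda>y s. ft (h y s)) x t\<bar> \<le> c / 2 * exp (2 * K * ptime t)"
    and "\<bar>potential_grad i (\<lambda>y s. ft (g y s)) x t - potential_grad i (\<lambda>y s. ft (h y s)) x t\<bar>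
       \<le> sqrt (2 * ptime t) * (K * c * exp (2 * K * ptime t)) * weight_moment TYPE('n)"
proof -
  have c0: "0 \<le> c" using order_trans[OF abs_ge_zero c[of 0 0]] by simp
  have b: "\<bar>ft (g x s) - ft (h x s)\<bar> \<le> (K * c) * exp (2 * K * ptime s)" for x s
  proof -
    have "\<bar>ft (g x s) - ft (h x s)\<bar> \<le> K * \<bar>g x s - h x s\<bar>" by (rule ft_Lipschitz)
    also have "\<dots> \<le> K * (c * exp (2 * K * ptime s))" using K c by (intro mult_left_mono) auto
    finally show ?thesis by simp
  qed
  note d = tame_diff[OF tame_ft[OF g] tame_ft[OF h]]
  have "\<bar>potential (\<lambda>y s. ft (g y s) - ft (h y s)) x t\<bar> \<le> K * c / (2 * K) * exp (2 * K * ptime t)"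
    by (rule potential_bound[OF d _ b]) (use K in simp)
  then show "\<bar>potential (\<lambda>y s. ft (g y s)) x t - potential (\<lambda>y s. ft (h y s)) x t\<bar> \<le> c / 2 * exp (2 * K * ptime t)"
    using K by (simp add: potential_diff[OF tame_ft[OF g] tame_ft[OF h]])
  have b2: "\<bar>ft (g x s) - ft (h x s)\<bar> \<le> K * c * exp (2 * K * ptime t)" if "s \<le> ptime t" for x s
  proof -
    have "ptime s \<le> ptime t" using that by (simp add: ptime_def)
    then have "(K * c) * exp (2 * K * ptime s) \<le> (K * c) * exp (2 * K * ptime t)"
      using K c0 by (intro mult_left_mono) auto
    then show ?thesis using b[of x s] by linarith
  qed
  have "\<bar>potential_grad i (\<lambda>y s. ft (g y s) - ft (h y s)) x t\<bar> \<le> sqrt (2 * ptime t) * (K * c * exp (2 * K * ptime t)) * weight_moment TYPE('n)"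
    by (rule potential_grad_bound[OF d]) (rule b2)
  then show "\<bar>potential_grad i (\<lambda>y s. ft (g y s)) x t - potential_grad i (\<lambda>y s. ft (h y s)) x t\<bar>
       \<le> sqrt (2 * ptime t) * (K * c * exp (2 * K * ptime t)) * weight_moment TYPE('n)"
    by (simp add: potential_grad_diff[OF tame_ft[OF g] tame_ft[OF h]])
qed

lemma U_increment: "\<bar>U (Suc n) x t - U n x t\<bar> \<le> (B / 2 * exp (2 * K * ptime t)) * (1/2)^n"
proof (induction n arbitrary: x t)
  case 0
  \<comment> \<open>The first increment is the Duhamel term of \<open>heat u0\<close>, estimated by
    comparison with the zero function, whose term vanishes because \<open>ft 0 = 0\<close>.\<close>
  have z: "tame (\<lambda>(x::real^'n) t. 0)" by (rule tame_of_bounded[of "\<lambda>_. 0" 0]) auto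
  have "\<bar>heat u0 x s - 0\<bar> \<le> B * exp (2 * K * ptime s)" for x s
  proof -
    have B: "0 \<le> B" using order_trans[OF abs_ge_zero b0] .
    have "1 \<le> exp (2 * K * ptime s)" using K by simp
    then have "B * 1 \<le> B * exp (2 * K * ptime s)" using B by (rule mult_left_mono)
    then show ?thesis using tame_heat(2)[OF c0 b0, of x s] by simp
  qed
  from ft_diff_bound(1)[OF tame_S0 z this, of x t]
  have "\<bar>potential (\<lambda>y s. ft (heat u0 y s)) x t - potential (\<lambda>y s. 0) x t\<bar> \<le> B / 2 * exp (2 * K * ptime t)"
    by (simp add: ft0)
  moreover have "potential (\<lambda>(y::real^'n) s. 0) x t = 0" by (simp add: potential_def heat_mean_def)
  ultimately show ?case by simp
next
  case (Suc n)
  have "\<bar>U (Suc n) x s - U n x s\<bar> \<le> (B / 2 * (1/2)^n) * exp (2 * K * ptime s)" for x s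
    using Suc[of x s] by (simp add: mult_ac)
  from ft_diff_bound(1)[OF tame_U tame_U this, of x t]
  show ?case by (simp add: mult_ac)
qed

section \<open>The limit and its derivatives\<close>

definition u :: "real^'n \<Rightarrow> real \<Rightarrow> real" where "u x t = lim (\<lambda>n. U n x t)"

lemma u_approx: "\<bar>u x t - U n x t\<bar> \<le> (B * (1/2)^n) * exp (2 * K * ptime t)"
  using geometric_increments_converge(2)[of "\<lambda>n. U n x t", OF U_increment, of n] by (simp add: u_def mult_ac)

lemma U_tendsto: "(\<lambda>n. U n x t) \<longlonglongrightarrow> u x t"
  using geometric_increments_converge(1)[of "\<lambda>n. U n x t", OF U_increment] by (simp add: u_def convergent_LIMSEQ_iff)

lemma half_power_tendsto: "(\<lambda>n. c * (1/2)^n) \<longlonglongrightarrow> (0::real)"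
  by (intro tendsto_mult_right_zero LIMSEQ_power_zero) simp

lemma B_nonneg: "0 \<le> B" using order_trans[OF abs_ge_zero b0] .

lemma tame_u: "tame u"
proof (rule tameI)
  show "continuous_on UNIV (\<lambda>p. u (fst p) (snd p))"
  proof (rule continuous_on_strips)
    fix T
    have "uniform_limit (UNIV \<times> {..<T}) (\<lambda>n p. U n (fst p) (snd p)) (\<lambda>p. u (fst p) (snd p)) sequentially"
    proof (rule uniform_limitI)
      fix e :: real assume "e > 0"
      have "\<forall>\<^sub>F n in sequentially. (B * exp (2 * K * ptime T)) * (1/2)^n < e"
        by (rule order_tendstoD(2)[OF half_power_tendsto \<open>e > 0\<close>])
      then show "\<forall>\<^sub>F n in sequentially. \<forall>p\<in>UNIV \<times> {..<T}. dist (U n (fst p) (snd p)) (u (fst p) (snd p)) < e"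
      proof eventually_elim
        case (elim n)
        show ?case
        proof
          fix p :: "(real^'n) \<times> real" assume "p \<in> UNIV \<times> {..<T}"
          then have "ptime (snd p) \<le> ptime T" by (auto simp: ptime_def)
          then have "exp (2 * K * ptime (snd p)) \<le> exp (2 * K * ptime T)" using K by simp
          then have "(B * (1/2)^n) * exp (2 * K * ptime (snd p)) \<le> (B * (1/2)^n) * exp (2 * K * ptime T)"
            using B_nonneg by (intro mult_left_mono) auto
          then have "\<bar>u (fst p) (snd p) - U n (fst p) (snd p)\<bar> \<le> (B * exp (2 * K * ptime T)) * (1/2)^n"
            using u_approx[of "fst p" "snd p" n] by (simp add: mult_ac)
          with elim show "dist (U n (fst p) (snd p)) (u (fst p) (snd p)) < e"
            by (simp add: dist_real_def abs_minus_commute)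
        qed
      qed
    qed
    then show "continuous_on (UNIV \<times> {..<T}) (\<lambda>p. u (fst p) (snd p))"
      by (rule uniform_limit_theorem[rotated])
         (auto intro!: always_eventually continuous_on_subset[OF tame_imp_continuous[OF tame_U]])
  qed
  fix T
  obtain C where C: "0 \<le> C \<and> (\<forall>x t. t \<le> T \<longrightarrow> \<bar>U 0 x t\<bar> \<le> C)" using tame_bound[OF tame_U, of T] ..
  have "\<bar>u x t\<bar> \<le> C + B * exp (2 * K * ptime T)" if "t \<le> T" for x t
  proof -
    have "ptime t \<le> ptime T" using that by (auto simp: ptime_def)
    then have "B * exp (2 * K * ptime t) \<le> B * exp (2 * K * ptime T)" using K B_nonneg by (intro mult_left_mono) auto
    moreover have "\<bar>U 0 x t\<bar> \<le> C" using C that by blast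
    ultimately show ?thesis using u_approx[of x t 0] by (simp del: U.simps)
  qed
  then show "\<exists>B. \<forall>x t. t \<le> T \<longrightarrow> \<bar>u x t\<bar> \<le> B" by blast
qed

lemma u_fixed_point: "u x t = heat u0 x t + potential (\<lambda>y s. ft (u y s)) x t"
proof -
  have "(\<lambda>n. potential (\<lambda>y s. ft (U n y s)) x t) \<longlonglongrightarrow> potential (\<lambda>y s. ft (u y s)) x t"
  proof (rule Lim_transform_bound[of "\<lambda>n. potential (\<lambda>y s. ft (U n y s)) x t - potential (\<lambda>y s. ft (u y s)) x t"
        "\<lambda>n. (B / 2 * exp (2 * K * ptime t)) * (1/2)^n", THEN LIM_zero_cancel])
    show "\<forall>\<^sub>F n in sequentially. norm (potential (\<lambda>y s. ft (U n y s)) x t - potential (\<lambda>y s. ft (u y s)) x t)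
        \<le> norm ((B / 2 * exp (2 * K * ptime t)) * (1/2)^n)"
    proof (rule always_eventually, rule allI)
      fix n
      have "\<bar>U n y s - u y s\<bar> \<le> (B * (1/2)^n) * exp (2 * K * ptime s)" for y s
        using u_approx[of y s n] by (simp add: abs_minus_commute)
      from ft_diff_bound(1)[OF tame_U tame_u this, of x t]
      have "\<bar>potential (\<lambda>y s. ft (U n y s)) x t - potential (\<lambda>y s. ft (u y s)) x t\<bar> \<le> (B / 2 * exp (2 * K * ptime t)) * (1/2)^n"
        by (simp add: mult_ac)
      then show "norm (potential (\<lambda>y s. ft (U n y s)) x t - potential (\<lambda>y s. ft (u y s)) x t)
        \<le> norm ((B / 2 * exp (2 * K * ptime t)) * (1/2)^n)" unfolding real_norm_def by linarith
    qed
  qed (rule half_power_tendsto)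
  then have "(\<lambda>n. U (Suc n) x t) \<longlonglongrightarrow> heat u0 x t + potential (\<lambda>y s. ft (u y s)) x t"
    by (simp add: tendsto_add)
  moreover have "(\<lambda>n. U (Suc n) x t) \<longlonglongrightarrow> u x t" by (rule LIMSEQ_Suc[OF U_tendsto])
  ultimately show ?thesis using LIMSEQ_unique by blast
qed

definition gu :: "'n \<Rightarrow> real^'n \<Rightarrow> real \<Rightarrow> real" where
  "gu i x t = heat (u1 i) x t + potential_grad i (\<lambda>y s. ft (u y s)) x t"

lemma tame_gu: "tame (gu i)"
  unfolding gu_def by (intro tame_add tame_S1 tame_potential_grad tame_ft tame_u)

text \<open>At fixed t the gradients \<open>DU (Suc n) i\<close> tend to \<open>gu i\<close>
  uniformly in space, so differentiation along a line passes to the limit. The shift to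
  \<open>Suc n\<close> skips the iterate without a potential term.\<close>

lemma has_pd_u: "has_pd i (\<lambda>x. u x t) x (gu i x t)"
proof -
  let ?y = "\<lambda>s. x + s *\<^sub>R axis i 1"
  define C where "C = sqrt (2 * ptime t) * (K * B * exp (2 * K * ptime t)) * weight_moment TYPE('n)"
  have conv: "\<bar>DU (Suc n) i y t - gu i y t\<bar> \<le> C * (1/2)^n" for n y
  proof -
    have "\<bar>U n y s - u y s\<bar> \<le> (B * (1/2)^n) * exp (2 * K * ptime s)" for y s
      using u_approx[of y s n] by (simp add: abs_minus_commute)
    from ft_diff_bound(2)[OF tame_U tame_u this, of i y t]
    show ?thesis by (simp add: DU_def gu_def C_def mult_ac)
  qed
  have "\<exists>g. \<forall>s\<in>UNIV. (\<lambda>n. U (Suc n) (?y s) t) \<longlonglongrightarrow> g s \<and> (g has_derivative (\<lambda>h. gu i (?y s) t * h)) (at s within UNIV)"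
  proof (rule has_derivative_sequence[where f' = "\<lambda>n s h. DU (Suc n) i (?y s) t * h" and ?x0.0 = 0])
    fix n s
    have "((\<lambda>s. U (Suc n) (?y s) t) has_real_derivative DU (Suc n) i (?y s) t) (at s)"
      by (rule iffD1[OF has_pd_along_line]) (rule has_pd_U)
    then show "((\<lambda>s. U (Suc n) (?y s) t) has_derivative (\<lambda>h. DU (Suc n) i (?y s) t * h)) (at s within UNIV)"
      by (simp only: has_field_derivative_def)
  next
    fix e :: real assume "e > 0"
    have "\<forall>\<^sub>F n in sequentially. C * (1/2)^n < e"
      by (rule order_tendstoD(2)[OF half_power_tendsto \<open>e > 0\<close>])
    then show "\<forall>\<^sub>F n in sequentially. \<forall>s\<in>UNIV. \<forall>h. norm (DU (Suc n) i (?y s) t * h - gu i (?y s) t * h) \<le> e * norm h"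
    proof eventually_elim
      case (elim n)
      show ?case
      proof (intro ballI allI)
        fix s h
        have "norm (DU (Suc n) i (?y s) t * h - gu i (?y s) t * h) = \<bar>DU (Suc n) i (?y s) t - gu i (?y s) t\<bar> * \<bar>h\<bar>"
          by (simp only: real_norm_def abs_mult[symmetric] left_diff_distrib)
        also have "\<dots> \<le> e * \<bar>h\<bar>" using conv[of n "?y s"] elim by (intro mult_right_mono) auto
        finally show "norm (DU (Suc n) i (?y s) t * h - gu i (?y s) t * h) \<le> e * norm h" by simp
      qed
    qed
  next
    show "(\<lambda>n. U (Suc n) (?y 0) t) \<longlonglongrightarrow> u (?y 0) t" by (rule LIMSEQ_Suc[OF U_tendsto])
  qed auto
  then obtain g where g: "\<And>s. (\<lambda>n. U (Suc n) (?y s) t) \<longlonglongrightarrow> g s"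
    "\<And>s. (g has_derivative (\<lambda>h. gu i (?y s) t * h)) (at s)" by auto
  have "g s = u (?y s) t" for s
    using LIMSEQ_unique[OF g(1) LIMSEQ_Suc[OF U_tendsto]] .
  then have "g = (\<lambda>s. u (?y s) t)" by auto
  with g(2)[of 0] show ?thesis by (simp add: has_pd_def has_field_derivative_def)
qed

text \<open>One derivative sits on the weight and the other on the density
  \<open>ft (u y s)\<close>, so second derivatives of u are expressed through its first derivatives
  and the continuous \<open>ft'\<close>.\<close>

definition hu :: "'n \<Rightarrow> 'n \<Rightarrow> real^'n \<Rightarrow> real \<Rightarrow> real" where
  "hu i j x t = heat (u2 i j) x t + potential_grad i (\<lambda>y s. ft' (u y s) * gu j y s) x t"

lemma tame_hu: "tame (hu i j)"
  unfolding hu_def by (intro tame_add tame_S2 tame_potential_grad tame_mult tame_compose[OF _ cft'] tame_u tame_gu)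

lemma has_pd_gu: "has_pd j (\<lambda>x. gu i x t) x (hu i j x t)"
  unfolding gu_def[of i] hu_def
  by (intro has_pd_add has_pd_heat[OF c1 b1 c2 b2 d2] has_pd_Duhamel_ft(2) tame_u tame_gu has_pd_u)

lemma u_time_derivative:
  assumes t: "t > 0"
  shows "(u x has_real_derivative (\<Sum>i\<in>UNIV. hu i i x t) + ft (u x t)) (at t)"
proof -
  have eq: "u x = (\<lambda>t. heat u0 x t + potential (\<lambda>y s. ft (u y s)) x t)" by (rule ext) (rule u_fixed_point)
  have h: "(heat u0 x has_real_derivative (\<Sum>i\<in>UNIV. heat (u2 i i) x t)) (at t)"
    by (rule heat_time_derivative[OF c0 c1 c2 b0 b1 b2 d1 d2 t])
  have d: "(potential (\<lambda>y s. ft (u y s)) x has_real_derivative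
      ft (u x t) + (\<Sum>i\<in>UNIV. potential_grad i (\<lambda>y s. ft' (u y s) * gu i y s) x t)) (at t)"
  proof (rule potential_time_derivative[OF tame_ft[OF tame_u] _ _ t])
    show "tame (\<lambda>y s. ft' (u y s) * gu i y s)" for i
      by (intro tame_mult tame_compose[OF _ cft'] tame_u tame_gu)
    show "has_pd i (\<lambda>x. ft (u x t)) x (ft' (u x t) * gu i x t)" for i x t
      by (rule has_pd_compose[OF ftd has_pd_u])
  qed
  have "(u x has_real_derivative (\<Sum>i\<in>UNIV. heat (u2 i i) x t) +
      (ft (u x t) + (\<Sum>i\<in>UNIV. potential_grad i (\<lambda>y s. ft' (u y s) * gu i y s) x t))) (at t)"
    by (subst eq) (rule DERIV_add[OF h d])
  then show ?thesis by (simp add: hu_def sum.distrib add_ac)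
qed

lemma u_initial: "u x 0 = u0 x"
proof -
  interpret G: prob_space "gauss :: (real^'n) measure" by (rule prob_space_gauss)
  have "heat u0 x 0 = u0 x" by (simp add: heat_def G.prob_space[unfolded space_gauss])
  moreover have "potential (\<lambda>y s. ft (u y s)) x 0 = 0" by (simp add: potential_def heat_mean_def)
  ultimately show ?thesis using u_fixed_point[of x 0] by linarith
qed

end

section \<open>The singular profile equation\<close>

lemma at_within_atLeast_interior: "(0::real) < x \<Longrightarrow> at x within {0..} = at x"
  by (rule at_within_interior) (simp add: interior_real_atLeast)

lemma at_within_atLeast_Icc: "s < T \<Longrightarrow> at (s::real) within {0..} = at s within {0..T}"
  by (rule at_within_nhd[of s "{..<T}"]) auto

lemma nondecreasing_from_derivative:
  fixes f :: "real \<Rightarrow> real"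
  assumes der: "\<And>s. a \<le> s \<Longrightarrow> s \<le> b \<Longrightarrow> (f has_real_derivative f' s) (at s within {0..})"
    and nonneg: "\<And>s. a < s \<Longrightarrow> s < b \<Longrightarrow> 0 \<le> f' s" and ab: "0 \<le> a" "a \<le> b"
  shows "f a \<le> f b"
proof (rule DERIV_nonneg_imp_increasing_open[OF ab(2)])
  fix x assume x: "a < x" "x < b"
  then have "(f has_real_derivative f' x) (at x)"
    using der[of x] ab at_within_atLeast_interior[of x] by simp
  then show "\<exists>y. (f has_real_derivative y) (at x) \<and> 0 \<le> y" using nonneg x by blast
next
  show "continuous_on {a..b} f"
    by (rule DERIV_continuous_on[of _ _ f'], rule DERIV_subset[OF der]) (use ab in auto)
qed

text \<open>At a negative minimum m either m = 0, where the factor 4 s kills the derivative term, or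
  the derivative is nonpositive; in both cases the right-hand side of \<open>ineq\<close> would be
  negative. The degeneracy at 0 takes the place of a boundary condition.\<close>

lemma degenerate_minimum_principle:
  fixes D D' :: "real \<Rightarrow> real"
  assumes der: "\<And>s. 0 \<le> s \<Longrightarrow> s \<le> S \<Longrightarrow> (D has_real_derivative D' s) (at s within {0..})"
    and ineq: "\<And>s. 0 \<le> s \<Longrightarrow> s \<le> S \<Longrightarrow> 0 \<le> 4 * s * D' s + (c + s) * D s"
    and c: "c > 0" and s: "0 \<le> s" "s \<le> S"
  shows "0 \<le> D s"
proof (rule ccontr)
  assume neg: "\<not> 0 \<le> D s"
  have "continuous_on {0..S} D"
    by (rule DERIV_continuous_on[of _ _ D'], rule DERIV_subset[OF der]) auto
  then obtain m where m: "m \<in> {0..S}" "\<And>r. r \<in> {0..S} \<Longrightarrow> D m \<le> D r"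
    using continuous_attains_inf[of "{0..S}" D] s by auto
  have Dm: "D m < 0" using m(2)[of s] neg s by auto
  have "D' m \<le> 0 \<or> m = 0"
  proof (rule ccontr)
    assume "\<not> ?thesis"
    then have pos: "0 < D' m" "0 < m" using m(1) by auto
    obtain d where d: "d > 0" "\<And>h. h > 0 \<Longrightarrow> m - h \<in> {0..} \<Longrightarrow> h < d \<Longrightarrow> D (m - h) < D m"
      using has_real_derivative_pos_inc_left[OF der pos(1)] m(1) by auto
    define h where "h = min (d/2) m"
    have "h > 0" "h < d" "h \<le> m" using d(1) pos(2) by (auto simp: h_def)
    then show False using d(2)[of h] m(2)[of "m - h"] m(1) by auto
  qed
  then have "4 * m * D' m \<le> 0" using m(1) by (auto simp: mult_nonneg_nonpos)
  moreover have "(c + m) * D m < 0" using c m(1) Dm by (intro mult_pos_neg) auto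
  ultimately show False using ineq[of m] m(1) by auto
qed

text \<open>At a first zero, positivity to the left forces J' <= 0. The premise of
  \<open>step\<close> hands over positivity on all of [a, s), so the strict inequality at the zero
  may draw on the whole past.\<close>

lemma positive_until_first_zero:
  fixes J J' :: "real \<Rightarrow> real"
  assumes der: "\<And>s. a \<le> s \<Longrightarrow> (J has_real_derivative J' s) (at s within {0..})" and a: "0 \<le> a" "0 < J a"
    and step: "\<And>s. a < s \<Longrightarrow> (\<And>r. a \<le> r \<Longrightarrow> r < s \<Longrightarrow> 0 < J r) \<Longrightarrow> J s = 0 \<Longrightarrow> 0 < J' s"
    and s: "a \<le> s"
  shows "0 < J s"
proof (rule ccontr)
  assume neg: "\<not> 0 < J s"
  define Z where "Z = {r \<in> {a..s}. J r \<le> 0}"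
  have cont: "continuous_on {a..s} J"
    by (rule DERIV_continuous_on[of _ _ J'], rule DERIV_subset[OF der]) (use a in auto)
  have "Z = {a..s} \<inter> J -` {..0}" by (auto simp: Z_def)
  then have "closed Z" using continuous_closed_preimage[OF cont, of "{..0}"] by simp
  then have "compact Z" unfolding Z_def
    by (metis (no_types, lifting) Z_def compact_Icc compact_Int_closed inf.absorb_iff2 mem_Collect_eq subsetI)
  moreover have "Z \<noteq> {}" using neg s by (auto simp: Z_def)
  ultimately obtain m where m: "m \<in> Z" "\<And>r. r \<in> Z \<Longrightarrow> m \<le> r" using compact_attains_inf[of Z] by auto
  have before: "0 < J r" if "a \<le> r" "r < m" for r
    using m(2)[of r] m(1) that by (force simp: Z_def)
  have am: "a < m" using m(1) a by (cases "a = m") (auto simp: Z_def)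
  have Jm: "J m = 0"
  proof (rule ccontr)
    assume "J m \<noteq> 0"
    then have "J m < 0" using m(1) by (auto simp: Z_def)
    moreover have "continuous_on {a..m} J" by (rule continuous_on_subset[OF cont]) (use m(1) in \<open>auto simp: Z_def\<close>)
    ultimately obtain r where "a \<le> r" "r \<le> m" "J r = 0"
      using IVT2'[of J m 0 a] a am by auto
    then show False using before[of r] \<open>J m < 0\<close> by (cases "r = m") auto
  qed
  have pos: "0 < J' m" using step[OF am before Jm] .
  have "(J has_real_derivative J' m) (at m within {0..})" using der am by simp
  from has_real_derivative_pos_inc_left[OF this pos]
  obtain d where d: "d > 0" "\<And>h. h > 0 \<Longrightarrow> m - h \<in> {0..} \<Longrightarrow> h < d \<Longrightarrow> J (m - h) < J m" by auto
  define h where "h = min (d/2) (m - a)"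
  have "h > 0" "h < d" "h \<le> m - a" using d(1) am by (auto simp: h_def)
  then show False using d(2)[of h] before[of "m - h"] a Jm by auto
qed

lemma antiderivative_exists:
  fixes g :: "real \<Rightarrow> real"
  assumes "continuous_on UNIV g"
  obtains G where "G a = c" "\<And>x. (G has_real_derivative g x) (at x)"
proof -
  have "\<exists>F. \<forall>x::real. -\<infinity> < ereal x \<longrightarrow> ereal x < \<infinity> \<longrightarrow> (F has_vector_derivative g x) (at x)"
    by (rule einterval_antiderivative) (use assms in \<open>auto simp: continuous_on_eq_continuous_at\<close>)
  then obtain F where F: "\<And>x. (F has_real_derivative g x) (at x)"
    by (auto simp: has_real_derivative_iff_has_vector_derivative)
  show ?thesis
  proof (rule that[of "\<lambda>x. F x - F a + c"])
    show "((\<lambda>x. F x - F a + c) has_real_derivative g x) (at x)" for x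
      by (auto intro!: derivative_eq_intros F)
  qed simp
qed

text \<open>The equation \<open>4 s V'' + (2 N + s) V' + H(V) = 0\<close>, singular at \<open>s = 0\<close>, is solved in the form
  \<open>V' = volterra V\<close>, obtained with the integrating factor \<open>s\<^bsup>N/2\<^esup> e\<^bsup>s/4\<^esup>\<close> and the substitution \<open>\<tau> = s \<kappa>\<^sup>2\<close>; in this
  form the right-hand side is regular up to \<open>s = 0\<close>.\<close>

locale singular_ode =
  fixes H H' :: "real \<Rightarrow> real" and K v0 :: real and N :: nat
  assumes Hd: "\<And>v. (H has_real_derivative H' v) (at v)" and cH': "continuous_on UNIV H'"
    and HK: "\<And>v. \<bar>H' v\<bar> \<le> K" and K: "K > 0" and N: "N \<ge> 1"
begin

lemma cH: "continuous_on UNIV H"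
  by (rule DERIV_continuous_on, rule has_field_derivative_at_within, rule Hd)

lemma H_Lipschitz: "\<bar>H a - H b\<bar> \<le> K * \<bar>a - b\<bar>"
  using field_differentiable_bound[of UNIV H H' K a b] Hd HK by simp

definition ker :: "real \<Rightarrow> real \<Rightarrow> real" where
  "ker s \<kappa> = \<kappa> ^ (N - 1) * exp (- s * (1 - \<kappa>\<^sup>2) / 4)"

text \<open>The factor 1/2 is 1/4 from normalising the leading coefficient times 2 from the Jacobian
  2 s \<kappa> of the substitution.\<close>

definition volterra :: "(real \<Rightarrow> real) \<Rightarrow> real \<Rightarrow> real" where
  "volterra V s = - (1/2) * integral {0..1} (\<lambda>\<kappa>. ker s \<kappa> * H (V (s * \<kappa>\<^sup>2)))"

lemma ker_bounds: "0 \<le> s \<Longrightarrow> \<kappa> \<in> {0..1} \<Longrightarrow> 0 \<le> ker s \<kappa> \<and> ker s \<kappa> \<le> 1"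
proof -
  assume s: "0 \<le> s" and k: "\<kappa> \<in> {0..1}"
  have "0 \<le> 1 - \<kappa>\<^sup>2" using k by (simp add: power_le_one)
  then have "exp (- s * (1 - \<kappa>\<^sup>2) / 4) \<le> 1" using s by (simp add: mult_nonneg_nonneg)
  then have "\<kappa> ^ (N - 1) * exp (- s * (1 - \<kappa>\<^sup>2) / 4) \<le> 1 * 1"
    using k by (intro mult_mono) (auto simp: power_le_one)
  then show ?thesis using k by (simp add: ker_def)
qed

lemma cont_integrand:
  assumes V: "continuous_on {0..} V"
  shows "continuous_on ({0..} \<times> cbox 0 1) (\<lambda>(s, \<kappa>). ker s \<kappa> * H (V (s * \<kappa>\<^sup>2)))"
  unfolding case_prod_beta ker_def
proof (intro continuous_intros)
  have "continuous_on ({0..} \<times> cbox 0 1) (\<lambda>p. V (fst p * (snd p)\<^sup>2))"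
    by (rule continuous_on_compose2[OF V]) (auto intro!: continuous_intros)
  then show "continuous_on ({0..} \<times> cbox 0 1) (\<lambda>p. H (V (fst p * (snd p)\<^sup>2)))"
    by (rule continuous_on_compose2[OF cH]) simp
qed auto

lemma cont_volterra: "continuous_on {0..} V \<Longrightarrow> continuous_on {0..} (volterra V)"
  unfolding volterra_def cbox_interval[symmetric]
  by (intro continuous_intros integral_continuous_on_param cont_integrand)

lemma integrable_integrand:
  assumes V: "continuous_on {0..} V" and s: "0 \<le> s"
  shows "(\<lambda>\<kappa>. ker s \<kappa> * H (V (s * \<kappa>\<^sup>2))) integrable_on {0..1}"
proof (rule integrable_continuous_interval)
  have "continuous_on {0..1} (\<lambda>\<kappa>. (case (s, \<kappa>) of (s, \<kappa>) \<Rightarrow> ker s \<kappa> * H (V (s * \<kappa>\<^sup>2))))"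
    by (rule continuous_on_compose2[OF cont_integrand[OF V]]) (use s in \<open>auto intro!: continuous_intros\<close>)
  then show "continuous_on {0..1} (\<lambda>\<kappa>. ker s \<kappa> * H (V (s * \<kappa>\<^sup>2)))" by simp
qed

section \<open>Picard iteration for the Volterra form\<close>

definition picard_map :: "(real \<Rightarrow> real) \<Rightarrow> real \<Rightarrow> real" where
  "picard_map V s = v0 + integral {0..s} (volterra V)"

lemma picard_map_derivative:
  assumes V: "continuous_on {0..} V" and s: "0 \<le> s"
  shows "(picard_map V has_real_derivative volterra V s) (at s within {0..})"
proof -
  have "((\<lambda>u. integral {0..u} (volterra V)) has_real_derivative volterra V s) (at s within {0..s+1})"
    by (rule integral_has_real_derivative) (use s continuous_on_subset[OF cont_volterra[OF V]] in auto)
  then have "(picard_map V has_real_derivative volterra V s) (at s within {0..s+1})"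
    unfolding picard_map_def by (auto intro!: derivative_eq_intros)
  then show ?thesis using at_within_atLeast_Icc[of s "s+1"] by simp
qed

lemma cont_picard_map: "continuous_on {0..} V \<Longrightarrow> continuous_on {0..} (picard_map V)"
  by (rule DERIV_continuous_on[of _ _ "volterra V"]) (simp add: picard_map_derivative)

lemma volterra_diff:
  assumes V: "continuous_on {0..} V" and W: "continuous_on {0..} W" and s: "0 \<le> s"
    and b: "\<And>r. 0 \<le> r \<Longrightarrow> \<bar>V r - W r\<bar> \<le> c * exp (K * r)"
  shows "\<bar>volterra V s - volterra W s\<bar> \<le> c / 2 * (K * exp (K * s))"
proof -
  have c: "0 \<le> c" using order_trans[OF abs_ge_zero b[of 0]] by simp
  let ?g = "\<lambda>\<kappa>. ker s \<kappa> * H (V (s * \<kappa>\<^sup>2)) - ker s \<kappa> * H (W (s * \<kappa>\<^sup>2))"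
  have I: "norm (integral {0..1} ?g) \<le> integral {0..1} (\<lambda>\<kappa>::real. K * (c * exp (K * s)))"
  proof (rule integral_norm_bound_integral)
    show "?g integrable_on {0..1}" by (intro integrable_diff integrable_integrand V W s)
    fix \<kappa> :: real assume k: "\<kappa> \<in> {0..1}"
    have k2: "0 \<le> s * \<kappa>\<^sup>2" "s * \<kappa>\<^sup>2 \<le> s" using k s by (auto simp: power_le_one mult_left_le)
    have "\<bar>H (V (s * \<kappa>\<^sup>2)) - H (W (s * \<kappa>\<^sup>2))\<bar> \<le> K * \<bar>V (s * \<kappa>\<^sup>2) - W (s * \<kappa>\<^sup>2)\<bar>"
      by (rule H_Lipschitz)
    also have "\<dots> \<le> K * (c * exp (K * (s * \<kappa>\<^sup>2)))" using K b[OF k2(1)] by (intro mult_left_mono) auto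
    also have "\<dots> \<le> K * (c * exp (K * s))" using K c k2(2) by (intro mult_left_mono) auto
    finally have *: "\<bar>H (V (s * \<kappa>\<^sup>2)) - H (W (s * \<kappa>\<^sup>2))\<bar> \<le> K * (c * exp (K * s))" .
    have "norm (?g \<kappa>) = ker s \<kappa> * \<bar>H (V (s * \<kappa>\<^sup>2)) - H (W (s * \<kappa>\<^sup>2))\<bar>"
      using ker_bounds[OF s k] by (simp add: abs_mult flip: right_diff_distrib)
    also have "\<dots> \<le> 1 * (K * (c * exp (K * s)))"
      using ker_bounds[OF s k] * by (intro mult_mono) auto
    finally show "norm (?g \<kappa>) \<le> K * (c * exp (K * s))" by simp
  qed (rule integrable_const_ivl)
  moreover have "integral {0..1} ?g = integral {0..1} (\<lambda>\<kappa>. ker s \<kappa> * H (V (s * \<kappa>\<^sup>2))) - integral {0..1} (\<lambda>\<kappa>. ker s \<kappa> * H (W (s * \<kappa>\<^sup>2)))"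
    by (intro Henstock_Kurzweil_Integration.integral_diff integrable_integrand V W s)
  ultimately have "volterra V s - volterra W s = - (1/2) * integral {0..1} ?g" by (simp add: volterra_def algebra_simps)
  then have "\<bar>volterra V s - volterra W s\<bar> = 1/2 * norm (integral {0..1} ?g)" by (simp add: abs_mult)
  also have "\<dots> \<le> 1/2 * integral {0..1} (\<lambda>\<kappa>::real. K * (c * exp (K * s)))"
    using I by (intro mult_left_mono) auto
  also have "\<dots> = c / 2 * (K * exp (K * s))" by simp
  finally show ?thesis .
qed

text \<open>The weight exp(K s) integrates to at most exp(K s) / K, which uses up the Lipschitz
  constant; the factor 1/2 in \<open>volterra\<close> remains as contraction constant.\<close>

lemma picard_map_diff:
  assumes V: "continuous_on {0..} V" and W: "continuous_on {0..} W" and s: "0 \<le> s"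
    and b: "\<And>r. 0 \<le> r \<Longrightarrow> \<bar>V r - W r\<bar> \<le> c * exp (K * r)"
  shows "\<bar>picard_map V s - picard_map W s\<bar> \<le> c / 2 * exp (K * s)"
proof -
  have c: "0 \<le> c" using order_trans[OF abs_ge_zero b[of 0]] by simp
  have ik: "volterra X integrable_on {0..s}" if "continuous_on {0..} X" for X
    by (rule integrable_continuous_interval, rule continuous_on_subset[OF cont_volterra[OF that]]) auto
  have I: "((\<lambda>r. c / 2 * (K * exp (K * r))) has_integral (c / 2 * exp (K * s) - c / 2 * exp (K * 0))) {0..s}"
    by (rule fundamental_theorem_of_calculus[OF s])
       (auto intro!: derivative_eq_intros simp flip: has_real_derivative_iff_has_vector_derivative)
  have "norm (integral {0..s} (\<lambda>r. volterra V r - volterra W r)) \<le> integral {0..s} (\<lambda>r. c / 2 * (K * exp (K * r)))"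
    by (rule integral_norm_bound_integral)
       (use I volterra_diff[OF V W _ b] in \<open>auto intro!: integrable_diff ik V W simp: has_integral_integrable\<close>)
  also have "\<dots> = c / 2 * exp (K * s) - c / 2 * exp (K * 0)" using I by (rule integral_unique)
  also have "\<dots> \<le> c / 2 * exp (K * s)" using c by simp
  finally have "norm (integral {0..s} (\<lambda>r. volterra V r - volterra W r)) \<le> c / 2 * exp (K * s)" .
  moreover have "integral {0..s} (\<lambda>r. volterra V r - volterra W r) = picard_map V s - picard_map W s"
    unfolding picard_map_def by (subst Henstock_Kurzweil_Integration.integral_diff[OF ik[OF V] ik[OF W]]) simp
  ultimately show ?thesis by simp
qed

primrec Vn :: "nat \<Rightarrow> real \<Rightarrow> real" where
  "Vn 0 = (\<lambda>s. v0)"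
| "Vn (Suc n) = picard_map (Vn n)"

lemma cont_Vn: "continuous_on {0..} (Vn n)"
  by (induction n) (auto intro: cont_picard_map)

lemma Vn_increment: "0 \<le> s \<Longrightarrow> \<bar>Vn (Suc n) s - Vn n s\<bar> \<le> (\<bar>H v0\<bar> / K * exp (K * s)) * (1/2)^n"
proof (induction n arbitrary: s)
  case 0
  have kb: "norm (volterra (\<lambda>s. v0) r) \<le> \<bar>H v0\<bar>" if r: "0 \<le> r" for r
  proof -
    have "norm (integral {0..1} (\<lambda>\<kappa>. ker r \<kappa> * H v0)) \<le> integral {0..1} (\<lambda>\<kappa>::real. \<bar>H v0\<bar>)"
    proof (rule integral_norm_bound_integral)
      show "(\<lambda>\<kappa>. ker r \<kappa> * H v0) integrable_on {0..1}" using integrable_integrand[of "\<lambda>_. v0" r] r by simp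
      show "norm (ker r \<kappa> * H v0) \<le> \<bar>H v0\<bar>" if "\<kappa> \<in> {0..1}" for \<kappa>
        using ker_bounds[OF r that] by (simp add: abs_mult mult_left_le_one_le)
    qed (rule integrable_const_ivl)
    then show ?thesis by (simp add: volterra_def)
  qed
  have "norm (integral {0..s} (volterra (\<lambda>s. v0))) \<le> integral {0..s} (\<lambda>r. \<bar>H v0\<bar>)"
  proof (rule integral_norm_bound_integral)
    show "volterra (\<lambda>s. v0) integrable_on {0..s}"
      by (rule integrable_continuous_interval, rule continuous_on_subset[OF cont_volterra]) auto
  qed (use kb in \<open>auto intro: integrable_const_ivl\<close>)
  also have "\<dots> = s * \<bar>H v0\<bar>" using 0 by simp
  also have "\<dots> \<le> \<bar>H v0\<bar> / K * exp (K * s)"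
  proof -
    have "K * s \<le> exp (K * s)" using exp_ge_add_one_self[of "K * s"] by linarith
    then have "s \<le> exp (K * s) / K" using K by (simp add: field_simps)
    then have "s * \<bar>H v0\<bar> \<le> exp (K * s) / K * \<bar>H v0\<bar>" by (rule mult_right_mono) simp
    then show ?thesis by (simp add: mult_ac)
  qed
  finally show ?case by (simp add: picard_map_def)
next
  case (Suc n)
  have "\<bar>Vn (Suc n) r - Vn n r\<bar> \<le> (\<bar>H v0\<bar> / K * (1/2)^n) * exp (K * r)" if "0 \<le> r" for r
    using Suc.IH[OF that] by (simp add: mult_ac)
  from picard_map_diff[OF cont_Vn cont_Vn Suc.prems this]
  show ?case by (simp add: mult_ac)
qed

definition V :: "real \<Rightarrow> real" where "V s = lim (\<lambda>n. Vn n s)"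

lemma V_approx: "0 \<le> s \<Longrightarrow> \<bar>V s - Vn n s\<bar> \<le> (2 * \<bar>H v0\<bar> / K * (1/2)^n) * exp (K * s)"
  using geometric_increments_converge(2)[where s = "\<lambda>n. Vn n s" and n = n, OF Vn_increment] by (simp add: V_def mult_ac)

lemma Vn_tendsto: "0 \<le> s \<Longrightarrow> (\<lambda>n. Vn n s) \<longlonglongrightarrow> V s"
  using geometric_increments_converge(1)[where s = "\<lambda>n. Vn n s", OF Vn_increment] by (simp add: V_def convergent_LIMSEQ_iff)

lemma half_power_null: "(\<lambda>n. c * (1/2)^n) \<longlonglongrightarrow> (0::real)"
  by (intro tendsto_mult_right_zero LIMSEQ_power_zero) simp

lemma cont_V: "continuous_on {0..} V"
proof -
  have loc: "continuous_on {0..T} V" for T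
  proof -
    have "uniform_limit {0..T} Vn V sequentially"
    proof (rule uniform_limitI)
      fix e :: real assume "e > 0"
      have "\<forall>\<^sub>F n in sequentially. (2 * \<bar>H v0\<bar> / K * exp (K * T)) * (1/2)^n < e"
        by (rule order_tendstoD(2)[OF half_power_null \<open>e > 0\<close>])
      then show "\<forall>\<^sub>F n in sequentially. \<forall>s\<in>{0..T}. dist (Vn n s) (V s) < e"
      proof eventually_elim
        case (elim n)
        show ?case
        proof
          fix s assume s: "s \<in> {0..T}"
          have "(2 * \<bar>H v0\<bar> / K * (1/2)^n) * exp (K * s) \<le> (2 * \<bar>H v0\<bar> / K * (1/2)^n) * exp (K * T)"
            using s K by (intro mult_left_mono) auto
          then have "\<bar>V s - Vn n s\<bar> \<le> (2 * \<bar>H v0\<bar> / K * exp (K * T)) * (1/2)^n"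
            using V_approx[of s n] s by (simp add: mult_ac)
          with elim show "dist (Vn n s) (V s) < e" by (simp add: dist_real_def abs_minus_commute)
        qed
      qed
    qed
    then show ?thesis
      by (rule uniform_limit_theorem[rotated])
         (auto intro!: always_eventually continuous_on_subset[OF cont_Vn])
  qed
  show ?thesis
    unfolding continuous_on_eq_continuous_within
  proof
    fix s :: real assume s: "s \<in> {0..}"
    have "continuous (at s within {0..s+1}) V"
      using loc[of "s+1"] s by (simp add: continuous_on_eq_continuous_within)
    then show "continuous (at s within {0..}) V" using at_within_atLeast_Icc[of s "s+1"] by simp
  qed
qed

lemma V_fixed_point: assumes s: "0 \<le> s" shows "V s = picard_map V s"
proof -
  have "(\<lambda>n. picard_map (Vn n) s - picard_map V s) \<longlonglongrightarrow> 0"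
  proof (rule Lim_transform_bound[of _ "\<lambda>n. (\<bar>H v0\<bar> / K * exp (K * s)) * (1/2)^n"])
    show "\<forall>\<^sub>F n in sequentially. norm (picard_map (Vn n) s - picard_map V s) \<le> norm ((\<bar>H v0\<bar> / K * exp (K * s)) * (1/2)^n)"
    proof (rule always_eventually, rule allI)
      fix n
      have "\<bar>Vn n r - V r\<bar> \<le> (2 * \<bar>H v0\<bar> / K * (1/2)^n) * exp (K * r)" if "0 \<le> r" for r
        using V_approx[OF that, of n] by (simp add: abs_minus_commute)
      from picard_map_diff[OF cont_Vn cont_V s this]
      have "\<bar>picard_map (Vn n) s - picard_map V s\<bar> \<le> (\<bar>H v0\<bar> / K * exp (K * s)) * (1/2)^n" by (simp add: mult_ac)
      then show "norm (picard_map (Vn n) s - picard_map V s) \<le> norm ((\<bar>H v0\<bar> / K * exp (K * s)) * (1/2)^n)"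
        unfolding real_norm_def by linarith
    qed
  qed (rule half_power_null)
  then have "(\<lambda>n. Vn (Suc n) s) \<longlonglongrightarrow> picard_map V s" by (simp add: LIM_zero_iff)
  then show ?thesis using LIMSEQ_Suc[OF Vn_tendsto[OF s]] LIMSEQ_unique by blast
qed

lemma V_initial: "V 0 = v0"
  using V_fixed_point[of 0] by (simp add: picard_map_def)

lemma V_derivative: assumes s: "0 \<le> s" shows "(V has_real_derivative volterra V s) (at s within {0..})"
  by (rule has_field_derivative_transform_within[OF picard_map_derivative[OF cont_V s], of 1])
     (use s V_fixed_point in auto)

section \<open>The second derivative and the differential equation\<close>

definition volterra_deriv :: "real \<Rightarrow> real" where
  "volterra_deriv s = - (1/2) * integral {0..1} (\<lambda>\<kappa>. ker s \<kappa> *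
     (- ((1 - \<kappa>\<^sup>2) / 4) * H (V (s * \<kappa>\<^sup>2)) + H' (V (s * \<kappa>\<^sup>2)) * (volterra V (s * \<kappa>\<^sup>2) * \<kappa>\<^sup>2)))"

lemma V_line_derivative:
  assumes U: "U \<subseteq> {0..}" "s \<in> U"
  shows "((\<lambda>s. H (V (s * \<kappa>\<^sup>2))) has_real_derivative H' (V (s * \<kappa>\<^sup>2)) * (volterra V (s * \<kappa>\<^sup>2) * \<kappa>\<^sup>2)) (at s within U)"
proof -
  have "((\<lambda>s. V (s * \<kappa>\<^sup>2)) has_real_derivative volterra V (s * \<kappa>\<^sup>2) * \<kappa>\<^sup>2) (at s within U)"
  proof (rule DERIV_image_chain[where f = V and g = "\<lambda>s. s * \<kappa>\<^sup>2", unfolded o_def])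
    show "(V has_real_derivative volterra V (s * \<kappa>\<^sup>2)) (at (s * \<kappa>\<^sup>2) within (\<lambda>s. s * \<kappa>\<^sup>2) ` U)"
      by (rule DERIV_subset[OF V_derivative]) (use U in \<open>auto intro!: mult_nonneg_nonneg\<close>)
  qed (auto intro!: derivative_eq_intros)
  then show ?thesis by (rule DERIV_chain2[OF Hd])
qed

lemma cont_volterra_deriv_integrand:
  "continuous_on ({0..} \<times> cbox 0 1) (\<lambda>(s, \<kappa>). ker s \<kappa> *
     (- ((1 - \<kappa>\<^sup>2) / 4) * H (V (s * \<kappa>\<^sup>2)) + H' (V (s * \<kappa>\<^sup>2)) * (volterra V (s * \<kappa>\<^sup>2) * \<kappa>\<^sup>2)))"
  unfolding case_prod_beta ker_def
proof (intro continuous_intros)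
  have V: "continuous_on ({0..} \<times> cbox 0 1) (\<lambda>p. V (fst p * (snd p)\<^sup>2))"
    by (rule continuous_on_compose2[OF cont_V]) (auto intro!: continuous_intros)
  then show "continuous_on ({0..} \<times> cbox 0 1) (\<lambda>p. H (V (fst p * (snd p)\<^sup>2)))"
    by (rule continuous_on_compose2[OF cH]) simp
  show "continuous_on ({0..} \<times> cbox 0 1) (\<lambda>p. H' (V (fst p * (snd p)\<^sup>2)))"
    by (rule continuous_on_compose2[OF cH' V]) simp
  show "continuous_on ({0..} \<times> cbox 0 1) (\<lambda>p. volterra V (fst p * (snd p)\<^sup>2))"
    by (rule continuous_on_compose2[OF cont_volterra[OF cont_V]]) (auto intro!: continuous_intros)
qed auto

lemma cont_volterra_deriv: "continuous_on {0..} volterra_deriv"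
  unfolding volterra_deriv_def cbox_interval[symmetric]
  by (intro continuous_intros integral_continuous_on_param cont_volterra_deriv_integrand)

lemma volterra_derivative:
  assumes s: "0 \<le> s" shows "(volterra V has_real_derivative volterra_deriv s) (at s within {0..})"
proof -
  have "((\<lambda>s. integral (cbox 0 1) (\<lambda>\<kappa>. ker s \<kappa> * H (V (s * \<kappa>\<^sup>2)))) has_real_derivative
     integral (cbox 0 1) (\<lambda>\<kappa>. ker s \<kappa> *
     (- ((1 - \<kappa>\<^sup>2) / 4) * H (V (s * \<kappa>\<^sup>2)) + H' (V (s * \<kappa>\<^sup>2)) * (volterra V (s * \<kappa>\<^sup>2) * \<kappa>\<^sup>2)))) (at s within {0..})"
  proof (rule leibniz_rule_field_derivative[OF _ _ cont_volterra_deriv_integrand])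
    fix s \<kappa> :: real assume s: "s \<in> {0..}"
    have "((\<lambda>s. ker s \<kappa>) has_real_derivative ker s \<kappa> * (- ((1 - \<kappa>\<^sup>2) / 4))) (at s within {0..})"
      unfolding ker_def by (auto intro!: derivative_eq_intros)
    from DERIV_mult[OF this V_line_derivative[OF order.refl s, of \<kappa>]]
    show "((\<lambda>s. ker s \<kappa> * H (V (s * \<kappa>\<^sup>2))) has_real_derivative ker s \<kappa> *
     (- ((1 - \<kappa>\<^sup>2) / 4) * H (V (s * \<kappa>\<^sup>2)) + H' (V (s * \<kappa>\<^sup>2)) * (volterra V (s * \<kappa>\<^sup>2) * \<kappa>\<^sup>2))) (at s within {0..})"
      by (rule back_subst[where P = "\<lambda>D. (_ has_real_derivative D) _"]) (simp add: algebra_simps)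
    show "(\<lambda>\<kappa>. ker s \<kappa> * H (V (s * \<kappa>\<^sup>2))) integrable_on cbox 0 1"
      using integrable_integrand[OF cont_V, of s] s by (simp add: cbox_interval)
  qed (use s in auto)
  from DERIV_cmult[OF this, of "- (1/2)"] show ?thesis
    by (simp only: volterra_def[abs_def] volterra_deriv_def cbox_interval)
qed

text \<open>Verified without dividing by s: the combination of the two integrals is -1 times the
  integral over [0, 1] of the derivative of \<kappa>^N exp(-s (1 - \<kappa>^2) / 4) H(V(s
  \<kappa>^2)). That integral equals H(V s), the boundary term at \<kappa> = 0 being zero for N >=
  1.\<close>

lemma volterra_ode:
  assumes s: "0 \<le> s" shows "4 * s * volterra_deriv s + (2 * real N + s) * volterra V s + H (V s) = 0"
proof -
  let ?HV = "\<lambda>\<kappa>. H (V (s * \<kappa>\<^sup>2))"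
  let ?H1 = "\<lambda>\<kappa>. H' (V (s * \<kappa>\<^sup>2)) * volterra V (s * \<kappa>\<^sup>2)"
  let ?G' = "\<lambda>\<kappa>. ker s \<kappa> * (real N * ?HV \<kappa> + \<kappa>\<^sup>2 * (s / 2) * ?HV \<kappa> + 2 * s * \<kappa>\<^sup>2 * ?H1 \<kappa>)"
  have "(?G' has_integral (1 ^ N * exp (- s * (1 - 1\<^sup>2) / 4) * ?HV 1 - 0 ^ N * exp (- s * (1 - 0\<^sup>2) / 4) * ?HV 0)) {0..1}"
  proof (rule fundamental_theorem_of_calculus)
    fix \<kappa> :: real assume k: "\<kappa> \<in> {0..1}"
    have V1: "((\<lambda>\<kappa>. V (s * \<kappa>\<^sup>2)) has_real_derivative volterra V (s * \<kappa>\<^sup>2) * (s * (2 * \<kappa>))) (at \<kappa> within {0..1})"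
    proof (rule DERIV_image_chain[where f = V and g = "\<lambda>\<kappa>. s * \<kappa>\<^sup>2", unfolded o_def])
      show "(V has_real_derivative volterra V (s * \<kappa>\<^sup>2)) (at (s * \<kappa>\<^sup>2) within (\<lambda>\<kappa>. s * \<kappa>\<^sup>2) ` {0..1})"
        by (rule DERIV_subset[OF V_derivative]) (use s in \<open>auto intro!: mult_nonneg_nonneg\<close>)
    qed (auto intro!: derivative_eq_intros)
    have HV: "(?HV has_real_derivative H' (V (s * \<kappa>\<^sup>2)) * (volterra V (s * \<kappa>\<^sup>2) * (s * (2 * \<kappa>)))) (at \<kappa> within {0..1})"
      by (rule DERIV_chain2[OF Hd V1])
    have kN: "\<kappa> ^ N = \<kappa> * \<kappa> ^ (N - 1)" using N by (cases N) auto
    have "((\<lambda>\<kappa>. \<kappa> ^ N * exp (- s * (1 - \<kappa>\<^sup>2) / 4)) has_real_derivative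
        real N * \<kappa> ^ (N - 1) * exp (- s * (1 - \<kappa>\<^sup>2) / 4) + \<kappa> ^ N * (exp (- s * (1 - \<kappa>\<^sup>2) / 4) * (s * \<kappa> / 2))) (at \<kappa> within {0..1})"
    proof -
      have "((\<lambda>\<kappa>. exp (- s * (1 - \<kappa>\<^sup>2) / 4)) has_real_derivative exp (- s * (1 - \<kappa>\<^sup>2) / 4) * (s * \<kappa> / 2)) (at \<kappa> within {0..1})"
        by (rule derivative_eq_intros refl | simp)+
      from DERIV_mult[OF DERIV_pow[of N] this] show ?thesis by (simp add: algebra_simps)
    qed
    from DERIV_mult[OF this HV]
    have "((\<lambda>\<kappa>. \<kappa> ^ N * exp (- s * (1 - \<kappa>\<^sup>2) / 4) * ?HV \<kappa>) has_real_derivative ?G' \<kappa>) (at \<kappa> within {0..1})"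
      by (rule back_subst[where P = "\<lambda>D. (_ has_real_derivative D) _"])
         (simp add: ker_def kN power2_eq_square algebra_simps)
    then show "((\<lambda>\<kappa>. \<kappa> ^ N * exp (- s * (1 - \<kappa>\<^sup>2) / 4) * ?HV \<kappa>) has_vector_derivative ?G' \<kappa>) (at \<kappa> within {0..1})"
      by (simp add: has_real_derivative_iff_has_vector_derivative)
  qed simp
  then have "(?G' has_integral H (V s)) {0..1}" using N by (simp add: zero_power)
  then have G: "integral {0..1} ?G' = H (V s)" by (rule integral_unique)
  have i1: "(\<lambda>\<kappa>. ker s \<kappa> * ?HV \<kappa>) integrable_on {0..1}" by (rule integrable_integrand[OF cont_V s])
  have i2: "(\<lambda>\<kappa>. ker s \<kappa> * (- ((1 - \<kappa>\<^sup>2) / 4) * ?HV \<kappa> + H' (V (s * \<kappa>\<^sup>2)) * (volterra V (s * \<kappa>\<^sup>2) * \<kappa>\<^sup>2))) integrable_on {0..1}"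
  proof (rule integrable_continuous_interval)
    have "continuous_on {0..1} (\<lambda>\<kappa>. (case (s, \<kappa>) of (s, \<kappa>) \<Rightarrow> ker s \<kappa> *
     (- ((1 - \<kappa>\<^sup>2) / 4) * H (V (s * \<kappa>\<^sup>2)) + H' (V (s * \<kappa>\<^sup>2)) * (volterra V (s * \<kappa>\<^sup>2) * \<kappa>\<^sup>2))))"
      by (rule continuous_on_compose2[OF cont_volterra_deriv_integrand]) (use s in \<open>auto intro!: continuous_intros\<close>)
    then show "continuous_on {0..1} (\<lambda>\<kappa>. ker s \<kappa> * (- ((1 - \<kappa>\<^sup>2) / 4) * ?HV \<kappa> + H' (V (s * \<kappa>\<^sup>2)) * (volterra V (s * \<kappa>\<^sup>2) * \<kappa>\<^sup>2)))"
      by simp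
  qed
  have "4 * s * volterra_deriv s + (2 * real N + s) * volterra V s = - (1/2) *
     (4 * s * integral {0..1} (\<lambda>\<kappa>. ker s \<kappa> * (- ((1 - \<kappa>\<^sup>2) / 4) * ?HV \<kappa> + H' (V (s * \<kappa>\<^sup>2)) * (volterra V (s * \<kappa>\<^sup>2) * \<kappa>\<^sup>2)))
      + (2 * real N + s) * integral {0..1} (\<lambda>\<kappa>. ker s \<kappa> * ?HV \<kappa>))"
    by (simp add: volterra_deriv_def volterra_def algebra_simps)
  also have "4 * s * integral {0..1} (\<lambda>\<kappa>. ker s \<kappa> * (- ((1 - \<kappa>\<^sup>2) / 4) * ?HV \<kappa> + H' (V (s * \<kappa>\<^sup>2)) * (volterra V (s * \<kappa>\<^sup>2) * \<kappa>\<^sup>2)))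
      + (2 * real N + s) * integral {0..1} (\<lambda>\<kappa>. ker s \<kappa> * ?HV \<kappa>) =
      integral {0..1} (\<lambda>\<kappa>. 4 * s * (ker s \<kappa> * (- ((1 - \<kappa>\<^sup>2) / 4) * ?HV \<kappa> + H' (V (s * \<kappa>\<^sup>2)) * (volterra V (s * \<kappa>\<^sup>2) * \<kappa>\<^sup>2)))
        + (2 * real N + s) * (ker s \<kappa> * ?HV \<kappa>))"
    by (rule integral_unique[OF has_integral_add[OF has_integral_mult_right[OF integrable_integral[OF i2]]
          has_integral_mult_right[OF integrable_integral[OF i1]]], symmetric])
  also have "\<dots> = integral {0..1} (\<lambda>\<kappa>. 2 * ?G' \<kappa>)"
    by (rule integral_cong) (simp add: field_simps power2_eq_square)
  also have "\<dots> = 2 * H (V s)" by (simp only: integral_mult_right G)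
  finally show ?thesis by simp
qed

end

text \<open>The profile equation for \<open>W\<close> under the substitution \<open>F (W y) = P (\<bar>y\<bar>\<^sup>2)\<close>, in which the nonlinearity
  disappears.\<close>

definition profile_ode :: "nat \<Rightarrow> real \<Rightarrow> (real \<Rightarrow> real) \<Rightarrow> (real \<Rightarrow> real) \<Rightarrow> (real \<Rightarrow> real) \<Rightarrow> bool" where
  "profile_ode N q P P1 P2 \<longleftrightarrow>
     (\<forall>s\<ge>0. (P has_real_derivative P1 s) (at s within {0..})) \<and>
     (\<forall>s\<ge>0. (P1 has_real_derivative P2 s) (at s within {0..})) \<and>
     continuous_on {0..} P2 \<and> (\<forall>s\<ge>0. 0 < P s) \<and>
     (\<forall>s\<ge>0. 4 * s * P2 s + (2 * real N + s) * P1 s - P s - 1 - 4 * q * s * (P1 s)\<^sup>2 / P s = 0)"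

text \<open>For y = P'/P the equation is of Riccati type, and the quadratic term carries the factor
  q - 1, so it has a sign.\<close>

lemma profile_log_derivative_ode:
  assumes ode: "profile_ode N q P P1 P2" and s: "0 \<le> s"
  defines "y \<equiv> \<lambda>s. P1 s / P s" and "y' \<equiv> \<lambda>s. P2 s / P s - (P1 s / P s)\<^sup>2"
  shows "(y has_real_derivative y' s) (at s within {0..})"
    and "4 * s * y' s = 4 * s * (q - 1) * (y s)\<^sup>2 - (2 * real N + s) * y s + 1 + 1 / P s"
proof -
  note o = ode[unfolded profile_ode_def]
  have p: "P s > 0" using o s by blast
  have "((\<lambda>s. P1 s / P s) has_real_derivative (P2 s * P s - P1 s * P1 s) / (P s * P s)) (at s within {0..})"
    by (rule DERIV_divide) (use o s p in auto)
  then show "(y has_real_derivative y' s) (at s within {0..})"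
    unfolding y_def y'_def using p by (simp add: diff_divide_distrib power2_eq_square)
  have "4 * s * P2 s = - (2 * real N + s) * P1 s + P s + 1 + 4 * q * s * (P1 s)\<^sup>2 / P s"
    using o s by (simp add: algebra_simps)
  then have "4 * s * P2 s / P s = (- (2 * real N + s) * P1 s + P s + 1 + 4 * q * s * (P1 s)\<^sup>2 / P s) / P s" by simp
  also have "\<dots> = - (2 * real N + s) * y s + 1 + 1 / P s + 4 * q * s * (y s)\<^sup>2"
    using p by (simp add: y_def add_divide_distrib diff_divide_distrib power_divide power2_eq_square)
  finally have "4 * s * P2 s / P s = - (2 * real N + s) * y s + 1 + 1 / P s + 4 * q * s * (y s)\<^sup>2" .
  moreover have "4 * s * y' s = 4 * s * P2 s / P s - 4 * s * (y s)\<^sup>2"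
    by (simp add: y'_def y_def right_diff_distrib)
  moreover have "4 * s * (q - 1) * (y s)\<^sup>2 = 4 * q * s * (y s)\<^sup>2 - 4 * s * (y s)\<^sup>2"
    by (simp add: left_diff_distrib right_diff_distrib)
  moreover have "- (2 * real N + s) * y s = - ((2 * real N + s) * y s)" by (rule mult_minus_left)
  ultimately show "4 * s * y' s = 4 * s * (q - 1) * (y s)\<^sup>2 - (2 * real N + s) * y s + 1 + 1 / P s"
    by linarith
qed

text \<open>1 / (2 N + s) is the logarithmic derivative of 2 N + s. Subtracted from P'/P it leaves
  only nonnegative source terms for q >= 1, so \<open>degenerate_minimum_principle\<close> applies
  and P / (2 N + s) is nondecreasing.\<close>

lemma profile_linear_lower_bound:
  assumes ode: "profile_ode N q P P1 P2" and q: "1 \<le> q" and N: "1 \<le> N" and s: "0 \<le> s"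
  shows "P 0 * (1 + s / (2 * real N)) \<le> P s"
proof -
  note o = ode[unfolded profile_ode_def]
  let ?c = "2 * real N"
  have c: "?c > 0" using N by simp
  have y: "0 \<le> P1 s / P s - 1 / (?c + s)" if s: "0 \<le> s" for s
  proof (rule degenerate_minimum_principle[where S = s and s = s and c = ?c and D = "\<lambda>s. P1 s / P s - 1 / (?c + s)" and
        D' = "\<lambda>s. (P2 s / P s - (P1 s / P s)\<^sup>2) + 1 / (?c + s)\<^sup>2"])
    fix r assume r: "0 \<le> r" "r \<le> s"
    have cr: "?c + r > 0" using c r by simp
    have "((\<lambda>r. 1 / (?c + r)) has_real_derivative - (1 / (?c + r)\<^sup>2)) (at r within {0..})"
      using cr by (auto intro!: derivative_eq_intros simp: power2_eq_square)
    from DERIV_diff[OF profile_log_derivative_ode(1)[OF ode r(1)] this]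
    show "((\<lambda>s. P1 s / P s - 1 / (?c + s)) has_real_derivative (P2 r / P r - (P1 r / P r)\<^sup>2) + 1 / (?c + r)\<^sup>2) (at r within {0..})"
      by simp
    have p: "P r > 0" using o r by blast
    have "4 * r * ((P2 r / P r - (P1 r / P r)\<^sup>2) + 1 / (?c + r)\<^sup>2) + (?c + r) * (P1 r / P r - 1 / (?c + r))
       = 4 * r * (P2 r / P r - (P1 r / P r)\<^sup>2) + 4 * r / (?c + r)\<^sup>2 + (?c + r) * (P1 r / P r) - 1"
      using cr by (simp add: algebra_simps)
    also have "\<dots> = 4 * r * (q - 1) * (P1 r / P r)\<^sup>2 + 1 / P r + 4 * r / (?c + r)\<^sup>2"
      unfolding profile_log_derivative_ode(2)[OF ode r(1)] by simp
    also have "\<dots> \<ge> 0" using q r p by (intro add_nonneg_nonneg) auto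
    finally show "0 \<le> 4 * r * ((P2 r / P r - (P1 r / P r)\<^sup>2) + 1 / (?c + r)\<^sup>2) + (?c + r) * (P1 r / P r - 1 / (?c + r))" .
  qed (use c s in auto)
  have "P 0 / (?c + 0) \<le> P s / (?c + s)"
  proof (rule nondecreasing_from_derivative[where a = 0 and b = s and f = "\<lambda>r. P r / (?c + r)" and
        f' = "\<lambda>r. (P1 r * (?c + r) - P r) / (?c + r)\<^sup>2"])
    fix r assume r: "0 \<le> r" "r \<le> s"
    have cr: "?c + r > 0" using c r by simp
    show "((\<lambda>r. P r / (?c + r)) has_real_derivative (P1 r * (?c + r) - P r) / (?c + r)\<^sup>2) (at r within {0..})"
      using cr o r by (auto intro!: derivative_eq_intros simp: power2_eq_square)
  next
    fix r assume r: "0 < r" "r < s"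
    have cr: "?c + r > 0" and p: "P r > 0" using c r o by auto
    have "1 / (?c + r) \<le> P1 r / P r" using y[of r] r by simp
    then have "P r \<le> P1 r * (?c + r)" using cr p by (simp add: field_simps)
    then show "0 \<le> (P1 r * (?c + r) - P r) / (?c + r)\<^sup>2" by simp
  qed (use s in auto)
  then have "P 0 / ?c * (?c + s) \<le> P s" using c s by (simp add: field_simps)
  moreover have "P 0 / ?c * (?c + s) = P 0 * (1 + s / ?c)" using c by (simp add: field_simps)
  ultimately show ?thesis by simp
qed

lemma log_derivative_slope_bound:
  assumes der: "\<And>s. 0 \<le> s \<Longrightarrow> (P has_real_derivative P1 s) (at s within {0..})"
    and k: "\<And>s. 0 \<le> s \<Longrightarrow> P1 s \<le> k * P s" and s: "0 \<le> s"
  shows "P s \<le> P 0 * exp (k * s)"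
proof -
  have "- (P 0 * exp (- k * 0)) \<le> - (P s * exp (- k * s))"
  proof (rule nondecreasing_from_derivative[where a = 0 and b = s and f = "\<lambda>r. - (P r * exp (- k * r))" and
        f' = "\<lambda>r. (k * P r - P1 r) * exp (- k * r)"])
    show "((\<lambda>r. - (P r * exp (- k * r))) has_real_derivative (k * P r - P1 r) * exp (- k * r)) (at r within {0..})"
      if "0 \<le> r" for r
      using der[OF that] by (auto intro!: derivative_eq_intros simp: algebra_simps)
  qed (use k s in auto)
  then have "P s * exp (- k * s) \<le> P 0" by simp
  then have "P s * exp (- k * s) * exp (k * s) \<le> P 0 * exp (k * s)" by (rule mult_right_mono) simp
  then show ?thesis by (simp add: mult.assoc flip: exp_add)
qed

text \<open>With \<open>y = P'/P\<close>, the a priori bound \<open>4 (q - 1) y \<le> 4 (q - 1) k < 1\<close> makes the equation for \<open>s y - 1\<close>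
  dissipative where \<open>s y > 1\<close>, so that \<open>s y - 1 \<le> C / s\<close> and \<open>ln P - ln s\<close> stays bounded.\<close>

lemma profile_linear_upper_bound:
  fixes q k :: real and N :: nat
  assumes q: "1 < q" "q < 1 + real N / 2" and k: "0 < k" "4 * (q - 1) * k < 1" and N: "1 \<le> N"
  shows "\<exists>C>0. \<forall>P P1 P2. profile_ode N q P P1 P2 \<longrightarrow> 1 \<le> P 0 \<longrightarrow> (\<forall>s\<ge>0. P1 s \<le> k * P s) \<longrightarrow>
           (\<forall>s\<ge>0. P s \<le> C * P 0 * (1 + s))"
proof -
  define \<beta> where "\<beta> = q - 1"
  have \<beta>: "\<beta> > 0" "2 * \<beta> < real N" using q by (auto simp: \<beta>_def)
  define \<eta> where "\<eta> = 1 - 4 * \<beta> * k"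
  have \<eta>: "\<eta> > 0" "4 * \<beta> * k = 1 - \<eta>" using k by (auto simp: \<eta>_def \<beta>_def)
  \<comment> \<open>For r > S this gives 8 / r <= \<eta> / 2. The 8 collects 4 d / r from the
    derivative of C / r and 4 d / r from 4 y, when r y = 1 + d.\<close>
  define S where "S = 16 / \<eta>"
  have S: "S > 0" using \<eta> by (simp add: S_def)
  \<comment> \<open>The term S^2 k makes the barrier function positive at S, where only y <= k is
    known; the first term beats the remainders (4 + 2 N) / r at a zero.\<close>
  define C where "C = 2 * (4 + 2 * real N) / \<eta> + S\<^sup>2 * k + 1"
  have "0 < 2 * (4 + 2 * real N) / \<eta>" using \<eta> by (intro divide_pos_pos) auto
  moreover have "0 < S\<^sup>2 * k" using S k by simp
  ultimately have C: "C > 0" "C > S\<^sup>2 * k" "C > 2 * (4 + 2 * real N) / \<eta>" by (auto simp: C_def)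
  then have C\<eta>: "\<eta> * C > 2 * (4 + 2 * real N)" using \<eta> by (simp add: field_simps)
  \<comment> \<open>exp (k S) serves on [0, S] through the exponential bound; beyond S the monotone
    quantity (P / r) exp (C / r) carries the value from S onwards.\<close>
  define Cc where "Cc = exp (k * S) * (1 + exp (C / S) / S)"
  have Cc: "Cc \<ge> exp (k * S)" "Cc > 0" "Cc \<ge> exp (k * S) * exp (C / S) / S"
  proof -
    have "exp (C / S) / S > 0" using S by simp
    then have "exp (k * S) * 1 \<le> exp (k * S) * (1 + exp (C / S) / S)" by (intro mult_left_mono) auto
    then show "Cc \<ge> exp (k * S)" by (simp add: Cc_def)
    then show "Cc > 0" by (rule less_le_trans[rotated]) simp
    show "Cc \<ge> exp (k * S) * exp (C / S) / S" by (simp add: Cc_def distrib_left)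
  qed
  have "P s \<le> Cc * P 0 * (1 + s)"
    if ode: "profile_ode N q P P1 P2" and P0: "1 \<le> P 0" and slope: "\<forall>s\<ge>0. P1 s \<le> k * P s" and s: "0 \<le> s"
    for P P1 P2 s
  proof -
    note o = ode[unfolded profile_ode_def]
    define y where "y r = P1 r / P r" for r
    define y' where "y' r = P2 r / P r - (P1 r / P r)\<^sup>2" for r
    have yder: "(y has_real_derivative y' r) (at r within {0..})" if "0 \<le> r" for r
      using profile_log_derivative_ode(1)[OF ode that] unfolding y_def[abs_def] y'_def[abs_def] .
    have yode: "4 * r * y' r = 4 * r * \<beta> * (y r)\<^sup>2 - (2 * real N + r) * y r + 1 + 1 / P r" if "0 \<le> r" for r
      using profile_log_derivative_ode(2)[OF ode that] unfolding y_def y'_def \<beta>_def .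
    have Ppos: "P r > 0" if "0 \<le> r" for r using o that by blast
    have yk: "y r \<le> k" if "0 \<le> r" for r using slope Ppos[OF that] that by (simp add: y_def field_simps)
    have P_exp: "P r \<le> P 0 * exp (k * r)" if "0 \<le> r" for r
      by (rule log_derivative_slope_bound[where ?P1.0 = P1]) (use o slope that in auto)
    have J: "0 < C / r - r * y r + 1" if r: "S \<le> r" for r
    proof (rule positive_until_first_zero[where a = S and s = r and J = "\<lambda>r. C / r - r * y r + 1" and J' = "\<lambda>r. - (C / r\<^sup>2) - (y r + r * y' r)"])
      fix r assume "S \<le> r"
      then have r: "r > 0" using S by simp
      have 1: "((\<lambda>r. C / r) has_real_derivative - (C / r\<^sup>2)) (at r within {0..})"
        using r by (auto intro!: derivative_eq_intros simp: power2_eq_square)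
      have 2: "((\<lambda>r. r * y r) has_real_derivative y r + r * y' r) (at r within {0..})"
        using DERIV_mult[OF DERIV_ident yder, of r] r by (simp add: mult.commute)
      show "((\<lambda>r. C / r - r * y r + 1) has_real_derivative - (C / r\<^sup>2) - (y r + r * y' r)) (at r within {0..})"
        using DERIV_add[OF DERIV_diff[OF 1 2] DERIV_const] by simp
    next
      have "S * y S \<le> S * k" using yk[of S] S by (intro mult_left_mono) auto
      moreover have "S * k < C / S" using C(2) S by (simp add: field_simps power2_eq_square)
      ultimately show "0 < C / S - S * y S + 1" by simp
    next
      fix r assume Sr: "S < r" and zero: "C / r - r * y r + 1 = 0"
      have r: "r > 0" using S Sr by simp
      define d where "d = C / r"
      have d: "d > 0" using C r by (simp add: d_def)
      have ry: "r * y r = 1 + d" using zero by (simp add: d_def)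
      then have yr: "y r = (1 + d) / r" using r by (simp add: field_simps)
      have ypos: "y r > 0" using d r by (simp add: yr)
      have Pr: "1 / P r \<le> 2 * real N / r"
      proof -
        have "r / (2 * real N) \<le> 1 * (1 + r / (2 * real N))" by simp
        also have "\<dots> \<le> P 0 * (1 + r / (2 * real N))" using P0 r N by (intro mult_right_mono) auto
        also have "\<dots> \<le> P r" using profile_linear_lower_bound[OF ode _ N, of r] q r by simp
        finally have "r / (2 * real N) \<le> P r" .
        moreover have "r / (2 * real N) > 0" using r N by simp
        ultimately have "1 / P r \<le> 1 / (r / (2 * real N))" by (intro divide_left_mono mult_pos_pos) auto
        then show ?thesis by simp
      qed
      have e1: "4 * r * y' r = 4 * \<beta> * y r * (1 + d) - 2 * real N * y r - (1 + d) + 1 + 1 / P r"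
      proof -
        have "4 * r * \<beta> * (y r)\<^sup>2 = 4 * \<beta> * y r * (r * y r)" by (simp add: power2_eq_square)
        moreover have "(2 * real N + r) * y r = 2 * real N * y r + r * y r" by (simp add: algebra_simps)
        ultimately show ?thesis unfolding yode[OF less_imp_le[OF r]] ry by simp
      qed
      have e2: "4 * \<beta> * y r * d \<le> (1 - \<eta>) * d"
      proof -
        have "4 * \<beta> * y r \<le> 4 * \<beta> * k" using \<beta> yk[of r] r by (intro mult_left_mono) auto
        then show ?thesis using \<eta> d by (intro mult_right_mono) auto
      qed
      \<comment> \<open>Here 2 (q - 1) < N enters, that is q < 1 + N/2.\<close>
      have e3: "4 * \<beta> * y r - 2 * real N * y r \<le> 0"
        using \<beta> ypos by (simp add: mult_right_mono)
      have e4: "4 * r * y' r \<le> - (\<eta> * d) + 1 / P r"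
        using e1 e2 e3 by (simp add: algebra_simps)
      have e5: "8 / r \<le> \<eta> / 2" using Sr S \<eta> r by (simp add: S_def field_simps)
      have e6: "4 * d / r + 4 * y r = 8 / r * d + 4 / r" by (simp add: yr add_divide_distrib distrib_left)
      have e7: "8 / r * d \<le> \<eta> / 2 * d" using e5 d by (intro mult_right_mono) auto
      have "\<eta> / 2 * d - (4 + 2 * real N) / r = (\<eta> * C / 2 - (4 + 2 * real N)) / r"
        by (simp add: d_def diff_divide_distrib)
      also have "\<dots> > 0" using C\<eta> r by (intro divide_pos_pos) auto
      finally have e8: "\<eta> / 2 * d - (4 + 2 * real N) / r > 0" .
      have "4 * (- (C / r\<^sup>2) - (y r + r * y' r)) = - (4 * d / r + 4 * y r) - 4 * r * y' r"
        by (simp add: d_def power2_eq_square)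
      also have "\<dots> \<ge> - (\<eta> / 2 * d + 4 / r) + \<eta> * d - 2 * real N / r"
        using e4 e6 e7 Pr by linarith
      finally have "4 * (- (C / r\<^sup>2) - (y r + r * y' r)) \<ge> \<eta> / 2 * d - (4 + 2 * real N) / r"
        by (simp add: add_divide_distrib)
      from less_le_trans[OF e8 this] show "0 < - (C / r\<^sup>2) - (y r + r * y' r)"
        unfolding zero_less_mult_iff by simp
    qed (use S r in auto)
    show ?thesis
    proof (cases "s \<le> S")
      case True
      have "exp (k * s) \<le> exp (k * S)" using True k by simp
      then have "P s \<le> P 0 * exp (k * S)"
        using P_exp[OF s] P0 by (meson mult_left_mono order_trans zero_le_one)
      also have "\<dots> \<le> P 0 * Cc" using Cc P0 by (intro mult_left_mono) auto
      also have "\<dots> \<le> P 0 * Cc * (1 + s)" using Cc P0 s by (simp add: distrib_left)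
      finally show ?thesis by (simp add: mult_ac)
    next
      case False
      then have Ss: "S \<le> s" by simp
      \<comment> \<open>\<open>J\<close> says P'/P <= 1 / r + C / r^2, so (P / r) exp (C / r) is
        nonincreasing.\<close>
      have G: "- (P S / S * exp (C / S)) \<le> - (P s / s * exp (C / s))"
      proof (rule nondecreasing_from_derivative[where a = S and b = s and f = "\<lambda>r. - (P r / r * exp (C / r))" and f' = "\<lambda>r. (P r / r\<^sup>2 + P r * C / r ^ 3 - P1 r / r) * exp (C / r)"])
        fix r assume "S \<le> r" "r \<le> s"
        then have r: "r > 0" using S by simp
        have 1: "((\<lambda>r. exp (C / r)) has_real_derivative exp (C / r) * - (C / r\<^sup>2)) (at r within {0..})"
          using r by (auto intro!: derivative_eq_intros simp: power2_eq_square)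
        have 2: "((\<lambda>r. P r / r) has_real_derivative (P1 r * r - P r) / (r * r)) (at r within {0..})"
          using DERIV_divide[of P "P1 r" r "{0..}" "\<lambda>r. r" 1] o r by simp
        have eq: "- ((P1 r * r - P r) / (r * r) * exp (C / r) + exp (C / r) * - (C / r\<^sup>2) * (P r / r)) =
            (P r / r\<^sup>2 + P r * C / r ^ 3 - P1 r / r) * exp (C / r)"
          using r by (simp add: field_simps power2_eq_square power3_eq_cube)
        show "((\<lambda>r. - (P r / r * exp (C / r))) has_real_derivative
            (P r / r\<^sup>2 + P r * C / r ^ 3 - P1 r / r) * exp (C / r)) (at r within {0..})"
          using DERIV_minus[OF DERIV_mult[OF 2 1]] unfolding eq .
      next
        fix r assume Sr: "S < r" "r < s"
        then have r: "r > 0" using S by simp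
        have p: "P r > 0" using Ppos r by simp
        have "r * y r * P r \<le> (1 + C / r) * P r" using J[of r] Sr p by (intro mult_right_mono) auto
        then have "r * P1 r \<le> P r + P r * C / r" using p by (simp add: y_def algebra_simps)
        then have "(r * P1 r) / r\<^sup>2 \<le> (P r + P r * C / r) / r\<^sup>2" by (rule divide_right_mono) simp
        then have "0 \<le> P r / r\<^sup>2 + P r * C / r ^ 3 - P1 r / r"
          using r by (simp add: add_divide_distrib power2_eq_square power3_eq_cube)
        then show "0 \<le> (P r / r\<^sup>2 + P r * C / r ^ 3 - P1 r / r) * exp (C / r)" by simp
      qed (use S Ss in auto)
      have sp: "s > 0" using S Ss by simp
      have "P s * 1 \<le> P s * exp (C / s)" using Ppos[OF s] C sp by (intro mult_left_mono) auto
      also have "\<dots> = s * (P s / s * exp (C / s))" using sp by simp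
      also have "\<dots> \<le> s * (P S / S * exp (C / S))" using G sp by (intro mult_left_mono) auto
      also have "\<dots> \<le> s * ((P 0 * exp (k * S)) / S * exp (C / S))"
        using P_exp[of S] S sp by (intro mult_left_mono mult_right_mono divide_right_mono) auto
      also have "\<dots> = (s * P 0) * (exp (k * S) * exp (C / S) / S)" by simp
      also have "\<dots> \<le> (s * P 0) * Cc" using Cc(3) sp P0 by (intro mult_left_mono) auto
      also have "\<dots> \<le> Cc * P 0 * (1 + s)" using Cc(2) P0 by (simp add: algebra_simps)
      finally show ?thesis by simp
    qed
  qed
  then show ?thesis using Cc(2) by blast
qed

text \<open>For \<open>q = 1\<close> the substitution \<open>P = exp (- V)\<close> makes the equation semilinear.\<close>

lemma profile_exists_exponential:
  fixes A :: real and N :: nat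
  assumes A: "0 < A" and N: "1 \<le> N"
  shows "\<exists>P P1 P2. profile_ode N 1 P P1 P2 \<and> P 0 = A"
proof -
  define v0 where "v0 = - ln A"
  \<comment> \<open>H continues 1 + exp v affinely above v0, which makes it globally Lipschitz. V
    starts at v0 and decreases, so it only sees the true nonlinearity.\<close>
  have cH': "continuous_on UNIV (\<lambda>v. exp (min v v0))" by (intro continuous_intros)
  obtain H where H: "H v0 = 1 + exp v0" "\<And>v. (H has_real_derivative exp (min v v0)) (at v)"
    using antiderivative_exists[OF cH', of v0 "1 + exp v0"] by blast
  have Hlow: "H v = 1 + exp v" if "v \<le> v0" for v
  proof (cases "v = v0")
    case False
    have "((\<lambda>v. H v - exp v) has_real_derivative 0) (at r)" if "r < v0" for r
      using DERIV_diff[OF H(2)[of r] DERIV_exp[of r]] that by simp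
    moreover have "continuous_on {v..v0} (\<lambda>v. H v - exp v)"
      by (intro continuous_intros, rule DERIV_continuous_on, rule has_field_derivative_at_within, rule H(2))
    ultimately have "H v0 - exp v0 = H v - exp v"
      by (intro DERIV_isconst2[of v v0 "\<lambda>v. H v - exp v"]) (use that False in auto)
    then show ?thesis using H(1) by simp
  qed (use H in simp)
  have Hpos: "0 \<le> H v" for v
  proof (cases "v \<le> v0")
    case True then show ?thesis using Hlow by (simp add: add_nonneg_nonneg)
  next
    case False
    then have "H v0 \<le> H v" by (intro DERIV_nonneg_imp_nondecreasing[of v0 v H]) (auto intro!: exI[of _ "exp (min _ v0)"] H(2))
    then show ?thesis using H(1) by (smt (verit) exp_ge_zero)
  qed
  interpret singular_ode H "\<lambda>v. exp (min v v0)" "exp v0" v0 N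
    by standard (use H cH' N in auto)
  have V1: "volterra V s \<le> 0" if "0 \<le> s" for s
  proof -
    have "0 \<le> - volterra V s"
    proof (rule degenerate_minimum_principle[where S = s and s = s and D = "\<lambda>s. - volterra V s" and c = "2 * real N" and D' = "\<lambda>s. - volterra_deriv s"])
      show "0 \<le> 4 * r * - volterra_deriv r + (2 * real N + r) * - volterra V r" if "0 \<le> r" for r
        using volterra_ode[OF that] Hpos[of "V r"] by simp
    qed (use that N in \<open>auto intro!: DERIV_minus volterra_derivative\<close>)
    then show ?thesis by simp
  qed
  have Vle: "V s \<le> v0" if "0 \<le> s" for s
  proof -
    have "- V 0 \<le> - V s"
      by (rule nondecreasing_from_derivative[where a = 0 and b = s and f = "\<lambda>s. - V s" and f' = "\<lambda>s. - volterra V s"])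
         (use that V1 in \<open>auto intro!: DERIV_minus V_derivative\<close>)
    then show ?thesis by (simp add: V_initial)
  qed
  define P where "P s = exp (- V s)" for s
  define P1 where "P1 s = - (volterra V s * exp (- V s))" for s
  define P2 where "P2 s = ((volterra V s)\<^sup>2 - volterra_deriv s) * exp (- V s)" for s
  have d1: "(P has_real_derivative P1 s) (at s within {0..})" if "0 \<le> s" for s
    unfolding P_def[abs_def] P1_def using V_derivative[OF that] by (auto intro!: derivative_eq_intros)
  have d2: "(P1 has_real_derivative P2 s) (at s within {0..})" if "0 \<le> s" for s
    unfolding P1_def[abs_def] P2_def using V_derivative[OF that] volterra_derivative[OF that]
    by (auto intro!: derivative_eq_intros simp: power2_eq_square algebra_simps)
  have "continuous_on {0..} P2"
    unfolding P2_def by (intro continuous_intros cont_V cont_volterra cont_volterra_deriv)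
  moreover have "4 * s * P2 s + (2 * real N + s) * P1 s - P s - 1 - 4 * 1 * s * (P1 s)\<^sup>2 / P s = 0" if s: "0 \<le> s" for s
  proof -
    have e: "(P1 s)\<^sup>2 / P s = (volterra V s)\<^sup>2 * exp (- V s)"
      by (simp add: P1_def P_def power2_eq_square)
    have h: "H (V s) = 1 + exp (V s)" by (rule Hlow[OF Vle[OF s]])
    have ode: "4 * s * volterra_deriv s = - ((2 * real N + s) * volterra V s) - 1 - exp (V s)" using volterra_ode[OF s] h by linarith
    have "4 * s * P2 s = 4 * s * ((volterra V s)\<^sup>2 * exp (- V s)) - (4 * s * volterra_deriv s) * exp (- V s)"
      by (simp add: P2_def algebra_simps)
    also have "(4 * s * volterra_deriv s) * exp (- V s) = - ((2 * real N + s) * volterra V s * exp (- V s)) - exp (- V s) - 1"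
    proof -
      have ee: "exp (V s) * exp (- V s) = 1" by (simp flip: exp_add)
      show ?thesis unfolding ode left_diff_distrib ee by simp
    qed
    finally have 4: "4 * s * P2 s = 4 * s * ((volterra V s)\<^sup>2 * exp (- V s)) + (2 * real N + s) * volterra V s * exp (- V s) + exp (- V s) + 1"
      by simp
    have "4 * 1 * s * (P1 s)\<^sup>2 / P s = 4 * s * ((volterra V s)\<^sup>2 * exp (- V s))"
      using e by (simp only: times_divide_eq_right[symmetric] mult_1_right)
    then show ?thesis unfolding 4 by (simp add: P1_def P_def)
  qed
  ultimately have "profile_ode N 1 P P1 P2" unfolding profile_ode_def using d1 d2 by (simp add: P_def)
  moreover have "P 0 = A" unfolding P_def V_initial using A by (simp add: v0_def)
  ultimately show ?thesis by blast
qed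

text \<open>For \<open>q = 1 + \<beta>\<close> the substitution \<open>P = V\<^bsup>-1/\<beta>\<^esup>\<close> makes the equation semilinear. Here \<open>V\<close> stays positive
  because \<open>V' + k V\<close> cannot reach \<open>0\<close> for \<open>\<beta> / (2 N) < k < 1/4\<close>; such \<open>k\<close> exist exactly if \<open>q < 1 + N/2\<close>.\<close>

lemma profile_exists_power:
  fixes q :: real and N :: nat
  assumes q: "1 < q" "q < 1 + real N / 2" and N: "1 \<le> N"
  shows "\<exists>k A0. 0 < k \<and> 4 * (q - 1) * k < 1 \<and> 0 < A0 \<and> (\<forall>A\<ge>A0. \<exists>P P1 P2.
     profile_ode N q P P1 P2 \<and> P 0 = A \<and> (\<forall>s\<ge>0. P1 s \<le> k * P s))"
proof -
  define \<beta> where "\<beta> = q - 1"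
  define \<alpha> where "\<alpha> = 1 / \<beta>"
  have \<beta>: "\<beta> > 0" "2 * \<beta> < real N" using q by (auto simp: \<beta>_def)
  have \<alpha>: "\<alpha> > 0" "\<alpha> * \<beta> = 1" using \<beta> by (auto simp: \<alpha>_def)
  define X where "X = \<beta> / (2 * real N)"
  define k where "k = (X + 1 / 4) / 2"
  have X: "X < 1 / 4" "X > 0" using \<beta> N by (auto simp: X_def field_simps)
  have k: "k < 1 / 4" "X < k" "k > 0" using X by (auto simp: k_def)
  have kN: "\<beta> < 2 * real N * k" using k(2) N by (simp add: X_def field_simps)
  \<comment> \<open>From this height on, \<beta> (1 + 1 / A) < 2 N k, which is V' + k V > 0 at s =
    0.\<close>
  define A0 where "A0 = \<beta> / (2 * real N * k - \<beta>) + 1"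
  have A0: "A0 > 0" "A0 > \<beta> / (2 * real N * k - \<beta>)" using \<beta> kN by (auto simp: A0_def intro!: add_pos_pos divide_pos_pos)
  have ex: "\<exists>P P1 P2. profile_ode N q P P1 P2 \<and> P 0 = A \<and> (\<forall>s\<ge>0. P1 s \<le> (\<alpha> * k) * P s)" if AA: "A0 \<le> A" for A
  proof -
    have A: "A > 0" using A0 AA by simp
    have Ak: "\<beta> * (1 + 1 / A) < 2 * real N * k"
    proof -
      have "\<beta> / (2 * real N * k - \<beta>) < A" using A0 AA by simp
      then have "\<beta> < A * (2 * real N * k - \<beta>)" using kN by (simp add: field_simps)
      then show ?thesis using A by (simp add: field_simps)
    qed
    \<comment> \<open>The initial value of V that corresponds to P 0 = A.\<close>
    define \<epsilon> where "\<epsilon> = A powr (- \<beta>)"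
    have \<epsilon>: "\<epsilon> > 0" using A by (simp add: \<epsilon>_def)
    have \<epsilon>\<alpha>: "\<epsilon> powr \<alpha> = 1 / A" "\<epsilon> powr (- \<alpha>) = A"
    proof -
      have e: "(- \<beta>) * \<alpha> = - 1" "(- \<beta>) * (- \<alpha>) = 1" using \<alpha> by (simp_all add: mult.commute)
      show "\<epsilon> powr \<alpha> = 1 / A" "\<epsilon> powr (- \<alpha>) = A"
        unfolding \<epsilon>_def powr_powr e using A by (simp_all add: powr_minus_divide)
    qed
    \<comment> \<open>The derivative of \<beta> (v + v^(1 + \<alpha>)), frozen outside
      [0, \<epsilon>] to be globally bounded; V turns out to stay in this interval.\<close>
    define H' where "H' v = \<beta> * (1 + (1 + \<alpha>) * (max 0 (min v \<epsilon>)) powr \<alpha>)" for v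
    have cH': "continuous_on UNIV H'"
      unfolding H'_def using \<alpha> by (intro continuous_intros continuous_on_powr') auto
    have H'0: "0 \<le> H' v" for v unfolding H'_def using \<alpha> \<beta> by (intro mult_nonneg_nonneg add_nonneg_nonneg) auto
    have H'K: "\<bar>H' v\<bar> \<le> \<beta> * (1 + (1 + \<alpha>) * \<epsilon> powr \<alpha>)" for v
    proof -
      have "(max 0 (min v \<epsilon>)) powr \<alpha> \<le> \<epsilon> powr \<alpha>" using \<epsilon> \<alpha> by (intro powr_mono2) auto
      then show ?thesis using H'0[of v] \<alpha> \<beta> unfolding H'_def by (simp add: mult_left_mono)
    qed
    have Kpos: "\<beta> * (1 + (1 + \<alpha>) * \<epsilon> powr \<alpha>) > 0" using \<alpha> \<beta> by (intro mult_pos_pos add_pos_nonneg) auto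
    obtain H where H: "H 0 = 0" "\<And>v. (H has_real_derivative H' v) (at v)"
      using antiderivative_exists[OF cH', of 0 0] by blast
    have cH: "continuous_on S H" for S
      by (rule DERIV_continuous_on, rule has_field_derivative_at_within, rule H(2))
    have Hmid: "H v = \<beta> * (v + v powr (1 + \<alpha>))" if v: "0 \<le> v" "v \<le> \<epsilon>" for v
    proof (cases "v = 0")
      case False
      let ?D = "\<lambda>v. H v - \<beta> * (v + v powr (1 + \<alpha>))"
      have "(?D has_real_derivative 0) (at r)" if r: "0 < r" "r < v" for r
      proof -
        have "((\<lambda>v. v powr (1 + \<alpha>)) has_real_derivative (1 + \<alpha>) * r powr \<alpha>) (at r)"
          using has_real_derivative_powr[OF r(1), of "1 + \<alpha>"] by simp
        then have "(?D has_real_derivative H' r - \<beta> * (1 + (1 + \<alpha>) * r powr \<alpha>)) (at r)"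
          using DERIV_diff[OF H(2)[of r] DERIV_cmult[OF DERIV_add[OF DERIV_ident]]] by blast
        then show ?thesis using r v by (simp add: H'_def)
      qed
      moreover have "continuous_on {0..v} ?D"
        using \<alpha> by (intro continuous_intros cH continuous_on_powr') auto
      ultimately have "?D v = ?D 0"
        by (intro DERIV_isconst2[of 0 v ?D]) (use v False in auto)
      then show ?thesis using H(1) by simp
    qed (use H in simp)
    have Hpos: "0 \<le> H v" if "0 \<le> v" for v
      using DERIV_nonneg_imp_nondecreasing[of 0 v H] that H(2) H'0 H(1) by (metis)
    interpret singular_ode H H' "\<beta> * (1 + (1 + \<alpha>) * \<epsilon> powr \<alpha>)" \<epsilon> N
      by standard (use H cH' H'K Kpos N in auto)
    \<comment> \<open>While V >= 0, the sign H >= 0 makes V decrease, so V remains below its initial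
      value \<epsilon> and the truncation is not felt.\<close>
    have decreasing: "volterra V r \<le> 0 \<and> V r \<le> \<epsilon>"
      if pos: "\<And>r. 0 \<le> r \<Longrightarrow> r \<le> s \<Longrightarrow> 0 \<le> V r" and r: "0 \<le> r" "r \<le> s" for r s
    proof -
      have V1: "volterra V r \<le> 0" if r: "0 \<le> r" "r \<le> s" for r
      proof -
        have "0 \<le> - volterra V r"
        proof (rule degenerate_minimum_principle[where S = s and s = r and D = "\<lambda>s. - volterra V s" and c = "2 * real N" and D' = "\<lambda>s. - volterra_deriv s"])
          show "0 \<le> 4 * r * - volterra_deriv r + (2 * real N + r) * - volterra V r" if "0 \<le> r" "r \<le> s" for r
            using volterra_ode[OF that(1)] Hpos[OF pos[OF that]] by simp
        qed (use r N in \<open>auto intro!: DERIV_minus volterra_derivative\<close>)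
        then show ?thesis by simp
      qed
      have "- V 0 \<le> - V r"
        by (rule nondecreasing_from_derivative[where a = 0 and b = r and f = "\<lambda>s. - V s" and f' = "\<lambda>s. - volterra V s"])
           (use r V1 in \<open>auto intro!: DERIV_minus V_derivative\<close>)
      then show ?thesis using V1 r by (simp add: V_initial)
    qed
    have J: "0 < volterra V s + k * V s" if s: "0 \<le> s" for s
    proof (rule positive_until_first_zero[where a = 0 and s = s and J = "\<lambda>s. volterra V s + k * V s" and J' = "\<lambda>s. volterra_deriv s + k * volterra V s"])
      show "((\<lambda>s. volterra V s + k * V s) has_real_derivative volterra_deriv r + k * volterra V r) (at r within {0..})" if "0 \<le> r" for r
        by (intro DERIV_add DERIV_cmult volterra_derivative V_derivative that)
    next
      have "2 * real N * volterra V 0 = - (\<beta> * (\<epsilon> + \<epsilon> powr (1 + \<alpha>)))"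
        using volterra_ode[of 0] Hmid[of \<epsilon>] \<epsilon> by (simp add: V_initial)
      also have "\<epsilon> powr (1 + \<alpha>) = \<epsilon> * (1 / A)" using \<epsilon> by (simp add: powr_add \<epsilon>\<alpha>)
      finally have "2 * real N * (volterra V 0 + k * V 0) = \<epsilon> * (2 * real N * k - \<beta> * (1 + 1 / A))"
        by (simp add: V_initial algebra_simps)
      also have "\<dots> > 0" using \<epsilon> Ak by (intro mult_pos_pos) auto
      finally show "0 < volterra V 0 + k * V 0" using N by (simp add: zero_less_mult_iff)
    next
      fix s assume s0: "0 < s" and before: "\<And>r. 0 \<le> r \<Longrightarrow> r < s \<Longrightarrow> 0 < volterra V r + k * V r"
        and zero: "volterra V s + k * V s = 0"
      have Vpos: "0 < V r" if r: "0 \<le> r" "r \<le> s" for r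
      proof -
        have "V 0 * exp (k * 0) \<le> V r * exp (k * r)"
        proof (rule nondecreasing_from_derivative[where a = 0 and b = r and f = "\<lambda>r. V r * exp (k * r)" and f' = "\<lambda>r. (volterra V r + k * V r) * exp (k * r)"])
          show "((\<lambda>r. V r * exp (k * r)) has_real_derivative (volterra V r + k * V r) * exp (k * r)) (at r within {0..})"
            if "0 \<le> r" for r
            using V_derivative[OF that] by (auto intro!: derivative_eq_intros simp: algebra_simps)
          show "0 \<le> (volterra V u + k * V u) * exp (k * u)" if "0 < u" "u < r" for u
            using that r before[of u] by (intro mult_nonneg_nonneg less_imp_le) auto
        qed (use r in auto)
        then have "0 < V r * exp (k * r)" using \<epsilon> by (simp add: V_initial)
        then show ?thesis by (simp add: zero_less_mult_iff)
      qed
      have Vs: "0 < V s" "V s \<le> \<epsilon>" using Vpos[of s] decreasing[of s s] Vpos s0 by (auto intro: less_imp_le)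
      have "(V s) powr \<alpha> \<le> 1 / A" using powr_mono2[of \<alpha> "V s" \<epsilon>] Vs \<alpha> \<epsilon>\<alpha> by simp
      then have b: "\<beta> * (1 + (V s) powr \<alpha>) \<le> \<beta> * (1 + 1 / A)" using \<beta> by (intro mult_left_mono) auto
      have h: "H (V s) = V s * (\<beta> * (1 + (V s) powr \<alpha>))"
        using Hmid[of "V s"] Vs by (simp add: powr_add algebra_simps)
      have kV: "volterra V s = - (k * V s)" using zero by simp
      \<comment> \<open>With V' = - k V both contributions have a sign: 2 N k - \<beta> (1 +
        V^\<alpha>) > 0 because V^\<alpha> <= 1 / A, and s k (1 - 4 k) > 0 because k < 1/4.\<close>
      have "4 * s * (volterra_deriv s + k * volterra V s) = - ((2 * real N + s) * volterra V s) - H (V s) + 4 * s * k * volterra V s"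
        using volterra_ode[of s] s0 by (simp add: algebra_simps)
      also have "\<dots> = V s * (2 * real N * k - \<beta> * (1 + (V s) powr \<alpha>) + s * k * (1 - 4 * k))"
        unfolding h kV by (simp add: algebra_simps)
      also have "\<dots> > 0"
        using Vs b Ak s0 k by (intro mult_pos_pos add_pos_nonneg mult_nonneg_nonneg) auto
      finally show "0 < volterra_deriv s + k * volterra V s" using s0 by (simp add: zero_less_mult_iff)
    qed (use s in auto)
    have Vpos: "0 < V s" if s: "0 \<le> s" for s
    proof -
      have "V 0 * exp (k * 0) \<le> V s * exp (k * s)"
      proof (rule nondecreasing_from_derivative[where a = 0 and b = s and f = "\<lambda>r. V r * exp (k * r)" and f' = "\<lambda>r. (volterra V r + k * V r) * exp (k * r)"])
        show "((\<lambda>r. V r * exp (k * r)) has_real_derivative (volterra V r + k * V r) * exp (k * r)) (at r within {0..})"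
          if "0 \<le> r" for r
          using V_derivative[OF that] by (auto intro!: derivative_eq_intros simp: algebra_simps)
        show "0 \<le> (volterra V u + k * V u) * exp (k * u)" if "0 < u" "u < s" for u
          using that J[of u] by (intro mult_nonneg_nonneg less_imp_le) auto
      qed (use s in auto)
      then have "0 < V s * exp (k * s)" using \<epsilon> by (simp add: V_initial)
      then show ?thesis by (simp add: zero_less_mult_iff)
    qed
    have Vle: "V s \<le> \<epsilon>" if "0 \<le> s" for s
      using decreasing[of s s] Vpos that by (auto intro: less_imp_le)
    define P where "P s = V s powr (- \<alpha>)" for s
    define P1 where "P1 s = - (\<alpha> * (P s * volterra V s / V s))" for s
    define P2 where "P2 s = - (\<alpha> * (P1 s * volterra V s / V s + P s * volterra_deriv s / V s - P s * (volterra V s)\<^sup>2 / (V s)\<^sup>2))" for s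
    have d1: "(P has_real_derivative P1 s) (at s within {0..})" if s: "0 \<le> s" for s
    proof -
      have "((\<lambda>v. v powr (- \<alpha>)) has_real_derivative (- \<alpha>) * V s powr (- \<alpha> - 1)) (at (V s))"
        using has_real_derivative_powr[OF Vpos[OF s], of "- \<alpha>"] by simp
      from DERIV_chain2[OF this V_derivative[OF s]]
      have "(P has_real_derivative ((- \<alpha>) * V s powr (- \<alpha> - 1)) * volterra V s) (at s within {0..})"
        unfolding P_def[abs_def] .
      moreover have "V s powr (- \<alpha> - 1) = P s / V s" using Vpos[OF s] by (simp add: P_def powr_diff)
      ultimately show ?thesis by (simp add: P1_def mult.assoc)
    qed
    have d2: "(P1 has_real_derivative P2 s) (at s within {0..})" if s: "0 \<le> s" for s
    proof -
      have "((\<lambda>s. - (\<alpha> * (P s * volterra V s / V s))) has_real_derivative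
        - (\<alpha> * (((P1 s * volterra V s + volterra_deriv s * P s) * V s - P s * volterra V s * volterra V s) / (V s * V s)))) (at s within {0..})"
        using Vpos[OF s]
        by (intro DERIV_minus DERIV_cmult DERIV_divide DERIV_mult d1 volterra_derivative V_derivative s) auto
      then show ?thesis unfolding P1_def[abs_def] P2_def
        by (rule back_subst[where P = "\<lambda>D. (_ has_real_derivative D) _"])
           (use Vpos[OF s] in \<open>simp add: P1_def field_simps power2_eq_square\<close>)
    qed
    have Ppos: "0 < P s" if "0 \<le> s" for s using Vpos[OF that] by (simp add: P_def)
    have cP: "continuous_on {0..} P" "continuous_on {0..} P1"
      by (rule DERIV_continuous_on, rule d1, simp) (rule DERIV_continuous_on, rule d2, simp)
    have "continuous_on {0..} P2"
      unfolding P2_def using Vpos by (intro continuous_intros cP cont_V cont_volterra cont_volterra_deriv) (auto simp: less_imp_neq[symmetric])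
    moreover have "4 * s * P2 s + (2 * real N + s) * P1 s - P s - 1 - 4 * q * s * (P1 s)\<^sup>2 / P s = 0" if s: "0 \<le> s" for s
    proof -
      define L where "L = volterra V s / V s"
      have p: "P s > 0" "V s > 0" using Ppos Vpos s by auto
      have P1L: "P1 s = - (\<alpha> * P s * L)" by (simp add: P1_def L_def)
      have "P2 s = - (\<alpha> * (P1 s * L + P s * (volterra_deriv s / V s) - P s * L\<^sup>2))"
        by (simp add: P2_def L_def power_divide)
      also have "\<dots> = P s * (\<alpha> * (\<alpha> + 1) * L\<^sup>2 - \<alpha> * (volterra_deriv s / V s))"
        by (simp add: P1L power2_eq_square algebra_simps)
      finally have P2L: "P2 s = P s * (\<alpha> * (\<alpha> + 1) * L\<^sup>2 - \<alpha> * (volterra_deriv s / V s))" .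
      have sq: "(P1 s)\<^sup>2 / P s = P s * (\<alpha>\<^sup>2 * L\<^sup>2)"
        using p by (simp add: P1L power2_eq_square)
      have sq': "4 * q * s * (P1 s)\<^sup>2 / P s = 4 * q * s * (P s * (\<alpha>\<^sup>2 * L\<^sup>2))"
        by (simp only: sq times_divide_eq_right[symmetric])
      \<comment> \<open>This identity is what fixes \<alpha> = 1 / (q - 1): it cancels the terms
        quadratic in V'.\<close>
      have qa: "q * \<alpha>\<^sup>2 = \<alpha> * (\<alpha> + 1)"
      proof -
        have "q = 1 + \<beta>" by (simp add: \<beta>_def)
        then have "q * \<alpha>\<^sup>2 = \<alpha>\<^sup>2 + \<alpha> * (\<alpha> * \<beta>)" by (simp add: power2_eq_square algebra_simps)
        then show ?thesis using \<alpha> by (simp add: power2_eq_square algebra_simps)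
      qed
      have h: "H (V s) = V s * (\<beta> * (1 + (V s) powr \<alpha>))"
        using Hmid[of "V s"] p Vle[OF s] by (simp add: powr_add algebra_simps)
      have "4 * s * volterra_deriv s + (2 * real N + s) * volterra V s = - (V s * (\<beta> * (1 + (V s) powr \<alpha>)))"
        using volterra_ode[OF s] h by linarith
      then have "(4 * s * volterra_deriv s + (2 * real N + s) * volterra V s) / V s = - (\<beta> * (1 + (V s) powr \<alpha>))"
        using p by simp
      then have o: "4 * s * (volterra_deriv s / V s) + (2 * real N + s) * L = - (\<beta> * (1 + (V s) powr \<alpha>))"
        by (simp add: L_def add_divide_distrib)
      have PV: "P s * (V s) powr \<alpha> = 1" using p by (simp add: P_def flip: powr_add)
      have "4 * s * P2 s + (2 * real N + s) * P1 s - P s - 1 - 4 * q * s * (P1 s)\<^sup>2 / P s =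
         P s * (4 * s * (\<alpha> * (\<alpha> + 1)) * L\<^sup>2 - \<alpha> * (4 * s * (volterra_deriv s / V s) + (2 * real N + s) * L) - 1 - 4 * s * (q * \<alpha>\<^sup>2) * L\<^sup>2) - 1"
        unfolding sq' P2L unfolding P1L by (simp add: algebra_simps)
      also have "\<dots> = P s * (\<alpha> * \<beta> * (1 + (V s) powr \<alpha>) - 1) - 1"
        unfolding qa o by simp
      also have "\<dots> = 0" using \<alpha> PV by simp
      finally show ?thesis .
    qed
    ultimately have "profile_ode N q P P1 P2" unfolding profile_ode_def using d1 d2 Ppos by simp
    moreover have "P 0 = A" by (simp add: P_def V_initial \<epsilon>\<alpha>)
    moreover have "P1 s \<le> (\<alpha> * k) * P s" if s: "0 \<le> s" for s
    proof -
      have "- volterra V s / V s \<le> k" using J[OF s] Vpos[OF s] by (simp add: field_simps)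
      then have "(\<alpha> * P s) * (- volterra V s / V s) \<le> (\<alpha> * P s) * k"
        using \<alpha> Ppos[OF s] by (intro mult_left_mono) auto
      then show ?thesis by (simp add: P1_def mult_ac)
    qed
    ultimately show ?thesis by blast
  qed
  \<comment> \<open>Since P'/P = - \<alpha> V'/V, the slope bound for P is \<alpha> k, and 4 (q - 1)
    \<alpha> k = 4 k < 1 is the smallness that \<open>profile_linear_upper_bound\<close> asks
    for.\<close>
  have "4 * (q - 1) * (\<alpha> * k) = 4 * (\<alpha> * \<beta>) * k" by (simp add: \<beta>_def)
  also have "\<dots> < 1" using \<alpha> k by simp
  finally have "4 * (q - 1) * (\<alpha> * k) < 1" .
  moreover have "0 < \<alpha> * k" using \<alpha> k by simp
  ultimately show ?thesis using A0(1) ex by blast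
qed

text \<open>C is uniform in A: a profile below g (1 + s) may be given a height A of order g / C,
  which grows with g.\<close>

lemma profile_exists_linear_growth:
  fixes q :: real and N :: nat
  assumes q: "1 < q" "q < 1 + real N / 2" and N: "1 \<le> N"
  shows "\<exists>A0 C. 1 \<le> A0 \<and> 0 < C \<and> (\<forall>A\<ge>A0. \<exists>P P1 P2. profile_ode N q P P1 P2 \<and>
     (\<forall>s\<ge>0. A \<le> P s \<and> P s \<le> C * A * (1 + s)))"
proof -
  obtain k A0 where k: "0 < k" "4 * (q - 1) * k < 1" and A0: "0 < A0"
    and ex: "\<forall>A\<ge>A0. \<exists>P P1 P2. profile_ode N q P P1 P2 \<and> P 0 = A \<and> (\<forall>s\<ge>0. P1 s \<le> k * P s)"
    using profile_exists_power[OF q N] by blast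
  obtain C where C: "C > 0" and up: "\<forall>P P1 P2. profile_ode N q P P1 P2 \<longrightarrow> 1 \<le> P 0 \<longrightarrow> (\<forall>s\<ge>0. P1 s \<le> k * P s) \<longrightarrow>
           (\<forall>s\<ge>0. P s \<le> C * P 0 * (1 + s))"
    using profile_linear_upper_bound[OF q k N] by blast
  have "\<exists>P P1 P2. profile_ode N q P P1 P2 \<and> (\<forall>s\<ge>0. A \<le> P s \<and> P s \<le> C * A * (1 + s))" if A: "max 1 A0 \<le> A" for A
  proof -
    obtain P P1 P2 where P: "profile_ode N q P P1 P2" "P 0 = A" "\<forall>s\<ge>0. P1 s \<le> k * P s"
      using ex[rule_format, of A] A by auto
    have "A \<le> P s" if s: "0 \<le> s" for s
    proof -
      have "A * 1 \<le> A * (1 + s / (2 * real N))" using A s by (intro mult_left_mono) auto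
      then show ?thesis using profile_linear_lower_bound[OF P(1) _ N s] q P(2) by simp
    qed
    moreover have "P s \<le> C * A * (1 + s)" if s: "0 \<le> s" for s
      using up[rule_format, OF P(1) _ P(3)[rule_format] s] P(2) A by simp
    ultimately show ?thesis using P(1) by blast
  qed
  then show ?thesis using C by (intro exI[of _ "max 1 A0"] exI[of _ C]) auto
qed

section \<open>The nonlinearity and its tail integral\<close>

text \<open>\<open>f1\<close> is the one-sided derivative, continuous down to 0, whereas the values
  of f at negative arguments, and with them \<open>deriv f 0\<close>, are arbitrary.\<close>

locale nonlinearity =
  fixes f f1 :: "real \<Rightarrow> real" and q :: real
  assumes fd: "\<And>x. 0 \<le> x \<Longrightarrow> (f has_real_derivative f1 x) (at x within {0..})"
    and cf1: "continuous_on {0..} f1"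
    and f0: "f 0 = 0" and fpos: "\<And>u. 0 < u \<Longrightarrow> 0 < f u" and f1pos: "\<And>u. 0 < u \<Longrightarrow> 0 < f1 u"
    and int: "\<And>u. 0 < u \<Longrightarrow> set_integrable lborel {u..} (\<lambda>s. 1 / f s)"
    and lim: "((\<lambda>s. f1 s * tail_int f s) \<longlongrightarrow> q) (at_right 0)"
begin

abbreviation "F \<equiv> tail_int f"
abbreviation "h \<equiv> tail_int_inv f"

lemma fd_at: "0 < x \<Longrightarrow> (f has_real_derivative f1 x) (at x)"
  using fd[of x] at_within_atLeast_interior[of x] by simp

lemma cf: "continuous_on {0..} f"
  by (rule DERIV_continuous_on[of _ _ f1]) (simp add: fd)

lemma cinv: "0 < a \<Longrightarrow> continuous_on {a..b} (\<lambda>s. 1 / f s)"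
  by (intro continuous_intros continuous_on_subset[OF cf]) (use fpos in \<open>auto simp: less_imp_neq[symmetric]\<close>)

lemma F_split:
  assumes "0 < u" "u \<le> b"
  shows "F u = integral {u..b} (\<lambda>s. 1 / f s) + F b"
proof -
  have i: "set_integrable lborel {u..<b} (\<lambda>s. 1 / f s)" "set_integrable lborel {b..} (\<lambda>s. 1 / f s)"
    by (rule set_integrable_subset[OF int[OF assms(1)]]; use assms in auto)+
  have "{u..} = {u..<b} \<union> {b..}" using assms by auto
  then have "F u = (LBINT s:{u..<b}. 1 / f s) + F b"
    unfolding tail_int_def using set_integral_Un[OF _ i] by (simp add: disjoint_iff)
  also have "(LBINT s:{u..<b}. 1 / f s) = integral {u..<b} (\<lambda>s. 1 / f s)"
    by (rule set_borel_integral_eq_integral(2)[OF i(1)])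
  also have "\<dots> = integral {u..b} (\<lambda>s. 1 / f s)"
    by (rule integral_spike_set; rule negligible_subset[of "{b}"]) auto
  finally show ?thesis .
qed

lemma F_derivative:
  assumes u: "0 < u" shows "(F has_real_derivative - (1 / f u)) (at u)"
proof -
  define a where "a = u / 2"
  have a: "0 < a" "a < u" using u by (auto simp: a_def)
  have "((\<lambda>v. integral {a..v} (\<lambda>s. 1 / f s)) has_real_derivative 1 / f u) (at u within {a..u+1})"
    by (rule integral_has_real_derivative[OF cinv[OF a(1)]]) (use a in auto)
  then have "((\<lambda>v. F a - integral {a..v} (\<lambda>s. 1 / f s)) has_real_derivative - (1 / f u)) (at u within {a..u+1})"
    by (auto intro!: derivative_eq_intros)
  then have "(F has_real_derivative - (1 / f u)) (at u within {a..u+1})"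
    by (rule has_field_derivative_transform_within[of _ _ _ _ 1]) (use a F_split[OF a(1)] in auto)
  moreover have "at u within {a..u+1} = at u" using a by (intro at_within_interior) auto
  ultimately show ?thesis by simp
qed

lemma F_less: assumes "0 < u" "u < v" shows "F v < F u"
proof (rule DERIV_neg_imp_decreasing[OF assms(2)])
  fix x assume "u \<le> x" "x \<le> v"
  then have "0 < x" using assms by simp
  then show "\<exists>y. (F has_real_derivative y) (at x) \<and> y < 0"
    using F_derivative[of x] fpos[of x] by (intro exI[of _ "- (1 / f x)"]) auto
qed

lemma F_pos: assumes u: "0 < u" shows "0 < F u"
proof -
  have "0 \<le> F (u + 1)" unfolding tail_int_def set_lebesgue_integral_def
    by (rule Bochner_Integration.integral_nonneg) (use u fpos in \<open>auto intro: less_imp_le simp: indicator_def\<close>)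
  then show ?thesis using F_less[of u "u+1"] u by simp
qed

lemma F_le_iff: "0 < u \<Longrightarrow> 0 < v \<Longrightarrow> F u \<le> F v \<longleftrightarrow> v \<le> u"
  using F_less[of u v] F_less[of v u] by (cases u v rule: linorder_cases) auto

lemma cF: "continuous_on {0<..} F"
  by (rule DERIV_continuous_on, rule has_field_derivative_at_within, rule F_derivative) simp

lemma F_small: assumes "0 < e" shows "\<exists>b>0. F b < e"
proof -
  have "((\<lambda>b. LBINT s:{1..b}. 1 / f s) \<longlongrightarrow> (LBINT s:{1..}. 1 / f s)) at_top"
    by (rule tendsto_set_lebesgue_integral_at_top) (use int[of 1] in auto)
  then have "\<forall>\<^sub>F b in at_top. F 1 - e < (LBINT s:{1..b}. 1 / f s)"
    using assms by (intro order_tendstoD(1)) (auto simp: tail_int_def)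
  then obtain b where b: "b \<ge> 1" "F 1 - e < (LBINT s:{1..b}. 1 / f s)"
    unfolding eventually_at_top_linorder by (metis linorder_linear)
  have "(LBINT s:{1..b}. 1 / f s) = integral {1..b} (\<lambda>s. 1 / f s)"
    by (rule set_borel_integral_eq_integral(2)) (rule set_integrable_subset[OF int[of 1]], auto)
  then have "F b < e" using F_split[of 1 b] b by simp
  then show ?thesis using b by (intro exI[of _ b]) auto
qed

text \<open>f 0 = 0 and bounded \<open>f1\<close> give f s <= C s on (0, 1], so F u grows at least
  like - ln u / C as u tends to 0.\<close>

lemma F_large: "\<exists>u>0. F u > R"
proof -
  have "compact (f1 ` {0..1})" by (intro compact_continuous_image continuous_on_subset[OF cf1]) auto
  then obtain C0 where C0: "\<forall>y\<in>f1 ` {0..1}. norm y \<le> C0" using compact_imp_bounded bounded_iff by metis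
  define C where "C = max C0 1"
  have C: "C > 0" "\<And>x. 0 \<le> x \<Longrightarrow> x \<le> 1 \<Longrightarrow> f1 x \<le> C" using C0 by (force simp: C_def)+
  have fC: "f s \<le> C * s" if s: "0 < s" "s \<le> 1" for s
  proof -
    have "C * 0 - f 0 \<le> C * s - f s"
    proof (rule nondecreasing_from_derivative[where a = 0 and b = s and f = "\<lambda>s. C * s - f s" and f' = "\<lambda>s. C - f1 s"])
      show "((\<lambda>s. C * s - f s) has_real_derivative C - f1 x) (at x within {0..})" if "0 \<le> x" for x
        using fd[OF that] by (auto intro!: derivative_eq_intros)
    qed (use C s in auto)
    then show ?thesis using f0 by simp
  qed
  \<comment> \<open>Chosen so that - ln u / C is at least R - F 1 + 1, which lifts F u above
    R.\<close>
  define u where "u = exp (- C * max 0 (R - F 1 + 1))"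
  have m: "0 \<le> max 0 (R - F 1 + 1)" by simp
  have u: "0 < u" "u \<le> 1" using C m by (auto simp: u_def)
  have "- (F u + ln u / C) \<le> - (F 1 + ln 1 / C)"
  proof (rule nondecreasing_from_derivative[where a = u and b = 1 and f = "\<lambda>x. - (F x + ln x / C)" and
        f' = "\<lambda>x. 1 / f x - 1 / (C * x)"])
    fix x assume x: "u \<le> x" "x \<le> 1"
    then have x0: "0 < x" using u by simp
    have "((\<lambda>x. - (F x + ln x / C)) has_real_derivative 1 / f x - 1 / (C * x)) (at x)"
      using F_derivative[OF x0] x0 C by (auto intro!: derivative_eq_intros simp: field_simps)
    then show "((\<lambda>x. - (F x + ln x / C)) has_real_derivative 1 / f x - 1 / (C * x)) (at x within {0..})"
      by (rule has_field_derivative_at_within)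
  next
    fix x assume x: "u < x" "x < 1"
    then have x0: "0 < x" "x \<le> 1" using u by auto
    have "1 / (C * x) \<le> 1 / f x" using fC[OF x0] fpos[OF x0(1)] C x0 by (intro divide_left_mono) auto
    then show "0 \<le> 1 / f x - 1 / (C * x)" by simp
  qed (use u in auto)
  then have "F u \<ge> F 1 - ln u / C" by simp
  also have "ln u / C = - max 0 (R - F 1 + 1)" using C by (simp add: u_def)
  finally have "F u > R" by simp
  then show ?thesis using u by blast
qed

section \<open>The inverse of the tail integral\<close>

lemma F_inj: "inj_on F {0<..}"
proof (rule inj_onI)
  fix u v assume "u \<in> {0<..}" "v \<in> {0<..}" "F u = F v"
  then show "u = v" using F_less[of u v] F_less[of v u] by (cases u v rule: linorder_cases) auto
qed

lemma F_surj: assumes y: "0 < y" shows "\<exists>u>0. F u = y"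
proof -
  obtain a where a: "0 < a" "F a > y" using F_large by blast
  obtain b where b: "0 < b" "F b < y" using F_small[OF y] by blast
  have ab: "a \<le> b" using F_less[of b a] a b by (cases "a \<le> b") auto
  have "\<exists>x\<ge>a. x \<le> b \<and> F x = y"
    by (rule IVT2') (use a b ab in \<open>auto intro!: continuous_on_subset[OF cF]\<close>)
  then show ?thesis using a by (metis less_le_trans)
qed

lemma h_props: assumes "0 < y" shows "0 < h y" "F (h y) = y"
proof -
  obtain u where u: "0 < u" "F u = y" using F_surj[OF assms] by blast
  have "h (F u) = u" unfolding tail_int_inv_def by (rule the_inv_into_f_f[OF F_inj]) (use u in simp)
  then show "0 < h y" "F (h y) = y" using u by auto
qed

lemma h_F: "0 < u \<Longrightarrow> h (F u) = u"
  unfolding tail_int_inv_def by (rule the_inv_into_f_f[OF F_inj]) simp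

lemma h_le_iff: "0 < y \<Longrightarrow> 0 < z \<Longrightarrow> h y \<le> h z \<longleftrightarrow> z \<le> y"
  using F_le_iff[of "h z" "h y"] h_props[of y] h_props[of z] by simp

lemma h_derivative: assumes y: "0 < y" shows "(h has_real_derivative - f (h y)) (at y)"
proof -
  define u where "u = h y"
  have u: "0 < u" "F u = y" using h_props[OF y] by (auto simp: u_def)
  have "isCont h (F u)"
  proof (rule isCont_inverse_function[where d = "u / 2" and f = F and x = u])
    show "h (F z) = z" if "\<bar>z - u\<bar> \<le> u / 2" for z
      by (rule h_F) (use abs_le_D2[OF that] u in linarith)
    show "isCont F z" if "\<bar>z - u\<bar> \<le> u / 2" for z
      by (rule DERIV_isCont[OF F_derivative]) (use abs_le_D2[OF that] u in linarith)
  qed (use u in simp)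
  moreover have "(F has_real_derivative - (1 / f u)) (at (h y))" using F_derivative u by (simp add: u_def)
  ultimately have "(h has_real_derivative inverse (- (1 / f u))) (at y)"
    by (intro DERIV_inverse_function[where f = F and a = 0 and b = "y + 1"])
       (use u y fpos[OF u(1)] h_props in auto)
  then show ?thesis by (simp add: u_def)
qed

lemma fh_derivative: assumes y: "0 < y" shows "((\<lambda>y. f (h y)) has_real_derivative - (f1 (h y) * f (h y))) (at y)"
  using DERIV_chain2[OF fd_at[OF h_props(1)[OF y]] h_derivative[OF y]] by simp

lemma ch: "continuous_on {0<..} h"
  by (rule DERIV_continuous_on, rule has_field_derivative_at_within, rule h_derivative) simp

lemma h_range_continuous:
  assumes "continuous_on S a" "\<And>x. x \<in> S \<Longrightarrow> 0 < a x" "continuous_on {0..} \<phi>"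
  shows "continuous_on S (\<lambda>x. \<phi> (h (a x)))"
proof (rule continuous_on_compose2[OF assms(3)])
  show "continuous_on S (\<lambda>x. h (a x))" by (rule continuous_on_compose2[OF ch assms(1)]) (use assms(2) in auto)
qed (use assms(2) h_props(1) in \<open>auto intro: less_imp_le\<close>)

lemma h_continuous:
  assumes "continuous_on S a" "\<And>x. x \<in> S \<Longrightarrow> 0 < a x"
  shows "continuous_on S (\<lambda>x. h (a x))"
  by (rule h_range_continuous[OF assms, of "\<lambda>x. x"]) simp_all

section \<open>The quantities f' F and f F near 0\<close>

lemma fF_derivative:
  assumes "0 < u" shows "((\<lambda>s. f s * F s) has_real_derivative f1 u * F u - 1) (at u)"
  using DERIV_mult[OF fd_at[OF assms] F_derivative[OF assms]] fpos[OF assms] by simp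

text \<open>If f' F < 1 near 0, then (f F)' = f' F - 1 < 0 there, so f F >= c > 0 near 0. Then (ln
  F)' = - 1 / (f F) is bounded and F stays bounded near 0, contrary to
  \<open>F_large\<close>.\<close>

lemma q_ge_1: "1 \<le> q"
proof (rule ccontr)
  assume "\<not> 1 \<le> q"
  then have "\<forall>\<^sub>F s in at_right 0. f1 s * F s < 1" by (intro order_tendstoD(2)[OF lim]) simp
  then obtain b where b: "0 < b" "\<And>s. 0 < s \<Longrightarrow> s < b \<Longrightarrow> f1 s * F s < 1"
    unfolding eventually_at_right_field by auto
  define d where "d = b / 2"
  have d: "0 < d" "d < b" using b by (auto simp: d_def)
  define c where "c = f d * F d"
  have c: "c > 0" using fpos F_pos d by (simp add: c_def)
  have fF: "c \<le> f s * F s" if "0 < s" "s \<le> d" for s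
  proof -
    have "- (f s * F s) \<le> - (f d * F d)"
    proof (rule nondecreasing_from_derivative[where a = s and b = d and f = "\<lambda>s. - (f s * F s)" and f' = "\<lambda>s. - (f1 s * F s - 1)"])
      show "((\<lambda>s. - (f s * F s)) has_real_derivative - (f1 x * F x - 1)) (at x within {0..})" if "s \<le> x" for x
        by (rule DERIV_minus, rule has_field_derivative_at_within, rule fF_derivative) (use that \<open>0 < s\<close> in linarith)
      show "0 \<le> - (f1 x * F x - 1)" if "s < x" "x < d" for x
        using b(2)[of x] that \<open>0 < s\<close> d by simp
    qed (use that in auto)
    then show ?thesis by (simp add: c_def)
  qed
  obtain u where u: "0 < u" "F u > exp (ln (F d) + d / c)" using F_large by blast
  have ud: "u < d"
  proof (rule ccontr)
    assume "\<not> u < d"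
    then have "F u \<le> F d" using F_le_iff[of u d] u d by simp
    also have "\<dots> = exp (ln (F d))" using F_pos[OF d(1)] by simp
    also have "\<dots> \<le> exp (ln (F d) + d / c)" using d c by simp
    finally show False using u by simp
  qed
  have "ln (F u) + u / c \<le> ln (F d) + d / c"
  proof (rule nondecreasing_from_derivative[where a = u and b = d and f = "\<lambda>s. ln (F s) + s / c" and f' = "\<lambda>s. 1 / c - 1 / (f s * F s)"])
    fix s assume s: "u \<le> s" "s \<le> d"
    then have s0: "0 < s" using u by simp
    have "((\<lambda>s. ln (F s) + s / c) has_real_derivative 1 / c - 1 / (f s * F s)) (at s)"
      using F_derivative[OF s0] F_pos[OF s0] fpos[OF s0] c
      by (auto intro!: derivative_eq_intros simp: field_simps)
    then show "((\<lambda>s. ln (F s) + s / c) has_real_derivative 1 / c - 1 / (f s * F s)) (at s within {0..})"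
      by (rule has_field_derivative_at_within)
  next
    fix s assume s: "u < s" "s < d"
    have "1 / (f s * F s) \<le> 1 / c" using fF[of s] s u c by (intro divide_left_mono) auto
    then show "0 \<le> 1 / c - 1 / (f s * F s)" by simp
  qed (use u ud in auto)
  moreover have "0 \<le> u / c" using u c by simp
  ultimately have "ln (F u) \<le> ln (F d) + d / c" by linarith
  then have "exp (ln (F u)) \<le> exp (ln (F d) + d / c)" by simp
  then have "F u \<le> exp (ln (F d) + d / c)" using F_pos[OF u(1)] by simp
  then show False using u by simp
qed

text \<open>Near 0 by the limit q, elsewhere by compactness. Together with \<open>fF_bounded\<close>
  it controls the derivatives of the initial datum.\<close>

lemma f1F_bounded: assumes b: "0 < b" shows "\<exists>B. \<forall>s. 0 < s \<and> s \<le> b \<longrightarrow> \<bar>f1 s * F s\<bar> \<le> B"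
proof -
  have "\<forall>\<^sub>F s in at_right 0. f1 s * F s < q + 1" by (intro order_tendstoD(2)[OF lim]) simp
  then obtain a where a: "0 < a" "\<And>s. 0 < s \<Longrightarrow> s < a \<Longrightarrow> f1 s * F s < q + 1"
    unfolding eventually_at_right_field by auto
  have "compact ((\<lambda>s. f1 s * F s) ` {a..b})"
    by (intro compact_continuous_image continuous_on_mult continuous_on_subset[OF cf1] continuous_on_subset[OF cF])
       (use a in auto)
  then obtain C where C: "\<forall>y\<in>(\<lambda>s. f1 s * F s) ` {a..b}. norm y \<le> C" using compact_imp_bounded bounded_iff by metis
  have "\<bar>f1 s * F s\<bar> \<le> max (q + 1) C" if s: "0 < s" "s \<le> b" for s
  proof (cases "s < a")
    case True
    have "0 < f1 s * F s" using f1pos F_pos s by simp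
    then show ?thesis using a(2)[OF s(1) True] by (simp add: le_max_iff_disj)
  next
    case False
    then have "norm (f1 s * F s) \<le> C" using C s by (auto simp del: real_norm_def)
    then show ?thesis by (simp add: le_max_iff_disj)
  qed
  then show ?thesis by blast
qed

text \<open>(f F)' = f' F - 1 >= -1, so f F + s is nondecreasing and its value at b bounds
  it.\<close>

lemma fF_bounded: assumes b: "0 < b" shows "\<exists>B. \<forall>s. 0 < s \<and> s \<le> b \<longrightarrow> f s * F s \<le> B"
proof -
  obtain C where C: "\<forall>s. 0 < s \<and> s \<le> b \<longrightarrow> \<bar>f1 s * F s\<bar> \<le> C" using f1F_bounded[OF b] ..
  have "f s * F s \<le> f b * F b + b" if s: "0 < s" "s \<le> b" for s
  proof -
    have "f s * F s + s \<le> f b * F b + b"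
    proof (rule nondecreasing_from_derivative[where a = s and b = b and f = "\<lambda>s. f s * F s + s" and f' = "\<lambda>s. f1 s * F s"])
      show "((\<lambda>s. f s * F s + s) has_real_derivative f1 x * F x) (at x within {0..})" if "s \<le> x" for x
        using DERIV_add[OF fF_derivative[of x] DERIV_ident] that s by (simp add: has_field_derivative_at_within)
      show "0 \<le> f1 x * F x" if "s < x" for x using that s f1pos[of x] F_pos[of x] by simp
    qed (use s in auto)
    then show ?thesis using s by simp
  qed
  then show ?thesis by blast
qed

lemma f_mono: assumes "0 \<le> a" "a \<le> b" shows "f a \<le> f b"
  by (rule nondecreasing_from_derivative[where f' = f1]) (use assms fd f1pos in \<open>auto intro: less_imp_le\<close>)

text \<open>The substitution gives W' = - f(W) P', which brings f f' (P')^2 into the second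
  derivative; this cancels against the term with f' F in the bracket. What remains is - f(W) times
  the equation of \<open>profile_ode\<close>.\<close>

lemma profile_solution_of_ode:
  assumes ode: "profile_ode CARD('n::finite) p P P1 P2"
  shows "profile_solution f p (\<lambda>y::real^'n. h (P ((norm y)\<^sup>2)))"
    and "F (h (P ((norm (y::real^'n))\<^sup>2))) = P ((norm y)\<^sup>2)"
proof -
  note o = ode[unfolded profile_ode_def]
  have Pd: "(P has_real_derivative P1 s) (at s within {0..})" if "0 \<le> s" for s using o that by blast
  have P1d: "(P1 has_real_derivative P2 s) (at s within {0..})" if "0 \<le> s" for s using o that by blast
  have Pp: "0 < P s" if "0 \<le> s" for s using o that by blast
  have cP: "continuous_on {0..} P" "continuous_on {0..} P1" "continuous_on {0..} P2"
    using DERIV_continuous_on[of "{0..}" P P1] DERIV_continuous_on[of "{0..}" P1 P2] Pd P1d o by auto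
  let ?\<Phi> = "\<lambda>s. h (P s)"
  define \<Phi>1 where "\<Phi>1 s = - (f (h (P s)) * P1 s)" for s
  define \<Phi>2 where "\<Phi>2 s = f1 (h (P s)) * f (h (P s)) * (P1 s)\<^sup>2 - f (h (P s)) * P2 s" for s
  have d1: "(?\<Phi> has_real_derivative \<Phi>1 s) (at s within {0..})" if "0 \<le> s" for s
    unfolding \<Phi>1_def using DERIV_chain2[OF h_derivative[OF Pp[OF that]] Pd[OF that]] by simp
  have d2: "(\<Phi>1 has_real_derivative \<Phi>2 s) (at s within {0..})" if "0 \<le> s" for s
    unfolding \<Phi>1_def[abs_def]
    using DERIV_minus[OF DERIV_mult[OF DERIV_chain2[OF fh_derivative[OF Pp[OF that]] Pd[OF that]] P1d[OF that]]]
    by (rule back_subst[where P = "\<lambda>D. (_ has_real_derivative D) _"]) (simp add: \<Phi>2_def power2_eq_square algebra_simps)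
  have c2: "continuous_on {0..} \<Phi>2"
    unfolding \<Phi>2_def by (intro continuous_intros h_range_continuous cP cf cf1) (auto intro: Pp)
  show FW: "F (h (P ((norm y)\<^sup>2))) = P ((norm y)\<^sup>2)" for y :: "real^'n"
    by (rule h_props(2)) (simp add: Pp)
  show "profile_solution f p (\<lambda>y::real^'n. h (P ((norm y)\<^sup>2)))"
    unfolding profile_solution_def
  proof (intro conjI allI)
    show "C2_space (\<lambda>y::real^'n. h (P ((norm y)\<^sup>2)))"
      by (rule C2_space_radial[OF d1 d2 c2])
    fix y :: "real^'n"
    let ?s = "(norm y)\<^sup>2"
    show Wp: "0 < h (P ?s)" by (rule h_props) (simp add: Pp)
    have pd: "partial_deriv i (\<lambda>y::real^'n. h (P ((norm y)\<^sup>2))) y = 2 * y $ i * \<Phi>1 ?s" for i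
      by (rule has_pd_imp_partial_deriv, rule has_pd_radial[OF d1])
    have g: "grad (\<lambda>y::real^'n. h (P ((norm y)\<^sup>2))) y = (2 * \<Phi>1 ?s) *\<^sub>R y"
      by (simp add: grad_def pd vec_eq_iff)
    have l: "laplacian (\<lambda>y::real^'n. h (P ((norm y)\<^sup>2))) y = 4 * ?s * \<Phi>2 ?s + 2 * real CARD('n) * \<Phi>1 ?s"
      by (rule laplacian_radial[OF d1 d2])
    have i: "(y /\<^sub>R 2) \<bullet> ((2 * \<Phi>1 ?s) *\<^sub>R y) = \<Phi>1 ?s * ?s" by (simp add: power2_norm_eq_inner)
    have n: "(norm ((2 * \<Phi>1 ?s) *\<^sub>R y))\<^sup>2 = 4 * (\<Phi>1 ?s)\<^sup>2 * ?s" by (simp add: power_mult_distrib)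
    define W s where "W = h (P ?s)" and "s = ?s"
    have df: "deriv f W = f1 W" unfolding W_def by (rule DERIV_imp_deriv[OF fd_at[OF Wp]])
    have fW: "f W > 0" "P s > 0" using fpos[OF Wp] Pp by (auto simp: W_def s_def)
    have od: "4 * s * P2 s + (2 * real CARD('n) + s) * P1 s - P s - 1 - 4 * p * s * (P1 s)\<^sup>2 / P s = 0"
      using o by (simp add: s_def)
    have e: "4 * (\<Phi>1 s)\<^sup>2 * s / (f W * P s) * (p - f1 W * P s) = f W * (4 * p * s * (P1 s)\<^sup>2 / P s) - 4 * s * f1 W * f W * (P1 s)\<^sup>2"
    proof -
      have "(\<Phi>1 s)\<^sup>2 = f W * (f W * (P1 s)\<^sup>2)" by (simp add: \<Phi>1_def W_def s_def power2_eq_square)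
      then have X: "4 * (\<Phi>1 s)\<^sup>2 * s / (f W * P s) = f W * (4 * s * (P1 s)\<^sup>2 / P s)" using fW by simp
      show ?thesis unfolding X using fW by (simp add: field_simps)
    qed
    have "4 * s * \<Phi>2 s + 2 * real CARD('n) * \<Phi>1 s + \<Phi>1 s * s + f W * P s + f W
        + 4 * (\<Phi>1 s)\<^sup>2 * s / (f W * P s) * (p - f1 W * P s)
       = - f W * (4 * s * P2 s + (2 * real CARD('n) + s) * P1 s - P s - 1 - 4 * p * s * (P1 s)\<^sup>2 / P s)"
      unfolding e unfolding \<Phi>1_def \<Phi>2_def W_def[folded s_def, symmetric] by (simp add: algebra_simps)
    then have "4 * s * \<Phi>2 s + 2 * real CARD('n) * \<Phi>1 s + \<Phi>1 s * s + f W * P s + f W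
        + 4 * (\<Phi>1 s)\<^sup>2 * s / (f W * P s) * (p - f1 W * P s) = 0" unfolding od by simp
    then show "laplacian (\<lambda>y::real^'n. h (P ((norm y)\<^sup>2))) y
         + (y /\<^sub>R 2) \<bullet> grad (\<lambda>y::real^'n. h (P ((norm y)\<^sup>2))) y
         + f (h (P ?s)) * F (h (P ?s)) + f (h (P ?s))
         + (norm (grad (\<lambda>y::real^'n. h (P ((norm y)\<^sup>2))) y))\<^sup>2 / (f (h (P ?s)) * F (h (P ?s)))
             * (p - deriv f (h (P ?s)) * F (h (P ?s))) = 0"
      unfolding g l i n FW using df by (simp only: W_def s_def)
  qed
qed

end

section \<open>Barriers and the global solution\<close>

context nonlinearity
begin

text \<open>Along V s = h (g (s + 1)) the growing factor is itself F: g (s + 1) = F (V s). With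
  |x_i| <= |x|^2 + 1 the first derivatives are at most 2 f F and the second at most 4 (f' F) (g f) +
  2 g f, while f F and f' F are bounded on (0, V 0].\<close>

lemma initial_data_bounds:
  fixes g :: real
  assumes g: "0 < g"
  defines "u0 \<equiv> \<lambda>x::real^'n::finite. h (g * ((norm x)\<^sup>2 + 1))"
  shows "\<exists>u1 u2 B. continuous_on UNIV u0 \<and> (\<forall>i. continuous_on UNIV (u1 i)) \<and> (\<forall>i j. continuous_on UNIV (u2 i j)) \<and>
    (\<forall>x. \<bar>u0 x\<bar> \<le> B) \<and> (\<forall>i x. \<bar>u1 i x\<bar> \<le> B) \<and> (\<forall>i j x. \<bar>u2 i j x\<bar> \<le> B) \<and>
    (\<forall>i x. has_pd i u0 x (u1 i x)) \<and> (\<forall>i j x. has_pd j (u1 i) x (u2 i j x))"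
proof -
  define V where "V s = h (g * (s + 1))" for s
  have pos: "0 < g * (s + 1)" if "0 \<le> s" for s using g that by simp
  have lin: "((\<lambda>s. g * (s + 1)) has_real_derivative g) (at s within {0..})" for s
    by (auto intro!: derivative_eq_intros)
  define \<Phi>1 where "\<Phi>1 s = - (g * f (V s))" for s
  define \<Phi>2 where "\<Phi>2 s = g * (f1 (V s) * f (V s) * g)" for s
  have d1: "(V has_real_derivative \<Phi>1 s) (at s within {0..})" if "0 \<le> s" for s
    unfolding V_def[abs_def] \<Phi>1_def using DERIV_chain2[OF h_derivative[OF pos[OF that]] lin] by (simp add: V_def mult.commute)
  have d2: "(\<Phi>1 has_real_derivative \<Phi>2 s) (at s within {0..})" if "0 \<le> s" for s
    unfolding \<Phi>1_def[abs_def] V_def[abs_def]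
    using DERIV_minus[OF DERIV_cmult[OF DERIV_chain2[OF fh_derivative[OF pos[OF that]] lin], of g]]
    by (simp add: \<Phi>2_def V_def)
  have cV: "continuous_on {0..} V" by (rule DERIV_continuous_on, rule d1) simp
  have cpos: "continuous_on {0..} (\<lambda>s. g * (s + 1))" by (intro continuous_intros)
  have c1: "continuous_on {0..} \<Phi>1" by (rule DERIV_continuous_on, rule d2) simp
  have c2: "continuous_on {0..} \<Phi>2"
    unfolding \<Phi>2_def V_def by (intro continuous_intros h_range_continuous cpos cf cf1) (use pos in auto)
  define b where "b = V 0"
  have V: "0 < V s" "V s \<le> b" "F (V s) = g * (s + 1)" if "0 \<le> s" for s
    using h_props[OF pos[OF that]] h_le_iff[OF pos[OF that] pos[OF order.refl]] g that by (auto simp: V_def b_def)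
  have b: "0 < b" using V(1)[of 0] by (simp add: b_def)
  obtain B1 where B1: "\<forall>s. 0 < s \<and> s \<le> b \<longrightarrow> \<bar>f1 s * F s\<bar> \<le> B1" using f1F_bounded[OF b] ..
  obtain B2 where B2: "\<forall>s. 0 < s \<and> s \<le> b \<longrightarrow> f s * F s \<le> B2" using fF_bounded[OF b] ..
  have B10: "0 \<le> B1" using B1[rule_format, of b] b order_trans[OF abs_ge_zero] by blast
  have fb: "0 < f (V s)" "f (V s) \<le> f b" if "0 \<le> s" for s
    using V[OF that] fpos f_mono[of "V s" b] by auto
  define u1 where "u1 i x = 2 * x $ i * \<Phi>1 ((norm x)\<^sup>2)" for i and x :: "real^'n"
  define u2 where "u2 i j x = 4 * x $ i * x $ j * \<Phi>2 ((norm x)\<^sup>2) + (if i = j then 2 * \<Phi>1 ((norm x)\<^sup>2) else 0)" for i j and x :: "real^'n"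
  define B where "B = max b (max (2 * B2) (4 * (B1 * (g * f b)) + 2 * (g * f b)))"
  have u0: "u0 = (\<lambda>x. V ((norm x)\<^sup>2))" by (simp add: u0_def V_def)
  have cr: "continuous_on UNIV (\<lambda>x::real^'n. \<phi> ((norm x)\<^sup>2))" if "continuous_on {0..} \<phi>" for \<phi> :: "real \<Rightarrow> real"
    by (rule continuous_on_compose2[OF that]) (auto intro!: continuous_intros)
  have comp: "\<bar>x $ i\<bar> * \<bar>x $ j\<bar> \<le> (norm x)\<^sup>2" for i j and x :: "real^'n"
    unfolding power2_eq_square by (intro mult_mono component_le_norm_cart) auto
  have comp1: "\<bar>x $ i\<bar> \<le> (norm x)\<^sup>2 + 1" for i and x :: "real^'n"
  proof -
    have "0 \<le> (norm x - 1)\<^sup>2" by simp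
    then have "2 * norm x \<le> (norm x)\<^sup>2 + 1" by (simp add: power2_eq_square algebra_simps)
    then show ?thesis using component_le_norm_cart[of x i] norm_ge_zero[of x] by linarith
  qed
  have "continuous_on UNIV u0" unfolding u0 by (rule cr[OF cV])
  moreover have "continuous_on UNIV (u1 i)" for i unfolding u1_def by (intro continuous_intros cr c1)
  moreover have "continuous_on UNIV (u2 i j)" for i j
    unfolding u2_def by (cases "i = j") (auto intro!: continuous_intros cr c1 c2)
  moreover have "\<bar>u0 x\<bar> \<le> B" for x
    using V[of "(norm x)\<^sup>2"] by (simp add: u0 B_def le_max_iff_disj)
  moreover have "\<bar>u1 i x\<bar> \<le> B" for i x
  proof -
    let ?s = "(norm x)\<^sup>2"
    have "\<bar>u1 i x\<bar> = 2 * (\<bar>x $ i\<bar> * (g * f (V ?s)))"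
      using g fb(1)[of ?s] by (simp add: u1_def \<Phi>1_def abs_mult)
    also have "\<dots> \<le> 2 * ((?s + 1) * (g * f (V ?s)))"
      using comp1[of x i] g fb(1)[of ?s] by (intro mult_left_mono mult_right_mono) auto
    also have "\<dots> = 2 * (f (V ?s) * F (V ?s))" by (simp add: V(3) mult_ac)
    also have "\<dots> \<le> 2 * B2" using B2[rule_format, of "V ?s"] V[of ?s] by simp
    finally show ?thesis by (simp add: B_def le_max_iff_disj)
  qed
  moreover have "\<bar>u2 i j x\<bar> \<le> B" for i j x
  proof -
    let ?s = "(norm x)\<^sup>2"
    have gf: "g * f (V ?s) \<le> g * f b" "0 \<le> g * f (V ?s)" using fb[of ?s] g by (auto intro: mult_left_mono less_imp_le)
    have f1p: "0 \<le> f1 (V ?s)" using f1pos[OF V(1)[of ?s]] by simp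
    have "\<bar>4 * x $ i * x $ j * \<Phi>2 ?s\<bar> = 4 * ((\<bar>x $ i\<bar> * \<bar>x $ j\<bar>) * (g * f1 (V ?s) * (g * f (V ?s))))"
      using g fb(1)[of ?s] f1p by (simp add: \<Phi>2_def abs_mult)
    also have "\<dots> \<le> 4 * ((?s + 1) * (g * f1 (V ?s) * (g * f (V ?s))))"
    proof -
      have "0 \<le> g * f1 (V ?s) * (g * f (V ?s))" by (rule mult_nonneg_nonneg[OF mult_nonneg_nonneg[OF less_imp_le[OF g] f1p] gf(2)])
      moreover have "\<bar>x $ i\<bar> * \<bar>x $ j\<bar> \<le> ?s + 1" using comp[of x i j] by linarith
      ultimately show ?thesis by (intro mult_left_mono mult_right_mono) simp_all
    qed
    also have "\<dots> = 4 * ((f1 (V ?s) * F (V ?s)) * (g * f (V ?s)))" by (simp add: V(3) mult_ac)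
    also have "\<dots> \<le> 4 * (B1 * (g * f b))"
    proof -
      have "f1 (V ?s) * F (V ?s) \<le> B1" using B1[rule_format, of "V ?s"] V(1,2)[of ?s] by (simp add: abs_le_iff)
      from mult_mono[OF this gf(1) B10 gf(2)] show ?thesis by simp
    qed
    finally have a: "\<bar>4 * x $ i * x $ j * \<Phi>2 ?s\<bar> \<le> 4 * (B1 * (g * f b))" .
    have "\<bar>if i = j then 2 * \<Phi>1 ?s else 0\<bar> \<le> 2 * (g * f b)"
      using gf by (auto simp: \<Phi>1_def abs_mult)
    then have "\<bar>u2 i j x\<bar> \<le> 4 * (B1 * (g * f b)) + 2 * (g * f b)"
      unfolding u2_def by (rule order_trans[OF abs_triangle_ineq add_mono[OF a]])
    then show ?thesis by (simp add: B_def le_max_iff_disj)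
  qed
  moreover have "has_pd i u0 x (u1 i x)" for i x
    unfolding u0 u1_def by (rule has_pd_radial[OF d1])
  moreover have "has_pd j (u1 i) x (u2 i j x)" for i j x
    unfolding u1_def[abs_def] u2_def by (rule has_pd_radial2[OF d2])
  ultimately show ?thesis by blast
qed

definition barrier :: "(real \<Rightarrow> real) \<Rightarrow> real^'n::finite \<Rightarrow> real \<Rightarrow> real" where
  "barrier P x t = h ((t + 1) * P ((norm x)\<^sup>2 / (t + 1)))"

lemma barrier_props:
  assumes ode: "profile_ode N p P P1 P2" and t: "0 \<le> t"
  shows "0 < barrier P x t" "F (barrier P x t) = (t + 1) * P ((norm x)\<^sup>2 / (t + 1))"
proof -
  have "0 < P ((norm x)\<^sup>2 / (t + 1))" using ode t unfolding profile_ode_def by simp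
  then have "0 < (t + 1) * P ((norm x)\<^sup>2 / (t + 1))" using t by simp
  from h_props[OF this] show "0 < barrier P x t" "F (barrier P x t) = (t + 1) * P ((norm x)\<^sup>2 / (t + 1))"
    by (simp_all add: barrier_def)
qed

lemma barrier_continuous:
  assumes ode: "profile_ode N p P P1 P2"
  shows "continuous_on (UNIV \<times> {0..}) (\<lambda>(x::real^'n::finite, t). barrier P x t)"
proof -
  have cP: "continuous_on {0..} P"
    using DERIV_continuous_on[of "{0..}" P P1] ode unfolding profile_ode_def by auto
  have "continuous_on (UNIV \<times> {0..}) (\<lambda>p::(real^'n) \<times> real. P ((norm (fst p))\<^sup>2 / (snd p + 1)))"
    by (rule continuous_on_compose2[OF cP]) (auto intro!: continuous_intros)
  then show ?thesis
    unfolding barrier_def case_prod_beta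
    by (intro h_continuous continuous_intros) (use ode in \<open>auto simp: profile_ode_def intro!: mult_pos_pos\<close>)
qed

text \<open>For the barrier v and w = F(v), the defect v_t - \<Delta> v - f(v) equals - f(v) (w_t -
  \<Delta> w + 1 + f'(v) |\<nabla> w|^2), and \<open>profile_ode\<close> says w_t - \<Delta> w + 1 =
  - p |\<nabla> w|^2 / w. Hence c = f(v) |\<nabla> w|^2 / w.\<close>

lemma barrier_equation:
  fixes P :: "real \<Rightarrow> real"
  assumes ode: "profile_ode CARD('n::finite) p P P1 P2"
  shows "\<exists>vt D DD. \<forall>t>0. \<forall>x::real^'n.
    (barrier P x has_real_derivative vt x t) (at t) \<and>
    (\<forall>i. has_pd i (\<lambda>x. barrier P x t) x (D i x t)) \<and>
    (\<forall>i. has_pd i (\<lambda>x. D i x t) x (DD i x t)) \<and>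
    (\<exists>c\<ge>0. vt x t - (\<Sum>i\<in>UNIV. DD i x t) - f (barrier P x t) = c * (p - f1 (barrier P x t) * F (barrier P x t)))"
proof -
  note o = ode[unfolded profile_ode_def]
  have Pd: "(P has_real_derivative P1 s) (at s within {0..})" if "0 \<le> s" for s using o that by blast
  have P1d: "(P1 has_real_derivative P2 s) (at s within {0..})" if "0 \<le> s" for s using o that by blast
  have Pp: "0 < P s" if "0 \<le> s" for s using o that by blast
  have od': "P z + 1 - (2 * real CARD('n) + z) * P1 z - 4 * z * P2 z = - (4 * p * z * (P1 z)\<^sup>2 / P z)" if "0 \<le> z" for z
  proof -
    have "4 * z * P2 z + (2 * real CARD('n) + z) * P1 z - P z - 1 - 4 * p * z * (P1 z)\<^sup>2 / P z = 0" using o that by blast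
    then show ?thesis by linarith
  qed
  define w where "w t s = h ((t + 1) * P (s / (t + 1)))" for t s
  define \<Phi>1 where "\<Phi>1 t s = - (f (w t s) * P1 (s / (t + 1)))" for t s
  define \<Phi>2 where "\<Phi>2 t s = f1 (w t s) * f (w t s) * (P1 (s / (t + 1)))\<^sup>2 - f (w t s) * (P2 (s / (t + 1)) / (t + 1))" for t s
  have arg: "0 < (t + 1) * P (s / (t + 1))" if "0 < t" "0 \<le> s" for t s using Pp that by simp
  have sc: "((\<lambda>s. G (s / (t + 1))) has_real_derivative G' (s / (t + 1)) * (1 / (t + 1))) (at s within {0..})"
    if G: "\<And>s. 0 \<le> s \<Longrightarrow> (G has_real_derivative G' s) (at s within {0..})" and t: "0 < t" "0 \<le> s" for G G' t s
  proof (rule DERIV_image_chain[where f = G and g = "\<lambda>s. s / (t + 1)", unfolded o_def])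
    show "(G has_real_derivative G' (s / (t + 1))) (at (s / (t + 1)) within (\<lambda>s. s / (t + 1)) ` {0..})"
      by (rule DERIV_subset[OF G]) (use t in auto)
    show "((\<lambda>s. s / (t + 1)) has_real_derivative 1 / (t + 1)) (at s within {0..})"
      by (rule DERIV_cdivide[OF DERIV_ident])
  qed
  have argd: "((\<lambda>s. (t + 1) * P (s / (t + 1))) has_real_derivative P1 (s / (t + 1))) (at s within {0..})" if "0 < t" "0 \<le> s" for t s
    using DERIV_cmult[OF sc[OF Pd that], of "t + 1"] that by simp
  have d1: "(w t has_real_derivative \<Phi>1 t s) (at s within {0..})" if "0 < t" "0 \<le> s" for t s
    unfolding w_def[abs_def] \<Phi>1_def using DERIV_chain2[OF h_derivative[OF arg[OF that]] argd[OF that]] by (simp add: w_def)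
  have d2: "(\<Phi>1 t has_real_derivative \<Phi>2 t s) (at s within {0..})" if "0 < t" "0 \<le> s" for t s
  proof -
    let ?y = "(t + 1) * P (s / (t + 1))"
    have "(\<Phi>1 t has_real_derivative - (- (f1 (h ?y) * f (h ?y)) * P1 (s / (t + 1)) * P1 (s / (t + 1)) +
        P2 (s / (t + 1)) * (1 / (t + 1)) * f (h ?y))) (at s within {0..})"
      using DERIV_minus[OF DERIV_mult[OF DERIV_chain2[OF fh_derivative[OF arg[OF that]] argd[OF that]] sc[OF P1d that]]]
      unfolding \<Phi>1_def[abs_def] w_def[abs_def] .
    moreover have "- (- (f1 (h ?y) * f (h ?y)) * P1 (s / (t + 1)) * P1 (s / (t + 1)) +
        P2 (s / (t + 1)) * (1 / (t + 1)) * f (h ?y)) = \<Phi>2 t s"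
      unfolding \<Phi>2_def w_def by (simp add: power2_eq_square)
    ultimately show ?thesis by simp
  qed
  have bw: "barrier P x t = w t ((norm x)\<^sup>2)" for x :: "real^'n" and t by (simp add: barrier_def w_def)
  define vt where "vt x t = - f (w t ((norm x)\<^sup>2)) * (P ((norm x)\<^sup>2 / (t + 1)) - (norm x)\<^sup>2 / (t + 1) * P1 ((norm x)\<^sup>2 / (t + 1)))"
    for x :: "real^'n" and t
  define D where "D i x t = 2 * x $ i * \<Phi>1 t ((norm x)\<^sup>2)" for i and x :: "real^'n" and t
  define DD where "DD i x t = 4 * x $ i * x $ i * \<Phi>2 t ((norm x)\<^sup>2) + (if i = i then 2 * \<Phi>1 t ((norm x)\<^sup>2) else 0)" for i and x :: "real^'n" and t
  have "(barrier P x has_real_derivative vt x t) (at t)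
      \<and> (\<forall>i. has_pd i (\<lambda>x. barrier P x t) x (D i x t)) \<and> (\<forall>i. has_pd i (\<lambda>x. D i x t) x (DD i x t))
      \<and> (\<exists>c\<ge>0. vt x t - (\<Sum>i\<in>UNIV. DD i x t) - f (barrier P x t) = c * (p - f1 (barrier P x t) * F (barrier P x t)))"
    if t: "0 < t" for x t
  proof (intro conjI allI)
    let ?s = "(norm x)\<^sup>2" and ?z = "(norm x)\<^sup>2 / (t + 1)"
    have z: "0 \<le> ?z" using t by simp
    have "((\<lambda>\<tau>. P (?s / (\<tau> + 1))) has_real_derivative P1 ?z * - (?s / (t + 1)\<^sup>2)) (at t within {0<..})"
    proof (rule DERIV_image_chain[where f = P and g = "\<lambda>\<tau>. ?s / (\<tau> + 1)", unfolded o_def])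
      show "(P has_real_derivative P1 ?z) (at ?z within (\<lambda>\<tau>. ?s / (\<tau> + 1)) ` {0<..})"
        by (rule DERIV_subset[OF Pd[OF z]]) auto
      show "((\<lambda>\<tau>. ?s / (\<tau> + 1)) has_real_derivative - (?s / (t + 1)\<^sup>2)) (at t within {0<..})"
        using t by (auto intro!: derivative_eq_intros simp: power2_eq_square)
    qed
    then have Pt: "((\<lambda>\<tau>. P (?s / (\<tau> + 1))) has_real_derivative P1 ?z * - (?s / (t + 1)\<^sup>2)) (at t)"
      using t by (simp add: at_within_open[of t "{0<..}"])
    have 1: "((\<lambda>\<tau>. \<tau> + 1) has_real_derivative 1) (at t)" by (auto intro!: derivative_eq_intros)
    have "((\<lambda>\<tau>. (\<tau> + 1) * P (?s / (\<tau> + 1))) has_real_derivative P ?z - ?z * P1 ?z) (at t)"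
      using DERIV_mult[OF 1 Pt]
      by (rule back_subst[where P = "\<lambda>D. (_ has_real_derivative D) _"]) (use t in \<open>simp add: power2_eq_square\<close>)
    from DERIV_chain2[OF h_derivative[OF arg[OF t, of ?s]] this]
    show "(barrier P x has_real_derivative vt x t) (at t)"
      unfolding barrier_def[abs_def] vt_def w_def by simp
    show "has_pd i (\<lambda>x. barrier P x t) x (D i x t)" for i
      unfolding bw D_def by (rule has_pd_radial[OF d1[OF t]])
    show "has_pd i (\<lambda>x. D i x t) x (DD i x t)" for i
      unfolding D_def DD_def by (rule has_pd_radial2[OF d2[OF t]])
    define W where "W = w t ?s"
    have bW: "barrier P x t = W" by (simp add: bw W_def)
    have W: "0 < W" "F W = (t + 1) * P ?z" using barrier_props[OF ode, of t x] t by (auto simp: bW[symmetric])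
    have S: "(\<Sum>i\<in>UNIV. DD i x t) = 4 * ?s * \<Phi>2 t ?s + 2 * real CARD('n) * \<Phi>1 t ?s"
    proof -
      have "(\<Sum>i\<in>UNIV. DD i x t) = (\<Sum>i\<in>UNIV. (x $ i * x $ i) * (4 * \<Phi>2 t ?s)) + (\<Sum>i\<in>(UNIV::'n set). 2 * \<Phi>1 t ?s)"
        by (simp add: DD_def sum.distrib mult_ac)
      also have "(\<Sum>i\<in>UNIV. (x $ i * x $ i) * (4 * \<Phi>2 t ?s)) = ?s * (4 * \<Phi>2 t ?s)"
        by (simp only: sum_distrib_right[symmetric] sum_component_sq)
      finally show ?thesis by simp
    qed
    have sz: "?s = (t + 1) * ?z" using t by simp
    have od: "P ?z + 1 - (2 * real CARD('n) + ?z) * P1 ?z - 4 * ?z * P2 ?z = - (4 * p * ?z * (P1 ?z)\<^sup>2 / P ?z)"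
      by (rule od'[OF z])
    have "vt x t - (\<Sum>i\<in>UNIV. DD i x t) - f W =
       - f W * (P ?z + 1 - (2 * real CARD('n) + ?z) * P1 ?z - 4 * (?s / (t + 1)) * P2 ?z) - 4 * ?s * (f1 W * f W * (P1 ?z)\<^sup>2)"
      unfolding S vt_def \<Phi>1_def \<Phi>2_def W_def[symmetric] by (simp add: algebra_simps)
    also have "\<dots> = f W * (4 * p * ?z * (P1 ?z)\<^sup>2 / P ?z) - 4 * ?s * (f1 W * f W * (P1 ?z)\<^sup>2)"
      unfolding od by simp
    also have "\<dots> = (4 * f W * (P1 ?z)\<^sup>2 * ?z / P ?z) * (p - f1 W * F W)"
    proof -
      have gen: "a * (4 * p * z * r / Pz) - 4 * s * (c * a * r) = (4 * a * r * z / Pz) * (p - c * ((t + 1) * Pz))"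
        if "0 < Pz" "s = (t + 1) * z" for a z r Pz s c
        using that by (simp add: field_simps)
      show ?thesis unfolding W(2) by (rule gen[OF Pp[OF z] sz])
    qed
    finally have "vt x t - (\<Sum>i\<in>UNIV. DD i x t) - f W = (4 * f W * (P1 ?z)\<^sup>2 * ?z / P ?z) * (p - f1 W * F W)" .
    moreover have "0 \<le> 4 * f W * (P1 ?z)\<^sup>2 * ?z / P ?z"
      using fpos[OF W(1)] z Pp[OF z] t by (intro divide_nonneg_pos mult_nonneg_nonneg) auto
    ultimately show "\<exists>c\<ge>0. vt x t - (\<Sum>i\<in>UNIV. DD i x t) - f (barrier P x t) = c * (p - f1 (barrier P x t) * F (barrier P x t))"
      unfolding bW by blast
  qed
  then show ?thesis by (intro exI[of _ vt] exI[of _ D] exI[of _ DD]) simp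
qed

text \<open>Freezing the derivative outside [0, M] keeps it continuous and bounded while f is
  unchanged on the range of the barriers.\<close>

lemma truncated_nonlinearity:
  assumes M: "0 < M"
  shows "\<exists>ft ft' K. (\<forall>v. (ft has_real_derivative ft' v) (at v)) \<and> continuous_on UNIV ft' \<and>
    (\<forall>v. \<bar>ft' v\<bar> \<le> K) \<and> 0 < K \<and> ft 0 = 0 \<and> (\<forall>v. 0 \<le> v \<and> v \<le> M \<longrightarrow> ft v = f v)"
proof -
  define ft' where "ft' v = f1 (max 0 (min v M))" for v
  have c: "continuous_on UNIV ft'"
    unfolding ft'_def by (rule continuous_on_compose2[OF cf1]) (auto intro!: continuous_intros)
  have "compact (f1 ` {0..M})" by (intro compact_continuous_image continuous_on_subset[OF cf1]) auto
  then obtain C where C: "\<forall>y\<in>f1 ` {0..M}. norm y \<le> C" using compact_imp_bounded bounded_iff by metis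
  have b: "\<bar>ft' v\<bar> \<le> max C 1" for v
  proof -
    have "max 0 (min v M) \<in> {0..M}" using M by auto
    then have "norm (ft' v) \<le> C" using C unfolding ft'_def by blast
    then show ?thesis by simp
  qed
  obtain ft where ft: "ft 0 = 0" "\<And>v. (ft has_real_derivative ft' v) (at v)"
    using antiderivative_exists[OF c, of 0 0] by blast
  have "ft v = f v" if v: "0 \<le> v" "v \<le> M" for v
  proof (cases "v = 0")
    case False
    have "((\<lambda>v. ft v - f v) has_real_derivative 0) (at r)" if r: "0 < r" "r < v" for r
      using DERIV_diff[OF ft(2)[of r] fd_at[OF r(1)]] r v by (simp add: ft'_def)
    moreover have "continuous_on {0..v} (\<lambda>v. ft v - f v)"
    proof (rule continuous_on_diff)
      show "continuous_on {0..v} ft" by (rule DERIV_continuous_on, rule has_field_derivative_at_within, rule ft(2))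
      show "continuous_on {0..v} f" by (rule continuous_on_subset[OF cf]) auto
    qed
    moreover have "0 < v" using v False by simp
    ultimately have "ft v - f v = ft 0 - f 0"
      using DERIV_isconst2[of 0 v "\<lambda>v. ft v - f v" v] by simp
    then show ?thesis using ft f0 by simp
  qed (use ft f0 in simp)
  then show ?thesis using c b ft by (intro exI[of _ ft] exI[of _ ft'] exI[of _ "max C 1"]) simp
qed

text \<open>Nearness of s to 0 is restated as largeness of F s, the quantity in which the barriers
  are bounded.\<close>

lemma eventually_f1F:
  assumes "\<forall>\<^sub>F s in at_right 0. Q (f1 s * F s)"
  shows "\<exists>R>0. \<forall>s>0. R \<le> F s \<longrightarrow> Q (f1 s * F s)"
proof -
  obtain b where b: "0 < b" "\<And>s. 0 < s \<Longrightarrow> s < b \<Longrightarrow> Q (f1 s * F s)"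
    using assms unfolding eventually_at_right_field by auto
  have "Q (f1 s * F s)" if "0 < s" "F (b / 2) \<le> F s" for s
    using b(2)[of s] F_le_iff[of "b/2" s] that b(1) by simp
  then show ?thesis using F_pos[of "b/2"] b(1) by (intro exI[of _ "F (b/2)"]) auto
qed

text \<open>Since F decreases, the larger profile gives the lower barrier. F of a barrier is t + 1
  times its profile, so it never drops below g for the lower and A for the upper one: the sign
  conditions on f' F hold along the barriers at all times, and both stay below M = h A. Comparison
  takes place for the truncated equation.\<close>

lemma global_solution_between_barriers:
  fixes g q2 :: real
  assumes g: "0 < g"
    and lower: "profile_ode CARD('n::finite) 1 P P1 P2" "\<And>s. 0 \<le> s \<Longrightarrow> g * (s + 1) \<le> P s"
    and upper: "profile_ode CARD('n) q2 R R1 R2" "\<And>s. 0 \<le> s \<Longrightarrow> A \<le> R s \<and> R s \<le> g * (s + 1)" and A: "0 < A"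
    and low: "\<And>s. 0 < s \<Longrightarrow> g \<le> F s \<Longrightarrow> 1 \<le> f1 s * F s"
    and up: "\<And>s. 0 < s \<Longrightarrow> A \<le> F s \<Longrightarrow> f1 s * F s \<le> q2"
  shows "\<exists>u. global_solution f (\<lambda>x::real^'n. h (g * ((norm x)\<^sup>2 + 1))) u \<and>
    (\<forall>x t. 0 \<le> t \<longrightarrow> barrier P x t \<le> u x t \<and> u x t \<le> barrier R x t)"
proof -
  define M where "M = h A"
  have M: "0 < M" "F M = A" using h_props[OF A] by (auto simp: M_def)
  obtain ft ft' K where "(\<forall>v. (ft has_real_derivative ft' v) (at v)) \<and> continuous_on UNIV ft' \<and>
    (\<forall>v. \<bar>ft' v\<bar> \<le> K) \<and> 0 < K \<and> ft 0 = 0 \<and> (\<forall>v. 0 \<le> v \<and> v \<le> M \<longrightarrow> ft v = f v)"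
    using truncated_nonlinearity[OF M(1)] by (elim exE) (rule that)
  then have ft: "\<And>v. (ft has_real_derivative ft' v) (at v)" "continuous_on UNIV ft'"
    "\<And>v. \<bar>ft' v\<bar> \<le> K" "0 < K" "ft 0 = 0" "\<And>v. 0 \<le> v \<Longrightarrow> v \<le> M \<Longrightarrow> ft v = f v"
    by blast+
  let ?u0 = "\<lambda>x::real^'n. h (g * ((norm x)\<^sup>2 + 1))"
  obtain u1 u2 B where "continuous_on UNIV ?u0 \<and> (\<forall>i. continuous_on UNIV (u1 i)) \<and> (\<forall>i j. continuous_on UNIV (u2 i j)) \<and>
    (\<forall>x. \<bar>?u0 x\<bar> \<le> B) \<and> (\<forall>i x. \<bar>u1 i x\<bar> \<le> B) \<and> (\<forall>i j x. \<bar>u2 i j x\<bar> \<le> B) \<and>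
    (\<forall>i x. has_pd i ?u0 x (u1 i x)) \<and> (\<forall>i j x. has_pd j (u1 i) x (u2 i j x))"
    using initial_data_bounds[OF g, where 'n = 'n] by (elim exE) (rule that)
  then have u: "continuous_on UNIV ?u0" "\<And>i. continuous_on UNIV (u1 i)" "\<And>i j. continuous_on UNIV (u2 i j)"
    "\<And>x. \<bar>?u0 x\<bar> \<le> B" "\<And>i x. \<bar>u1 i x\<bar> \<le> B" "\<And>i j x. \<bar>u2 i j x\<bar> \<le> B"
    "\<And>i x. has_pd i ?u0 x (u1 i x)" "\<And>i j x. has_pd j (u1 i) x (u2 i j x)"
    by blast+
  interpret S: semilinear_heat ft ft' K B ?u0 u1 u2
    by (rule semilinear_heat.intro) (rule ft u)+
  have z: "0 \<le> (norm x)\<^sup>2 / (t + 1)" if "0 \<le> t" for x :: "real^'n" and t using that by simp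
  have super_le: "barrier R x t \<le> M" if "0 \<le> t" for x :: "real^'n" and t
  proof -
    have "A \<le> R ((norm x)\<^sup>2 / (t + 1))" using upper(2)[OF z[OF that, of x]] by blast
    then have "1 * A \<le> (t + 1) * R ((norm x)\<^sup>2 / (t + 1))" using that A by (intro mult_mono) auto
    then have "F M \<le> F (barrier R x t)" using barrier_props(2)[OF upper(1) that, of x] M by simp
    then show ?thesis by (rule iffD1[OF F_le_iff[OF M(1) barrier_props(1)[OF upper(1) that]]])
  qed
  have Ag: "A \<le> g" using upper(2)[of 0] by simp
  have FP: "g \<le> F (barrier P x t)" if "0 \<le> t" for x :: "real^'n" and t
  proof -
    have "g * 1 \<le> g * ((norm x)\<^sup>2 / (t + 1) + 1)" using g z[OF that, of x] by (intro mult_left_mono) auto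
    then have "g \<le> P ((norm x)\<^sup>2 / (t + 1))" using lower(2)[OF z[OF that, of x]] by simp
    then have "1 * g \<le> (t + 1) * P ((norm x)\<^sup>2 / (t + 1))" using that g by (intro mult_mono) auto
    then show ?thesis using barrier_props(2)[OF lower(1) that, of x] by simp
  qed
  have sub_le: "barrier P x t \<le> M" if "0 \<le> t" for x :: "real^'n" and t
    by (rule iffD1[OF F_le_iff[OF M(1) barrier_props(1)[OF lower(1) that]]]) (use FP[OF that, of x] Ag M(2) in linarith)
  have cu: "continuous_on X (\<lambda>(x, t). S.u x t)" for X
    unfolding case_prod_beta by (rule continuous_on_subset[OF tame_imp_continuous[OF S.tame_u]]) simp
  have cb: "continuous_on (UNIV \<times> {0..t}) (\<lambda>(x::real^'n, t). barrier X x t)"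
    if "profile_ode CARD('n) r X X1 X2" for r X X1 X2 t
    by (rule continuous_on_subset[OF barrier_continuous[OF that]]) auto
  have le_super: "S.u x t \<le> barrier R x t" if t: "0 \<le> t" for x t
  proof -
    obtain vt D DD where b: "\<forall>t>0. \<forall>x::real^'n.
      (barrier R x has_real_derivative vt x t) (at t) \<and>
      (\<forall>i. has_pd i (\<lambda>x. barrier R x t) x (D i x t)) \<and>
      (\<forall>i. has_pd i (\<lambda>x. D i x t) x (DD i x t)) \<and>
      (\<exists>c\<ge>0. vt x t - (\<Sum>i\<in>UNIV. DD i x t) - f (barrier R x t) = c * (q2 - f1 (barrier R x t) * F (barrier R x t)))"
      using barrier_equation[OF upper(1)] by blast
    obtain C where C: "0 \<le> C \<and> (\<forall>x s. s \<le> t \<longrightarrow> \<bar>S.u x s\<bar> \<le> C)" using tame_bound[OF S.tame_u, of t] ..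
    have "S.u x t - barrier R x t \<le> 0"
    proof (rule comparison_principle[where T = t and d = "\<lambda>x t. S.u x t - barrier R x t" and K = K and B = C
          and dt = "\<lambda>x t. ((\<Sum>i\<in>UNIV. S.hu i i x t) + ft (S.u x t)) - vt x t"
          and D = "\<lambda>i x t. S.gu i x t - D i x t" and DD = "\<lambda>i x t. S.hu i i x t - DD i x t"])
      show "continuous_on (UNIV \<times> {0..t}) (\<lambda>(x, t). S.u x t - barrier R x t)"
        using continuous_on_diff[OF cu cb[OF upper(1)]] by (simp add: case_prod_beta)
      show "S.u x s - barrier R x s \<le> C" if "0 \<le> s" "s \<le> t" for x s
      proof -
        have "\<bar>S.u x s\<bar> \<le> C" using C that by blast
        then show ?thesis using barrier_props(1)[OF upper(1) that(1), of x] by linarith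
      qed
      show "S.u x 0 - barrier R x 0 \<le> 0" for x
      proof -
        have "R ((norm x)\<^sup>2) \<le> g * ((norm x)\<^sup>2 + 1)" "0 < R ((norm x)\<^sup>2)" using upper(2)[of "(norm x)\<^sup>2"] A by auto
        then have "?u0 x \<le> h (R ((norm x)\<^sup>2))" using g by (subst h_le_iff) (auto intro!: mult_pos_pos add_nonneg_pos)
        then show ?thesis by (simp add: S.u_initial barrier_def)
      qed
      fix x :: "real^'n" and s assume s: "0 < s" "s \<le> t"
      show "((\<lambda>s. S.u x s - barrier R x s) has_real_derivative ((\<Sum>i\<in>UNIV. S.hu i i x s) + ft (S.u x s)) - vt x s) (at s)"
        using b s(1) by (intro DERIV_diff S.u_time_derivative) blast+
      show "has_pd i (\<lambda>x. S.u x s - barrier R x s) x (S.gu i x s - D i x s)" for i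
        using b s(1) by (intro has_pd_diff S.has_pd_u) blast
      show "has_pd i (\<lambda>x. S.gu i x s - D i x s) x (S.hu i i x s - DD i x s)" for i
        using b s(1) by (intro has_pd_diff S.has_pd_gu) blast
      assume d: "S.u x s - barrier R x s > 0"
      let ?v = "barrier R x s"
      have s0: "0 \<le> s" using s by simp
      have vp: "0 < ?v" "?v \<le> M" using barrier_props(1)[OF upper(1) s0] super_le[OF s0] by auto
      obtain c where c: "0 \<le> c" "vt x s - (\<Sum>i\<in>UNIV. DD i x s) - f ?v = c * (q2 - f1 ?v * F ?v)" using b s(1) by blast
      have "A \<le> F ?v" using F_le_iff[OF M(1) vp(1)] vp(2) M(2) by simp
      then have "0 \<le> c * (q2 - f1 ?v * F ?v)" using c(1) up[OF vp(1)] by simp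
      then have e1: "(\<Sum>i\<in>UNIV. DD i x s) + f ?v \<le> vt x s" using c(2) by linarith
      have "ft (S.u x s) - ft ?v \<le> K * (S.u x s - ?v)" using S.ft_Lipschitz[of "S.u x s" ?v] d by simp
      then have e2: "ft (S.u x s) - f ?v \<le> K * (S.u x s - ?v)" using ft(6)[of ?v] vp by simp
      show "((\<Sum>i\<in>UNIV. S.hu i i x s) + ft (S.u x s)) - vt x s \<le> (\<Sum>i\<in>UNIV. S.hu i i x s - DD i x s) + K * (S.u x s - ?v)"
        unfolding sum_subtractf using e1 e2 by linarith
    qed (use t ft in auto)
    then show ?thesis by simp
  qed
  have ge_sub: "barrier P x t \<le> S.u x t" if t: "0 \<le> t" for x t
  proof -
    obtain vt D DD where b: "\<forall>t>0. \<forall>x::real^'n.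
      (barrier P x has_real_derivative vt x t) (at t) \<and>
      (\<forall>i. has_pd i (\<lambda>x. barrier P x t) x (D i x t)) \<and>
      (\<forall>i. has_pd i (\<lambda>x. D i x t) x (DD i x t)) \<and>
      (\<exists>c\<ge>0. vt x t - (\<Sum>i\<in>UNIV. DD i x t) - f (barrier P x t) = c * (1 - f1 (barrier P x t) * F (barrier P x t)))"
      using barrier_equation[OF lower(1)] by blast
    obtain C where C: "0 \<le> C \<and> (\<forall>x s. s \<le> t \<longrightarrow> \<bar>S.u x s\<bar> \<le> C)" using tame_bound[OF S.tame_u, of t] ..
    have "barrier P x t - S.u x t \<le> 0"
    proof (rule comparison_principle[where T = t and d = "\<lambda>x t. barrier P x t - S.u x t" and K = K and B = "M + C"
          and dt = "\<lambda>x t. vt x t - ((\<Sum>i\<in>UNIV. S.hu i i x t) + ft (S.u x t))"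
          and D = "\<lambda>i x t. D i x t - S.gu i x t" and DD = "\<lambda>i x t. DD i x t - S.hu i i x t"])
      show "continuous_on (UNIV \<times> {0..t}) (\<lambda>(x, t). barrier P x t - S.u x t)"
        using continuous_on_diff[OF cb[OF lower(1)] cu] by (simp add: case_prod_beta)
      show "barrier P x s - S.u x s \<le> M + C" if "0 \<le> s" "s \<le> t" for x s
      proof -
        have "\<bar>S.u x s\<bar> \<le> C" using C that by blast
        then show ?thesis using sub_le[OF that(1), of x] by linarith
      qed
      show "barrier P x 0 - S.u x 0 \<le> 0" for x
      proof -
        have p: "0 < g * ((norm x)\<^sup>2 + 1)" using g by (auto intro!: mult_pos_pos add_nonneg_pos)
        have "g * ((norm x)\<^sup>2 + 1) \<le> P ((norm x)\<^sup>2)" using lower(2)[of "(norm x)\<^sup>2"] by simp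
        then have "h (P ((norm x)\<^sup>2)) \<le> ?u0 x" using p by (subst h_le_iff) auto
        then show ?thesis by (simp add: S.u_initial barrier_def)
      qed
      fix x :: "real^'n" and s assume s: "0 < s" "s \<le> t"
      show "((\<lambda>s. barrier P x s - S.u x s) has_real_derivative vt x s - ((\<Sum>i\<in>UNIV. S.hu i i x s) + ft (S.u x s))) (at s)"
        using b s(1) by (intro DERIV_diff S.u_time_derivative) blast+
      show "has_pd i (\<lambda>x. barrier P x s - S.u x s) x (D i x s - S.gu i x s)" for i
        using b s(1) by (intro has_pd_diff S.has_pd_u) blast
      show "has_pd i (\<lambda>x. D i x s - S.gu i x s) x (DD i x s - S.hu i i x s)" for i
        using b s(1) by (intro has_pd_diff S.has_pd_gu) blast
      assume d: "barrier P x s - S.u x s > 0"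
      let ?v = "barrier P x s"
      have s0: "0 \<le> s" using s by simp
      have vp: "0 < ?v" "?v \<le> M" using barrier_props(1)[OF lower(1) s0] sub_le[OF s0] by auto
      obtain c where c: "0 \<le> c" "vt x s - (\<Sum>i\<in>UNIV. DD i x s) - f ?v = c * (1 - f1 ?v * F ?v)" using b s(1) by blast
      have "c * (1 - f1 ?v * F ?v) \<le> 0" using c(1) low[OF vp(1) FP[OF s0]] by (simp add: mult_nonneg_nonpos)
      then have e1: "vt x s \<le> (\<Sum>i\<in>UNIV. DD i x s) + f ?v" using c(2) by linarith
      have "ft ?v - ft (S.u x s) \<le> K * (?v - S.u x s)" using S.ft_Lipschitz[of ?v "S.u x s"] d by simp
      then have e2: "f ?v - ft (S.u x s) \<le> K * (?v - S.u x s)" using ft(6)[of ?v] vp by simp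
      show "vt x s - ((\<Sum>i\<in>UNIV. S.hu i i x s) + ft (S.u x s)) \<le> (\<Sum>i\<in>UNIV. DD i x s - S.hu i i x s) + K * (?v - S.u x s)"
        unfolding sum_subtractf using e1 e2 by linarith
    qed (use t ft in auto)
    then show ?thesis by simp
  qed
  \<comment> \<open>Between the barriers u takes values in (0, M], where truncated and original
    nonlinearity agree; u thus solves the original equation.\<close>
  have range: "0 < S.u x t" "ft (S.u x t) = f (S.u x t)" if "0 \<le> t" for x t
  proof -
    have "0 < S.u x t" using ge_sub[OF that, of x] barrier_props(1)[OF lower(1) that, of x] by linarith
    moreover have "S.u x t \<le> M" using le_super[OF that, of x] super_le[OF that, of x] by linarith
    ultimately show "0 < S.u x t" "ft (S.u x t) = f (S.u x t)" using ft(6) by auto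
  qed
  have p1: "partial_deriv i (\<lambda>x. S.u x t) = (\<lambda>x. S.gu i x t)" for i t
    by (rule partial_deriv_eqI) (rule S.has_pd_u)
  have p2: "partial_deriv j (\<lambda>x. S.gu i x t) = (\<lambda>x. S.hu i j x t)" for i j t
    by (rule partial_deriv_eqI) (rule S.has_pd_gu)
  have dt: "deriv (S.u x) t = (\<Sum>i\<in>UNIV. S.hu i i x t) + ft (S.u x t)" if "0 < t" for x t
    by (rule DERIV_imp_deriv[OF S.u_time_derivative[OF that]])
  have cs: "continuous_on X (\<lambda>(x, t). w x t)" if "tame w" for X and w :: "real^'n \<Rightarrow> real \<Rightarrow> real"
    unfolding case_prod_beta by (rule continuous_on_subset[OF tame_imp_continuous[OF that]]) simp
  have "C21 S.u"
    unfolding C21_def p1 p2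
  proof (intro conjI allI impI)
    show "S.u x field_differentiable at t" if "0 < t" for x t
      using S.u_time_derivative[OF that] unfolding field_differentiable_def by blast
    have "continuous_on (UNIV \<times> {0<..}) (\<lambda>(x, t). (\<Sum>i\<in>UNIV. S.hu i i x t) + ft (S.u x t))"
      unfolding case_prod_beta
      by (intro continuous_on_add continuous_on_sum
          continuous_on_subset[OF tame_imp_continuous[OF S.tame_hu]]
          continuous_on_subset[OF tame_imp_continuous[OF S.tame_ft[OF S.tame_u]]] subset_UNIV)
    then show "continuous_on (UNIV \<times> {0<..}) (\<lambda>(x, t). deriv (S.u x) t)"
      by (rule continuous_on_eq) (auto simp: dt)
    show "has_partial_derivs (\<lambda>x. S.u x t)" for t by (rule has_partial_derivsI) (rule S.has_pd_u)
    show "has_partial_derivs (\<lambda>x. S.gu i x t)" for t i by (rule has_partial_derivsI) (rule S.has_pd_gu)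
  qed (rule cs S.tame_u S.tame_gu S.tame_hu)+
  moreover have "bounded ((\<lambda>(x, t). S.u x t) ` (UNIV \<times> {0..T}))" for T
  proof -
    obtain C where "0 \<le> C \<and> (\<forall>x s. s \<le> T \<longrightarrow> \<bar>S.u x s\<bar> \<le> C)" using tame_bound[OF S.tame_u, of T] ..
    then show ?thesis unfolding bounded_iff by (intro exI[of _ C]) auto
  qed
  moreover have "deriv (S.u x) t = laplacian (\<lambda>x. S.u x t) x + f (S.u x t)" if "0 < t" for x t
    unfolding laplacian_def p1 p2 dt[OF that] using range(2)[of t x] that by simp
  ultimately have "global_solution f ?u0 S.u"
    unfolding global_solution_def using range(1) by (auto intro: cu less_imp_le simp: S.u_initial)
  then show ?thesis using le_super ge_sub by blast
qed

text \<open>F reverses order: u above the lower barrier means F(u) <= (t + 1) P, and |y|^2 = |x|^2 /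
  (t + 1) absorbs the factor t + 1. The right inequality follows likewise from the upper
  barrier.\<close>

lemma existence_and_bounds:
  assumes q: "q < 1 + real CARD('n::finite) / 2"
    and q1: "q = 1 \<Longrightarrow> \<exists>s0>0. \<forall>s. 0 < s \<and> s < s0 \<longrightarrow> 1 \<le> f1 s * F s"
  shows "\<exists>\<gamma>s>0. \<exists>q1 q2. 1 \<le> q1 \<and> q1 \<le> q \<and> q \<le> q2 \<and> q2 < 1 + real CARD('n) / 2 \<and>
    (\<forall>\<gamma>. 0 < \<gamma> \<and> \<gamma> < \<gamma>s \<longrightarrow>
      (\<exists>u :: real^'n \<Rightarrow> real \<Rightarrow> real.
        global_solution f (\<lambda>x. h (inverse \<gamma> * ((norm x)\<^sup>2 + 1))) u \<and>
        (\<exists>W1 W2 :: real^'n \<Rightarrow> real.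
          profile_solution f q1 W1 \<and> profile_solution f q2 W2 \<and>
          (\<forall>x t. t \<ge> 0 \<longrightarrow>
            (let y = x /\<^sub>R sqrt (t + 1) in
              (norm y)\<^sup>2 / F (W1 y) \<le> (norm x)\<^sup>2 / F (u x t) \<and>
              (norm x)\<^sup>2 / F (u x t) \<le> (norm y)\<^sup>2 / F (W2 y))))))"
proof -
  let ?N = "CARD('n)"
  have N: "1 \<le> ?N" by (simp add: Suc_leI)
  \<comment> \<open>The midpoint of q and 1 + N/2: strictly above q, so that f' F <= q2 near 0 from
    whichever side the limit is approached.\<close>
  define q2 where "q2 = (q + (1 + real ?N / 2)) / 2"
  have q2: "q < q2" "q2 < 1 + real ?N / 2" "1 < q2" using q q_ge_1 by (auto simp: q2_def)
  obtain A0 C where A0: "1 \<le> A0" and C: "0 < C" and ex: "\<forall>A\<ge>A0. \<exists>P P1 P2. profile_ode ?N q2 P P1 P2 \<and>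
     (\<forall>s\<ge>0. A \<le> P s \<and> P s \<le> C * A * (1 + s))"
    using profile_exists_linear_growth[OF q2(3,2) N] by blast
  have "\<forall>\<^sub>F s in at_right 0. f1 s * F s < q2" by (rule order_tendstoD(2)[OF lim q2(1)])
  then have "\<forall>\<^sub>F s in at_right 0. f1 s * F s \<le> q2" by (rule eventually_mono) simp
  then obtain RU where RU: "0 < RU" "\<forall>s>0. RU \<le> F s \<longrightarrow> f1 s * F s \<le> q2"
    using eventually_f1F[of "\<lambda>v. v \<le> q2"] by blast
  have "\<forall>\<^sub>F s in at_right 0. 1 \<le> f1 s * F s"
  proof (cases "q = 1")
    case True
    from q1[OF this] show ?thesis unfolding eventually_at_right_field by blast
  next
    case False
    then have "\<forall>\<^sub>F s in at_right 0. 1 < f1 s * F s" using q_ge_1 by (intro order_tendstoD(1)[OF lim]) simp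
    then show ?thesis by (rule eventually_mono) simp
  qed
  then obtain RL where RL: "0 < RL" "\<forall>s>0. RL \<le> F s \<longrightarrow> 1 \<le> f1 s * F s"
    using eventually_f1F[of "\<lambda>v. 1 \<le> v"] by blast
  define C' where "C' = max C 1"
  have C': "C \<le> C'" "1 \<le> C'" by (auto simp: C'_def)
  \<comment> \<open>For g = 1 / \<gamma> > G the height A = g / C' is at least A0 + RU, and g is at
    least RL: the upper profile exists and both sign conditions on f' F hold along the
    barriers.\<close>
  define G where "G = C' * (A0 + RU) + RL"
  have G: "0 < G" using C' A0 RU RL by (auto simp: G_def intro!: add_pos_pos mult_pos_pos)
  have main: "\<exists>u :: real^'n \<Rightarrow> real \<Rightarrow> real.
        global_solution f (\<lambda>x. h (inverse \<gamma> * ((norm x)\<^sup>2 + 1))) u \<and>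
        (\<exists>W1 W2 :: real^'n \<Rightarrow> real.
          profile_solution f 1 W1 \<and> profile_solution f q2 W2 \<and>
          (\<forall>x t. t \<ge> 0 \<longrightarrow>
            (let y = x /\<^sub>R sqrt (t + 1) in
              (norm y)\<^sup>2 / F (W1 y) \<le> (norm x)\<^sup>2 / F (u x t) \<and>
              (norm x)\<^sup>2 / F (u x t) \<le> (norm y)\<^sup>2 / F (W2 y))))"
    if \<gamma>: "0 < \<gamma>" "\<gamma> < 1 / G" for \<gamma>
  proof -
    define g where "g = inverse \<gamma>"
    have g: "0 < g" "G < g" using \<gamma> G by (auto simp: g_def field_simps)
    have gRL: "RL \<le> g"
    proof -
      have "0 \<le> C' * (A0 + RU)" using C' A0 RU by simp
      then show ?thesis using g by (simp add: G_def)
    qed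
    define A where "A = g / C'"
    have "C' * (A0 + RU) \<le> g" using g RL by (simp add: G_def)
    then have AA: "A0 + RU \<le> A" using C' by (simp add: A_def field_simps)
    then have A: "A0 \<le> A" "RU \<le> A" "0 < A" using A0 RU by auto
    obtain R R1 R2 where R: "profile_ode ?N q2 R R1 R2" "\<forall>s\<ge>0. A \<le> R s \<and> R s \<le> C * A * (1 + s)"
      using ex[rule_format, OF A(1)] by blast
    have Rg: "A \<le> R s \<and> R s \<le> g * (s + 1)" if "0 \<le> s" for s
    proof -
      have "C * A \<le> C' * A" using C' A by (intro mult_right_mono) auto
      also have "\<dots> = g" using C' by (simp add: A_def)
      finally have "C * A * (1 + s) \<le> g * (1 + s)" using that by (intro mult_right_mono) auto
      then have "R s \<le> g * (s + 1)" using R(2)[rule_format, OF that] by (simp add: add.commute)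
      then show ?thesis using R(2)[rule_format, OF that] by blast
    qed
    have "0 < 2 * real ?N * g" using N g by simp
    \<comment> \<open>This value at 0 turns the lower bound P 0 (1 + s / (2 N)) into g (2 N + s),
      which exceeds g (s + 1).\<close>
    then obtain P P1 P2 where P: "profile_ode ?N 1 P P1 P2" "P 0 = 2 * real ?N * g"
      using profile_exists_exponential[OF _ N] by blast
    have Pg: "g * (s + 1) \<le> P s" if "0 \<le> s" for s
    proof -
      have N1: "1 \<le> real ?N" using N by simp
      then have "s + 1 \<le> 2 * real ?N + s" by linarith
      then have "g * (s + 1) \<le> g * (2 * real ?N + s)" using g by (intro mult_left_mono) auto
      also have "\<dots> = P 0 * (1 + s / (2 * real ?N))" unfolding P(2) using N1 by (simp add: distrib_left distrib_right)
      also have "\<dots> \<le> P s" by (rule profile_linear_lower_bound[OF P(1) order.refl N that])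
      finally show ?thesis .
    qed
    have "\<exists>u. global_solution f (\<lambda>x::real^'n. h (g * ((norm x)\<^sup>2 + 1))) u \<and>
        (\<forall>x t. 0 \<le> t \<longrightarrow> barrier P x t \<le> u x t \<and> u x t \<le> barrier R x t)"
    proof (rule global_solution_between_barriers[OF g(1) P(1) Pg R(1) Rg A(3)])
      show "1 \<le> f1 s * F s" if "0 < s" "g \<le> F s" for s using RL(2) that gRL by simp
      show "f1 s * F s \<le> q2" if "0 < s" "A \<le> F s" for s using RU(2) that A(2) by simp
    qed
    then obtain u where uu: "global_solution f (\<lambda>x::real^'n. h (g * ((norm x)\<^sup>2 + 1))) u \<and>
        (\<forall>x t. 0 \<le> t \<longrightarrow> barrier P x t \<le> u x t \<and> u x t \<le> barrier R x t)" ..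
    then have u: "global_solution f (\<lambda>x::real^'n. h (g * ((norm x)\<^sup>2 + 1))) u"
      "\<And>x t. 0 \<le> t \<Longrightarrow> barrier P x t \<le> u x t" "\<And>x t. 0 \<le> t \<Longrightarrow> u x t \<le> barrier R x t"
      by (simp_all only:)
    define W1 where "W1 y = h (P ((norm y)\<^sup>2))" for y :: "real^'n"
    define W2 where "W2 y = h (R ((norm y)\<^sup>2))" for y :: "real^'n"
    have W: "profile_solution f 1 W1" "profile_solution f q2 W2" "\<And>y. F (W1 y) = P ((norm y)\<^sup>2)" "\<And>y. F (W2 y) = R ((norm y)\<^sup>2)"
      using profile_solution_of_ode[OF P(1)] profile_solution_of_ode[OF R(1)] by (simp_all add: W1_def[abs_def] W2_def[abs_def])
    have "(norm y)\<^sup>2 / F (W1 y) \<le> (norm x)\<^sup>2 / F (u x t) \<and> (norm x)\<^sup>2 / F (u x t) \<le> (norm y)\<^sup>2 / F (W2 y)"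
      if t: "0 \<le> t" and y: "y = x /\<^sub>R sqrt (t + 1)" for x y t
    proof -
      let ?z = "(norm x)\<^sup>2 / (t + 1)"
      have ny: "(norm y)\<^sup>2 = ?z" using t by (simp add: y power_divide power_mult_distrib divide_inverse power_inverse)
      have z: "0 \<le> ?z" using t by simp
      have Pp: "0 < P ?z" and Rp: "0 < R ?z" using P(1) R(1) z unfolding profile_ode_def by blast+
      have bp: "0 < barrier P x t" "F (barrier P x t) = (t + 1) * P ?z"
        "0 < barrier R x t" "F (barrier R x t) = (t + 1) * R ?z"
        using barrier_props[OF P(1) t, of x] barrier_props[OF R(1) t, of x] by auto
      have up: "0 < u x t" using u(2)[OF t, of x] bp(1) by linarith
      have F1: "F (u x t) \<le> (t + 1) * P ?z" using F_le_iff[OF up bp(1)] u(2)[OF t, of x] bp(2) by simp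
      have F2: "(t + 1) * R ?z \<le> F (u x t)" using F_le_iff[OF bp(3) up] u(3)[OF t, of x] bp(4) by simp
      have "(norm x)\<^sup>2 / ((t + 1) * P ?z) \<le> (norm x)\<^sup>2 / F (u x t)"
        using F1 F_pos[OF up] Pp t by (intro divide_left_mono mult_pos_pos) auto
      moreover have "(norm x)\<^sup>2 / F (u x t) \<le> (norm x)\<^sup>2 / ((t + 1) * R ?z)"
        using F2 F_pos[OF up] Rp t by (intro divide_left_mono mult_pos_pos) auto
      ultimately show ?thesis by (simp add: W(3,4) ny)
    qed
    then have "\<forall>x t. t \<ge> 0 \<longrightarrow> (let y = x /\<^sub>R sqrt (t + 1) in
              (norm y)\<^sup>2 / F (W1 y) \<le> (norm x)\<^sup>2 / F (u x t) \<and>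
              (norm x)\<^sup>2 / F (u x t) \<le> (norm y)\<^sup>2 / F (W2 y))" by (simp only: Let_def) simp
    with u(1) W(1,2) show ?thesis unfolding g_def by (intro exI[of _ u] conjI exI[of _ W1] exI[of _ W2])
  qed
  \<comment> \<open>The lower exponent is 1 for every q; its place in the chain up to q is secured
    by \<open>q_ge_1\<close>.\<close>
  have "1 \<le> (1::real) \<and> 1 \<le> q \<and> q \<le> q2 \<and> q2 < 1 + real CARD('n) / 2 \<and>
    (\<forall>\<gamma>. 0 < \<gamma> \<and> \<gamma> < 1 / G \<longrightarrow>
      (\<exists>u :: real^'n \<Rightarrow> real \<Rightarrow> real.
        global_solution f (\<lambda>x. h (inverse \<gamma> * ((norm x)\<^sup>2 + 1))) u \<and>
        (\<exists>W1 W2 :: real^'n \<Rightarrow> real.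
          profile_solution f 1 W1 \<and> profile_solution f q2 W2 \<and>
          (\<forall>x t. t \<ge> 0 \<longrightarrow>
            (let y = x /\<^sub>R sqrt (t + 1) in
              (norm y)\<^sup>2 / F (W1 y) \<le> (norm x)\<^sup>2 / F (u x t) \<and>
              (norm x)\<^sup>2 / F (u x t) \<le> (norm y)\<^sup>2 / F (W2 y))))))"
    using q_ge_1 q2 main by simp
  moreover have "0 < 1 / G" using G by simp
  ultimately show ?thesis by blast
qed

end

theorem theorem1p2:
  fixes f :: "real \<Rightarrow> real" and q :: real
  assumes "C1_on {0..} f" and "C2_on {0<..} f"
    and "f 0 = 0"
    and "\<And>u. u > 0 \<Longrightarrow> f u > 0"
    and "\<And>u. u > 0 \<Longrightarrow> deriv f u > 0"
    and "\<And>u. u > 0 \<Longrightarrow> deriv (deriv f) u > 0"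
    and "\<And>u. u > 0 \<Longrightarrow> set_integrable lborel {u..} (\<lambda>s. 1 / f s)"
    and "((\<lambda>s. deriv f s * tail_int f s) \<longlongrightarrow> q) (at_right 0)"
    and "q < 1 + real CARD('n::finite) / 2"
    and "q = 1 \<Longrightarrow> \<exists>s0>0. \<forall>s. 0 < s \<and> s < s0 \<longrightarrow> deriv f s * tail_int f s \<ge> 1"
  shows "\<exists>\<gamma>s>0. \<exists>q1 q2. 1 \<le> q1 \<and> q1 \<le> q \<and> q \<le> q2 \<and> q2 < 1 + real CARD('n) / 2 \<and>
    (\<forall>\<gamma>. 0 < \<gamma> \<and> \<gamma> < \<gamma>s \<longrightarrow>
      (\<exists>u :: real^'n \<Rightarrow> real \<Rightarrow> real.
        global_solution f (\<lambda>x. tail_int_inv f (inverse \<gamma> * ((norm x)\<^sup>2 + 1))) u \<and>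
        (\<exists>W1 W2 :: real^'n \<Rightarrow> real.
          profile_solution f q1 W1 \<and> profile_solution f q2 W2 \<and>
          (\<forall>x t. t \<ge> 0 \<longrightarrow>
            (let y = x /\<^sub>R sqrt (t + 1) in
              (norm y)\<^sup>2 / tail_int f (W1 y) \<le> (norm x)\<^sup>2 / tail_int f (u x t) \<and>
              (norm x)\<^sup>2 / tail_int f (u x t) \<le> (norm y)\<^sup>2 / tail_int f (W2 y))))))"
proof -
  obtain f1 where f1: "\<And>x. 0 \<le> x \<Longrightarrow> (f has_real_derivative f1 x) (at x within {0..})"
    and cf1: "continuous_on {0..} f1"
    using assms(1) unfolding C1_on_def by auto
  have f1_eq: "deriv f x = f1 x" if "0 < x" for x
  proof (rule DERIV_imp_deriv)
    show "(f has_real_derivative f1 x) (at x)"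
      using f1[of x] at_within_atLeast_interior[OF that] that by simp
  qed
  \<comment> \<open>\<open>deriv f\<close> and \<open>f1\<close> agree at positive arguments, which
    is all that a limit from the right sees.\<close>
  have ev: "\<forall>\<^sub>F s in at_right 0. deriv f s * tail_int f s = f1 s * tail_int f s"
    using eventually_at_right_less[of "0::real"] by (rule eventually_mono) (simp add: f1_eq)
  interpret nonlinearity f f1 q
  proof
    show "0 < f1 u" if "0 < u" for u using assms(5)[OF that] f1_eq[OF that] by simp
    show "((\<lambda>s. f1 s * tail_int f s) \<longlongrightarrow> q) (at_right 0)"
      using assms(8) unfolding tendsto_cong[OF ev] .
  qed (use f1 cf1 assms(3,4,7) in auto)
  have "\<exists>s0>0. \<forall>s. 0 < s \<and> s < s0 \<longrightarrow> 1 \<le> f1 s * tail_int f s" if "q = 1"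
    using assms(10)[OF that] f1_eq by auto
  from existence_and_bounds[OF assms(9) this] show ?thesis .
qed

end
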